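(* Let $\xi\in\mathcal D\setminus\mathbb R^+$ and let $N,M$ be arbitrary non-negative integers. Let $\nu,\alpha,\beta$ be complex numbers with $\Re(2\nu+\alpha+\beta+1)>\Re(\alpha'+\beta')$. Write $\sigma=2\nu+\alpha+\beta$, $X_\pm=\dfrac{e^{\pm\xi}}{\sinh\xi}$, $Y_\pm=\dfrac{e^{\pm\xi}}{\cosh\xi}$, $$\kappa=\frac{\Gamma(\Re(\sigma-\alpha'-\beta')+1)}{|\Gamma(\sigma-\alpha'-\beta'+1)|},\qquad \rho_n(\mu)=\frac{\Gamma(\Re\mu+n+\frac12)}{|\Gamma(\mu+n+\frac12)|},\qquad H_K=\frac{|\Gamma(\sigma+2)|}{\Gamma(\Re(\sigma)+K+2)}.$$ Then $$\frac{\pi P_\nu^{(\alpha,\beta)}(\cosh(2\xi))}{2^{\sigma}B(\nu+\alpha+1,\nu+\beta+1)}=X_+^{\alpha+1/2}Y_+^{\beta+1/2}e^{2\nu\xi}\left(\sum_{n=0}^{N-1}(-1)^ng_n(\xi,\alpha,\beta)\frac{\Gamma(\sigma+2)}{\Gamma(\sigma+n+2)}+\widehat R_N^{(P1)}(\nu,\xi,\alpha,\beta)\right)$$ $$-\,C(\xi,\alpha)X_-^{\alpha+1/2}Y_-^{\beta+1/2}e^{-2\nu\xi}\left(\sum_{m=0}^{M-1}(-1)^mg_m(-\xi,\alpha,\beta)\frac{\Gamma(\sigma+2)}{\Gamma(\sigma+m+2)}+\widehat R_M^{(P2)}(\nu,\xi,\alpha,\beta)\right),$$ with remainder terms $\widehat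 R_N^{(P1)}$ (independent of $M$) and $\widehat R_M^{(P2)}$ (independent of $N$) satisfying all of the following. (i) If $-\frac12<\Re\alpha<N+\frac12$ and $|\Re\beta|<\frac12$, then $$|\widehat R_N^{(P1)}|\le\kappa H_N\rho_0(\alpha')\rho_0(\beta')\hat a_N(\alpha)\hat a_0(\beta)|X_+|^N\,|1-e^{4\xi}|\,|\csc(2\Im\xi)|$$ $$+\,\kappa H_N\rho_0(\beta')\sum_{\ell=0}^{N-1}\rho_\ell(\alpha')|a_\ell(\alpha)|\,\hat a_{N-\ell}(\beta)|X_+|^\ell|Y_+|^{N-\ell}\times\begin{cases}|1+e^{2\xi}|\,|\csc(2\Im\xi)|&\text{if }-1<\Re(e^{-2\xi})\le0,\\|1+e^{2\xi}|&\text{if }0<\Re(e^{-2\xi}).\end{cases}$$ (ii) If $|\Re\alpha|<\frac12$ and $-\frac12<\Re\beta<N+\frac12$, then $$|\widehat R_N^{(P1)}|\le\kappa H_N\rho_0(\alpha')\rho_0(\beta')\hat a_0(\alpha)\hat a_N(\beta)|Y_+|^N\,|1-e^{4\xi}|\,|\csc(2\Im\xi)|$$ $$+\,\kappa H_N\rho_0(\alpha')\sum_{\ell=1}^{N}\rho_{N-\ell}(\beta')\hat a_\ell(\alpha)|a_{N-\ell}(\beta)|\,|X_+|^\ell|Y_+|^{N-\ell}\times\begin{cases}|1-e^{2\xi}|\,|\csc(2\Im\xi)|&\text{if }0\le\Re(e^{-2\xi})<1,\\|1-e^{2\xi}|&\text{if }\Re(e^{-2\xi})<0.\end{cases}$$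 (iii) If $|\Re\alpha|,|\Re\beta|<\frac12$, then $$|\widehat R_N^{(P1)}|\le\kappa H_N\rho_0(\alpha')\rho_0(\beta')\sum_{\ell=0}^N\hat a_\ell(\alpha)\hat a_{N-\ell}(\beta)|X_+|^\ell|Y_+|^{N-\ell}\times|1-e^{4\xi}|\,|\csc(2\Im\xi)|.$$ For the other remainder put $$T(\xi)=\begin{cases}|1\pm e^{-2\xi}|&\text{if }1\le\pm\Re(e^{2\xi}),\\|1-e^{-4\xi}|\,|\csc(2\Im\xi)|&\text{if }|\Re(e^{2\xi})|<1.\end{cases}$$ (iv) If $-\frac12<\Re\alpha<M+\frac12$ and $|\Re\beta|<\frac12$, then $$|\widehat R_M^{(P2)}|\le\kappa H_M\rho_0(\alpha')\rho_0(\beta')\hat a_M(\alpha)\hat a_0(\beta)|X_-|^M\,T(\xi)$$ $$+\,\kappa H_M\rho_0(\beta')\sum_{\ell=0}^{M-1}\rho_\ell(\alpha')|a_\ell(\alpha)|\,\hat a_{M-\ell}(\beta)|X_-|^\ell|Y_-|^{M-\ell}\times\begin{cases}1&\text{if }\Re(e^{2\xi})\le-1,\\|1+e^{-2\xi}|\,|\csc(2\Im\xi)|&\text{if }-1<\Re(e^{2\xi})\le0,\\|1+e^{-2\xi}|&\text{if }0<\Re(e^{2\xi}).\end{cases}$$ (v) If $|\Re\alpha|<\frac12$ and $-\frac12<\Re\beta<M+\frac12$, then $$|\widehat R_M^{(P2)}|\le\kappa H_M\rho_0(\alpha')\rho_0(\beta')\hat a_0(\alpha)\hat a_M(\beta)|Y_-|^M\,T(\xi)$$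 $$+\,\kappa H_M\rho_0(\alpha')\sum_{\ell=1}^{M}\rho_{M-\ell}(\beta')\hat a_\ell(\alpha)|a_{M-\ell}(\beta)|\,|X_-|^\ell|Y_-|^{M-\ell}\times\begin{cases}1&\text{if }1\le\Re(e^{2\xi}),\\|1-e^{-2\xi}|\,|\csc(2\Im\xi)|&\text{if }0\le\Re(e^{2\xi})<1,\\|1-e^{-2\xi}|&\text{if }\Re(e^{2\xi})<0.\end{cases}$$ (vi) If $|\Re\alpha|,|\Re\beta|<\frac12$, then $$|\widehat R_M^{(P2)}|\le\kappa H_M\rho_0(\alpha')\rho_0(\beta')\sum_{\ell=0}^M\hat a_\ell(\alpha)\hat a_{M-\ell}(\beta)|X_-|^\ell|Y_-|^{M-\ell}\times T(\xi).$$
   Context: $\mathbf F\left({a,b\atop c};x\right)$ is the regularised hypergeometric function, $\sum_{n\ge0}\frac{(a)_n(b)_n}{\Gamma(c+n)\,n!}x^n$ for $|x|<1$, continued analytically to $x\in\mathbb C\setminus[1,\infty)$; $(w)_n=w(w+1)\cdots(w+n-1)$, $(w)_0=1$; $B$ is the beta function; $\mathbb Z^-=\{-1,-2,\dots\}$. The Jacobi function of the first kind is $$P_\nu^{(\alpha,\beta)}(z)=\frac{\Gamma(\nu+\alpha+1)}{\Gamma(\nu+1)}\mathbf F\left({-\nu,\nu+\alpha+\beta+1\atop \alpha+1};\frac{1-z}{2}\right),\quad z\in\mathbb C\setminus(-\infty,-1],\ \nu+\alpha\notin\mathbb Z^-.$$ Parameters are understood to be such that the functions appearing are defined. $\mathcal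 D=\{\xi:\Re\xi>0,\ |\Im\xi|<\frac\pi2\}$. For $\xi\in\mathcal D$: $C(\xi,\alpha)=\sin(\pi\alpha)$ if $\xi>0$, and $C(\xi,\alpha)=\mp i e^{\pm\pi i\alpha}$ if $0<\pm\Im\xi<\frac\pi2$. The numbers $\alpha',\beta'$ are: $\alpha'=\alpha$ if $\Re\alpha\ge\frac12$; $\alpha'=-\alpha$ if $\Re\alpha\le-\frac12$; and if $-\frac12<\Re\alpha<\frac12$, $\alpha'$ is either of $\alpha,-\alpha$, chosen arbitrarily; $\beta'$ is obtained from $\beta$ in the same way. Also $$a_n(\mu)=\frac{(\frac12+\mu)_n(\frac12-\mu)_n}{(-2)^n n!},\qquad g_n(\pm\xi,\alpha,\beta)=\sum_{\ell=0}^n(\pm1)^\ell a_\ell(\alpha)a_{n-\ell}(\beta)\left(\frac{e^{\pm\xi}}{\sinh\xi}\right)^\ell\left(\frac{e^{\pm\xi}}{\cosh\xi}\right)^{n-\ell},$$ $$\hat a_n(\mu)=\left|\frac{\cos(\pi\mu)}{\cos(\pi\Re\mu)}\,a_n(\Re\mu)\right|,$$ where, if $2\Re\mu$ is an odd integer, $a_n(\Re\mu)/\cos(\pi\Re\mu)$ in $\hat a_n(\mu)$ is replaced by its limiting value $\lim_{x\to\Re\mu}a_n(x)/\cos(\pi x)$ (used only for $|\Re\mu|<n+\frac12$). Fractional powers of $X_\pm$, $Y_\pm$ are positive-based (real logarithm of the base) for $\xi>0$ and are defined by continuity elsewhere in $\mathcal D$. *)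

theory Defs
  imports "HOL-Complex_Analysis.Complex_Analysis"
begin

section \<open>The regularised hypergeometric function and the Jacobi function\<close>

definition slit_plane :: "complex set" where
  "slit_plane = - (complex_of_real ` {1..})"

definition is_reg_2F1 :: "complex \<Rightarrow> complex \<Rightarrow> complex \<Rightarrow> (complex \<Rightarrow> complex) \<Rightarrow> bool" where
  "is_reg_2F1 a b c f \<longleftrightarrow> f holomorphic_on slit_plane \<and>
     (\<forall>x. norm x < 1 \<longrightarrow>
        (\<lambda>n. pochhammer a n * pochhammer b n * rGamma (c + of_nat n) / fact n * x ^ n) sums f x)"

text \<open>The analytic continuation of the power series to the slit plane. Using the entire function
  \<^const>\<open>rGamma\<close> for the reciprocal Gamma function makes sense of every complex \<open>c\<close>.\<close>

definition reg_2F1 :: "complex \<Rightarrow> complex \<Rightarrow> complex \<Rightarrow> complex \<Rightarrow> complex" where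
  "reg_2F1 a b c x = (THE w. \<exists>f. is_reg_2F1 a b c f \<and> f x = w)"

lemma reg_2F1_eqI:
  assumes f: "is_reg_2F1 a b c f" and x: "x \<in> slit_plane"
  shows "reg_2F1 a b c x = f x"
proof -
  have cl: "closed (complex_of_real ` {1..})"
    by (intro closed_injective_linear_image) (auto intro: linearI simp: inj_on_def scaleR_conv_of_real)
  have op: "open slit_plane"
    using cl by (simp add: slit_plane_def open_Compl)
  have "starlike slit_plane"
    unfolding starlike_def
  proof (intro bexI[of _ 0] ballI subsetI)
    fix z y assume z: "z \<in> slit_plane" and y: "y \<in> closed_segment 0 z"
    from y obtain u where u: "0 \<le> u" "u \<le> 1" "y = u *\<^sub>R z"
      by (auto simp: closed_segment_def)
    show "y \<in> slit_plane"
    proof (rule ccontr)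
      assume "y \<notin> slit_plane"
      then obtain t where t: "t \<ge> 1" "u *\<^sub>R z = of_real t"
        using u by (auto simp: slit_plane_def)
      hence "u \<noteq> 0" by auto
      hence "z = of_real (t / u)"
        using t by (simp add: scaleR_conv_of_real field_simps)
      moreover have "t / u \<ge> 1" using t u \<open>u \<noteq> 0\<close> by (simp add: field_simps)
      ultimately show False using z unfolding slit_plane_def by blast
    qed
  qed (auto simp: slit_plane_def)
  hence conn: "connected slit_plane"
    by (rule starlike_imp_connected)
  have sub: "ball 0 1 \<subseteq> slit_plane"
    by (auto simp: slit_plane_def)
  have "g x = f x" if g: "is_reg_2F1 a b c g" for g
  proof (rule analytic_continuation_open[of "ball 0 1" slit_plane g f])
    show "g z = f z" if "z \<in> ball 0 1" for z
      using f g that unfolding is_reg_2F1_def by (auto intro: sums_unique2)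
  qed (use f g op conn sub x in \<open>auto simp: is_reg_2F1_def\<close>)
  thus ?thesis
    unfolding reg_2F1_def using f by blast
qed

definition jacobi_P :: "complex \<Rightarrow> complex \<Rightarrow> complex \<Rightarrow> complex \<Rightarrow> complex" where
  "jacobi_P \<nu> \<alpha> \<beta> z =
     Gamma (\<nu> + \<alpha> + 1) * rGamma (\<nu> + 1) * reg_2F1 (- \<nu>) (\<nu> + \<alpha> + \<beta> + 1) (\<alpha> + 1) ((1 - z) / 2)"


section \<open>The domain and the algebraic prefactors\<close>

definition strip_D :: "complex set" where
  "strip_D = {\<xi>. Re \<xi> > 0 \<and> \<bar>Im \<xi>\<bar> < pi / 2}"

definition Xp :: "complex \<Rightarrow> complex" where "Xp \<xi> = exp \<xi> / sinh \<xi>"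
definition Xm :: "complex \<Rightarrow> complex" where "Xm \<xi> = exp (- \<xi>) / sinh \<xi>"
definition Yp :: "complex \<Rightarrow> complex" where "Yp \<xi> = exp \<xi> / cosh \<xi>"
definition Ym :: "complex \<Rightarrow> complex" where "Ym \<xi> = exp (- \<xi>) / cosh \<xi>"

text \<open>The four functions avoid the branch cut of \<^const>\<open>Ln\<close> on \<^const>\<open>strip_D\<close> and are positive on
  the positive real axis. So the branches of their powers that are positive-based for \<open>\<xi> > 0\<close> and
  extended by continuity to \<^const>\<open>strip_D\<close> are the principal ones, given by \<open>powr\<close>.\<close>

lemma strip_D_nz:
  assumes "\<xi> \<in> strip_D"
  shows "sinh \<xi> \<noteq> 0" "cosh \<xi> \<noteq> 0"
proof -
  have n: "norm (exp \<xi>) > norm (exp (- \<xi>))"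
    using assms by (simp add: strip_D_def)
  show "sinh \<xi> \<noteq> 0"
  proof
    assume "sinh \<xi> = 0"
    hence "exp \<xi> = exp (- \<xi>)" by (simp add: sinh_field_def)
    thus False using n by (metis less_irrefl)
  qed
  show "cosh \<xi> \<noteq> 0"
  proof
    assume "cosh \<xi> = 0"
    hence "exp \<xi> = - exp (- \<xi>)" by (simp add: cosh_field_def eq_neg_iff_add_eq_0)
    hence "norm (exp \<xi>) = norm (exp (- \<xi>))" by (metis norm_minus_cancel)
    thus False using n by simp
  qed
qed

lemma strip_D_aux:
  assumes "\<xi> \<in> strip_D" and "(e::complex) \<in> {1, -1}"
  shows "2 / (1 + e * exp (- 2 * \<xi>)) \<notin> \<real>\<^sub>\<le>\<^sub>0"
    and "2 / (exp (2 * \<xi>) + e) \<notin> \<real>\<^sub>\<le>\<^sub>0"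
proof -
  have inv: "2 / w \<notin> \<real>\<^sub>\<le>\<^sub>0" if "w \<notin> \<real>\<^sub>\<le>\<^sub>0" for w :: complex
  proof
    assume "2 / w \<in> \<real>\<^sub>\<le>\<^sub>0"
    then obtain t where t: "t \<le> 0" "2 / w = of_real t"
      by (auto simp: nonpos_Reals_def)
    have "w \<noteq> 0" using that by auto
    hence "t \<noteq> 0" using t by auto
    hence "w = of_real (2 / t)" using t \<open>w \<noteq> 0\<close> by (simp add: field_simps)
    moreover have "2 / t \<le> 0" using t by (simp add: divide_nonneg_nonpos)
    ultimately show False using that by (auto simp: complex_nonpos_Reals_iff)
  qed
  have ne: "norm e = 1" using assms by auto
  have x: "Re \<xi> > 0" "\<bar>Im \<xi>\<bar> < pi / 2" using assms by (auto simp: strip_D_def)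
  have "norm (e * exp (- 2 * \<xi>)) < 1"
    using x ne by (simp add: norm_mult)
  hence "Re (1 + e * exp (- 2 * \<xi>)) > 0"
    using abs_Re_le_cmod[of "e * exp (- 2 * \<xi>)"] by simp
  thus "2 / (1 + e * exp (- 2 * \<xi>)) \<notin> \<real>\<^sub>\<le>\<^sub>0"
    by (intro inv) (auto simp: complex_nonpos_Reals_iff)
  show "2 / (exp (2 * \<xi>) + e) \<notin> \<real>\<^sub>\<le>\<^sub>0"
  proof (intro inv notI)
    assume "exp (2 * \<xi>) + e \<in> \<real>\<^sub>\<le>\<^sub>0"
    hence "Im (exp (2 * \<xi>) + e) = 0" and le: "Re (exp (2 * \<xi>) + e) \<le> 0"
      by (auto simp: complex_nonpos_Reals_iff)
    moreover have "Im e = 0" using assms by auto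
    ultimately have "sin (2 * Im \<xi>) = 0" by (simp add: Im_exp)
    moreover have "-pi < 2 * Im \<xi>" "2 * Im \<xi> < pi" using x by auto
    ultimately have "2 * Im \<xi> = 0" using sin_eq_0_pi by blast
    hence "Re (exp (2 * \<xi>)) = exp (2 * Re \<xi>)" by (simp add: Re_exp)
    moreover have "exp (2 * Re \<xi>) > 1" using x by simp
    moreover have "Re e \<ge> -1" using assms by auto
    ultimately show False using le unfolding plus_complex.sel by linarith
  qed
qed

lemma XY_alt:
  "Xp \<xi> = 2 / (1 + (-1) * exp (- 2 * \<xi>))" "Yp \<xi> = 2 / (1 + 1 * exp (- 2 * \<xi>))"
  "Xm \<xi> = 2 / (exp (2 * \<xi>) + (-1))" "Ym \<xi> = 2 / (exp (2 * \<xi>) + 1)"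
proof -
  have e: "exp (- 2 * \<xi>) = exp (- \<xi>) / exp \<xi>" "exp (2 * \<xi>) = exp \<xi> / exp (- \<xi>)"
    by (simp_all flip: exp_diff)
  show "Xp \<xi> = 2 / (1 + (-1) * exp (- 2 * \<xi>))"
    unfolding Xp_def sinh_field_def e by (simp add: divide_simps)
  show "Yp \<xi> = 2 / (1 + 1 * exp (- 2 * \<xi>))"
    unfolding Yp_def cosh_field_def e by (simp add: divide_simps)
  show "Xm \<xi> = 2 / (exp (2 * \<xi>) + (-1))"
    unfolding Xm_def sinh_field_def e by (simp add: divide_simps)
  show "Ym \<xi> = 2 / (exp (2 * \<xi>) + 1)"
    unfolding Ym_def cosh_field_def e by (simp add: divide_simps)
qed

lemma XY_notin_cut:
  assumes "\<xi> \<in> strip_D"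
  shows "Xp \<xi> \<notin> \<real>\<^sub>\<le>\<^sub>0" "Xm \<xi> \<notin> \<real>\<^sub>\<le>\<^sub>0" "Yp \<xi> \<notin> \<real>\<^sub>\<le>\<^sub>0" "Ym \<xi> \<notin> \<real>\<^sub>\<le>\<^sub>0"
  unfolding XY_alt using strip_D_aux[OF assms, of 1] strip_D_aux[OF assms, of "-1"] by auto

lemma continuous_on_XY_powr:
  "continuous_on strip_D (\<lambda>\<xi>. Xp \<xi> powr s)" "continuous_on strip_D (\<lambda>\<xi>. Xm \<xi> powr s)"
  "continuous_on strip_D (\<lambda>\<xi>. Yp \<xi> powr s)" "continuous_on strip_D (\<lambda>\<xi>. Ym \<xi> powr s)"
proof -
  have c: "continuous_on strip_D Xp" "continuous_on strip_D Xm"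
    "continuous_on strip_D Yp" "continuous_on strip_D Ym"
    unfolding Xp_def Xm_def Yp_def Ym_def using strip_D_nz
    by (auto intro!: continuous_intros simp: sinh_field_def cosh_field_def)
  have p: "continuous_on strip_D (\<lambda>\<xi>. f \<xi> powr s)"
    if "continuous_on strip_D f" "\<And>\<xi>. \<xi> \<in> strip_D \<Longrightarrow> f \<xi> \<notin> \<real>\<^sub>\<le>\<^sub>0" for f :: "complex \<Rightarrow> complex"
  proof (rule continuous_on_eq[of _ "\<lambda>\<xi>. exp (s * Ln (f \<xi>))"])
    show "continuous_on strip_D (\<lambda>\<xi>. exp (s * Ln (f \<xi>)))"
      using that by (intro continuous_intros) auto
    show "exp (s * Ln (f \<xi>)) = f \<xi> powr s" if "\<xi> \<in> strip_D" for \<xi>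
      using \<open>\<And>\<xi>. \<xi> \<in> strip_D \<Longrightarrow> f \<xi> \<notin> \<real>\<^sub>\<le>\<^sub>0\<close>[OF that] by (auto simp: powr_def)
  qed
  show "continuous_on strip_D (\<lambda>\<xi>. Xp \<xi> powr s)" "continuous_on strip_D (\<lambda>\<xi>. Xm \<xi> powr s)"
    "continuous_on strip_D (\<lambda>\<xi>. Yp \<xi> powr s)" "continuous_on strip_D (\<lambda>\<xi>. Ym \<xi> powr s)"
    using c XY_notin_cut by (auto intro!: p)
qed

lemma XY_powr_pos:
  assumes "t > 0"
  shows "Xp (of_real t) powr s = exp (s * of_real (ln (exp t / sinh t)))"
    and "Xm (of_real t) powr s = exp (s * of_real (ln (exp (- t) / sinh t)))"
    and "Yp (of_real t) powr s = exp (s * of_real (ln (exp t / cosh t)))"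
    and "Ym (of_real t) powr s = exp (s * of_real (ln (exp (- t) / cosh t)))"
proof -
  have sc: "sinh (complex_of_real t) = of_real (sinh t)" "cosh (complex_of_real t) = of_real (cosh t)"
    by (simp_all add: sinh_field_def cosh_field_def exp_of_real flip: of_real_minus)
  have e: "Xp (of_real t) = of_real (exp t / sinh t)" "Xm (of_real t) = of_real (exp (- t) / sinh t)"
    "Yp (of_real t) = of_real (exp t / cosh t)" "Ym (of_real t) = of_real (exp (- t) / cosh t)"
    unfolding Xp_def Xm_def Yp_def Ym_def sc by (simp_all add: exp_of_real flip: of_real_minus)
  have p: "of_real r powr s = exp (s * of_real (ln r))" if "r > 0" for r :: real
    using that by (simp add: powr_def Ln_of_real)
  have "sinh t > 0" "cosh t > 0" using assms by (simp_all add: cosh_real_pos)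
  thus "Xp (of_real t) powr s = exp (s * of_real (ln (exp t / sinh t)))"
    "Xm (of_real t) powr s = exp (s * of_real (ln (exp (- t) / sinh t)))"
    "Yp (of_real t) powr s = exp (s * of_real (ln (exp t / cosh t)))"
    "Ym (of_real t) powr s = exp (s * of_real (ln (exp (- t) / cosh t)))"
    unfolding e by (intro p; simp)+
qed

definition conn_C :: "complex \<Rightarrow> complex \<Rightarrow> complex" where
  "conn_C \<xi> \<alpha> =
     (if Im \<xi> = 0 then sin (of_real pi * \<alpha>)
      else if Im \<xi> > 0 then - \<i> * exp (of_real pi * \<i> * \<alpha>)
      else \<i> * exp (- (of_real pi * \<i> * \<alpha>)))"


section \<open>Coefficients\<close>

definition coeff_a :: "nat \<Rightarrow> 'a::field_char_0 \<Rightarrow> 'a" where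
  "coeff_a n \<mu> = pochhammer (1/2 + \<mu>) n * pochhammer (1/2 - \<mu>) n / ((-2) ^ n * fact n)"

definition coeff_g :: "nat \<Rightarrow> complex \<Rightarrow> complex \<Rightarrow> complex \<Rightarrow> complex" where
  "coeff_g n \<xi> \<alpha> \<beta> =
     (\<Sum>l\<le>n. coeff_a l \<alpha> * coeff_a (n - l) \<beta> * (exp \<xi> / sinh \<xi>) ^ l * (exp \<xi> / cosh \<xi>) ^ (n - l))"

text \<open>The formula for \<open>g\<^sub>n(-\<xi>,\<alpha>,\<beta>)\<close> is obtained from that for \<open>g\<^sub>n(\<xi>,\<alpha>,\<beta>)\<close> by negating \<open>\<xi>\<close>, the sign
  \<open>(-1)\<^sup>l\<close> coming from \<open>sinh(-\<xi>) = -sinh \<xi>\<close>.\<close>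

lemma coeff_g_XY:
  "coeff_g n \<xi> \<alpha> \<beta> =
     (\<Sum>l\<le>n. coeff_a l \<alpha> * coeff_a (n - l) \<beta> * Xp \<xi> ^ l * Yp \<xi> ^ (n - l))"
  "coeff_g n (- \<xi>) \<alpha> \<beta> =
     (\<Sum>l\<le>n. (-1) ^ l * coeff_a l \<alpha> * coeff_a (n - l) \<beta> * Xm \<xi> ^ l * Ym \<xi> ^ (n - l))"
proof -
  show "coeff_g n \<xi> \<alpha> \<beta> =
     (\<Sum>l\<le>n. coeff_a l \<alpha> * coeff_a (n - l) \<beta> * Xp \<xi> ^ l * Yp \<xi> ^ (n - l))"
    by (simp add: coeff_g_def Xp_def Yp_def)
  have "(exp (- \<xi>) / sinh (- \<xi>)) ^ l = (-1) ^ l * Xm \<xi> ^ l" for l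
    unfolding Xm_def power_mult_distrib[symmetric] by simp
  thus "coeff_g n (- \<xi>) \<alpha> \<beta> =
     (\<Sum>l\<le>n. (-1) ^ l * coeff_a l \<alpha> * coeff_a (n - l) \<beta> * Xm \<xi> ^ l * Ym \<xi> ^ (n - l))"
    by (simp add: coeff_g_def Ym_def mult_ac)
qed

definition hat_a :: "nat \<Rightarrow> complex \<Rightarrow> real" where
  "hat_a n \<mu> = cmod (cos (of_real pi * \<mu>) * of_real
     (if \<exists>k::int. odd k \<and> 2 * Re \<mu> = of_int k
      then Lim (at (Re \<mu>)) (\<lambda>x::real. coeff_a n x / cos (pi * x))
      else coeff_a n (Re \<mu>) / cos (pi * Re \<mu>)))"

text \<open>The admissible choices of \<open>\<mu>'\<close> for a parameter \<open>\<mu>\<close>.\<close>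

definition primed :: "complex \<Rightarrow> complex \<Rightarrow> bool" where
  "primed \<mu> \<mu>' \<longleftrightarrow>
     (Re \<mu> \<ge> 1/2 \<longrightarrow> \<mu>' = \<mu>) \<and>
     (Re \<mu> \<le> -1/2 \<longrightarrow> \<mu>' = - \<mu>) \<and>
     (-1/2 < Re \<mu> \<and> Re \<mu> < 1/2 \<longrightarrow> \<mu>' = \<mu> \<or> \<mu>' = - \<mu>)"

definition rho :: "nat \<Rightarrow> complex \<Rightarrow> real" where
  "rho n \<mu> = Gamma (Re \<mu> + real n + 1/2) / cmod (Gamma (\<mu> + of_nat n + 1/2))"

definition kappa :: "complex \<Rightarrow> complex \<Rightarrow> complex \<Rightarrow> real" where
  "kappa \<sigma> \<alpha>' \<beta>' = Gamma (Re (\<sigma> - \<alpha>' - \<beta>') + 1) / cmod (Gamma (\<sigma> - \<alpha>' - \<beta>' + 1))"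

definition fac_H :: "nat \<Rightarrow> complex \<Rightarrow> real" where
  "fac_H K \<sigma> = cmod (Gamma (\<sigma> + 2)) / Gamma (Re \<sigma> + real K + 2)"

definition abs_csc :: "complex \<Rightarrow> real" where
  "abs_csc \<xi> = \<bar>1 / sin (2 * Im \<xi>)\<bar>"

definition fac_T :: "complex \<Rightarrow> real" where
  "fac_T \<xi> =
     (if 1 \<le> Re (exp (2 * \<xi>)) then cmod (1 + exp (- 2 * \<xi>))
      else if 1 \<le> - Re (exp (2 * \<xi>)) then cmod (1 - exp (- 2 * \<xi>))
      else cmod (1 - exp (- 4 * \<xi>)) * abs_csc \<xi>)"

end

theory Submission
  imports Defs
begin

text \<open>Put \<open>W = exp (- 2 * \<xi>)\<close> in the growing part and \<open>W = exp (2 * \<xi>)\<close> in the decaying one. Up to elementary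
  factors each part is an Appell function \<open>F\<^sub>3\<close> with parameters \<open>1/2 \<plusminus> \<alpha>\<close>, \<open>1/2 \<plusminus> \<beta>\<close> and arguments
  \<open>x = 1 / (1 - W)\<close>, \<open>y = 1 / (1 + W)\<close>. Since it depends only on the unordered parameter pairs, it may be written
  as a double integral of \<open>(1 - s x) powr (A - 1/2) * (1 - t y) powr (B - 1/2)\<close> over the simplex
  with \<open>A = \<plusminus> \<alpha>\<close>, \<open>B = \<plusminus> \<beta>\<close> of real part above \<open>- 1/2\<close>. Expanding both binomials gives the inverse
  factorial series. Their remainders are Stieltjes integrals with kernels \<open>1 / (1 - s x)\<close> and \<open>1 / (1 - t y)\<close>, whose suprema
  are read off the distance of \<open>W\<close> to \<open>[0, 1]\<close> and to \<open>[- 1, 0]\<close>.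

  With \<open>\<tau> = tanh \<xi>\<close>, the decomposition into the two parts is Cauchy's theorem on the triangle with
  vertices \<open>- \<tau>\<close>, \<open>\<tau>\<close>, \<open>1\<close>: integrating one variable out of the double integrals leaves integrals over the sides
  through \<open>1\<close>, while the integral over \<open>[- \<tau>, \<tau>]\<close> is a hypergeometric function of \<open>\<tau>\<^sup>2\<close>.
  Analytic continuation in the parameters and in \<open>\<xi>\<close> removes the restrictions of that argument.\<close>

section \<open>Integrals depending on a parameter and beta integrals\<close>

text \<open>The double integral converges only for \<open>Re A > - 1/2\<close> and
  \<open>Re B > - 1/2\<close>, which the sign choice in \<open>primed\<close> secures. The factors
  \<open>kappa\<close> and \<open>rho\<close> are the price of taking moduli inside beta integrals:
  a Gamma function at the real part, divided by the modulus of the Gamma function. Non-real \<xi>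
  keeps W off the real axis, hence x and y off the cut of the powers. The obstacle is the choice A =
  - \<alpha>. The triangle needs A = \<alpha> with \<open>Re \<alpha> > 1/2\<close>, since the
  integrand must stay continuous at \<plusminus> \<tau>, whereas A = - \<alpha> is admissible only
  for \<open>Re \<alpha> < 1/2\<close>, and these ranges are disjoint. So the relation is continued
  with A = \<alpha> down to \<open>Re \<alpha> > - 1/2\<close>, transferred to A = - \<alpha> where
  |Re \<alpha>| < 1/2 and both integrals agree, and only then continued to the left. In all this
  \<sigma> has to move along with \<alpha>, because \<open>Re (\<sigma> + 1) > Re (A + B)\<close>
  must persist. In \<xi> the relation is obtained near 0 and continued separately to the two halves
  of the strip, where C(\<xi>, \<alpha>) takes different forms.\<close>

lemma holomorphic_on_integral_parameter:
  fixes f :: "complex \<Rightarrow> 'a \<Rightarrow> complex"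
  assumes A: "open A"
    and hol: "\<And>x. x \<in> space M \<Longrightarrow> (\<lambda>z. f z x) holomorphic_on A"
    and meas: "\<And>z. z \<in> A \<Longrightarrow> f z \<in> borel_measurable M"
    and dom: "\<And>z. z \<in> A \<Longrightarrow> \<exists>r>0. \<exists>g. cball z r \<subseteq> A \<and> integrable M g \<and>
                (\<forall>y\<in>cball z r. \<forall>x\<in>space M. cmod (f y x) \<le> g x)"
  shows "(\<lambda>z. integral\<^sup>L M (f z)) holomorphic_on A"
proof -
  have int: "integrable M (f z)" if z: "z \<in> A" for z
  proof -
    obtain r g where r: "r > 0" "integrable M g" "\<And>y x. y \<in> cball z r \<Longrightarrow> x \<in> space M \<Longrightarrow> cmod (f y x) \<le> g x"
      using dom[OF z] by blast
    have le: "norm (f z x) \<le> norm (g x)" if "x \<in> space M" for x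
      using r(3)[of z x] that r(1) by (auto intro: order_trans)
    show ?thesis
      by (rule Bochner_Integration.integrable_bound[OF r(2) meas[OF z]]) (intro AE_I2, rule le, assumption)
  qed
  have "\<exists>D. ((\<lambda>z. integral\<^sup>L M (f z)) has_field_derivative D) (at z)" if z: "z \<in> A" for z
  proof -
    obtain r g where r: "r > 0" "cball z r \<subseteq> A" and g: "integrable M g"
      and le: "\<And>y x. y \<in> cball z r \<Longrightarrow> x \<in> space M \<Longrightarrow> cmod (f y x) \<le> g x"
      using dom[OF z] by blast
    define D where "D = (\<integral>x. deriv (\<lambda>z. f z x) z \<partial>M)"
    \<comment> \<open>Cauchy's estimate on discs of radius r/2 bounds the derivative by 2/r times g.
      So the difference quotients inherit a dominating function from f, and no bound on the
      derivative has to be assumed.\<close>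
    have lip: "cmod (f y x - f z x) \<le> 2 / r * g x * cmod (y - z)"
      if y: "y \<in> cball z (r/2)" and x: "x \<in> space M" for x y
    proof (rule field_differentiable_bound[of "cball z (r/2)" "\<lambda>z. f z x" "deriv (\<lambda>z. f z x)"])
      fix w assume w: "w \<in> cball z (r/2)"
      have sub: "cball w (r/2) \<subseteq> cball z r"
        using w by (simp add: cball_subset_cball_iff dist_commute)
      have wA: "w \<in> A" using sub r w by (auto simp: subset_iff)
      show "((\<lambda>z. f z x) has_field_derivative deriv (\<lambda>z. f z x) w) (at w within cball z (r/2))"
        by (rule has_field_derivative_at_within, rule holomorphic_derivI[OF hol[OF x] A wA])
      have "cmod ((deriv ^^ 1) (\<lambda>z. f z x) w) \<le> fact 1 * g x / (r/2) ^ 1"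
      proof (rule Cauchy_inequality)
        show "(\<lambda>z. f z x) holomorphic_on ball w (r/2)"
          by (rule holomorphic_on_subset[OF hol[OF x]]) (use sub r ball_subset_cball in blast)
        show "continuous_on (cball w (r/2)) (\<lambda>z. f z x)"
          by (rule continuous_on_subset[OF holomorphic_on_imp_continuous_on[OF hol[OF x]]]) (use sub r in blast)
        show "cmod (f y x) \<le> g x" if "cmod (w - y) = r/2" for y
          by (rule le[OF _ x]) (use sub that in \<open>auto simp: dist_norm\<close>)
      qed (use r in auto)
      thus "norm (deriv (\<lambda>z. f z x) w) \<le> 2 / r * g x" by (simp add: field_simps)
    qed (use y r in auto)
    have "((\<lambda>y. (integral\<^sup>L M (f y) - integral\<^sup>L M (f z)) / (y - z)) \<longlongrightarrow> D) (at z)"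
      unfolding tendsto_at_iff_sequentially
    proof (intro allI impI)
      fix X :: "nat \<Rightarrow> complex"
      assume Xn: "\<forall>i. X i \<in> UNIV - {z}" and X: "X \<longlonglongrightarrow> z"
      from X r(1) have "eventually (\<lambda>n. dist (X n) z < r/2) sequentially"
        using half_gt_zero tendstoD by blast
      then obtain K where K: "\<And>n. n \<ge> K \<Longrightarrow> dist (X n) z < r/2" by (auto simp: eventually_sequentially)
      have KA: "X (n + K) \<in> A" for n
        using K[of "n+K"] r by (intro subsetD[OF r(2)]) (simp add: dist_commute)
      have "(\<lambda>n. \<integral>x. (f (X (n + K)) x - f z x) / (X (n + K) - z) \<partial>M) \<longlonglongrightarrow> D"
        unfolding D_def
      proof (rule integral_dominated_convergence[where w = "\<lambda>x. 2 / r * g x"])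
        have lim: "(\<lambda>n. (f (X (n + K)) x - f z x) / (X (n + K) - z)) \<longlonglongrightarrow> deriv (\<lambda>z. f z x) z"
          if x: "x \<in> space M" for x
        proof -
          have "((\<lambda>y. (f y x - f z x) / (y - z)) \<longlongrightarrow> deriv (\<lambda>z. f z x) z) (at z)"
            using holomorphic_derivI[OF hol[OF x] A z] by (simp add: has_field_derivative_iff)
          thus ?thesis
            using Xn X unfolding tendsto_at_iff_sequentially
            by (auto simp: o_def dest!: spec[of _ "\<lambda>n. X (n + K)"] intro: LIMSEQ_ignore_initial_segment)
        qed
        show m: "(\<lambda>x. (f (X (n + K)) x - f z x) / (X (n + K) - z)) \<in> borel_measurable M" for n
          using meas[OF KA] meas[OF z] by measurable
        show "(\<lambda>x. deriv (\<lambda>z. f z x) z) \<in> borel_measurable M"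
          using lim m by (rule borel_measurable_LIMSEQ_metric[rotated])
        show "AE x in M. (\<lambda>n. (f (X (n + K)) x - f z x) / (X (n + K) - z)) \<longlonglongrightarrow> deriv (\<lambda>z. f z x) z"
          using lim by (intro AE_I2)
        show "integrable M (\<lambda>x. 2 / r * g x)" using g by simp
        show "AE x in M. norm ((f (X (n + K)) x - f z x) / (X (n + K) - z)) \<le> 2 / r * g x" for n
        proof (rule AE_I2)
          fix x assume x: "x \<in> space M"
          have "X (n + K) \<noteq> z" using Xn by auto
          moreover have "cmod (f (X (n+K)) x - f z x) \<le> 2 / r * g x * cmod (X (n+K) - z)"
            by (rule lip[OF _ x]) (use K[of "n+K"] in \<open>auto simp: dist_commute\<close>)
          ultimately show "norm ((f (X (n + K)) x - f z x) / (X (n + K) - z)) \<le> 2 / r * g x"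
            by (simp add: norm_divide field_simps)
        qed
      qed
      also have "(\<lambda>n. \<integral>x. (f (X (n + K)) x - f z x) / (X (n + K) - z) \<partial>M) =
          (\<lambda>n. (integral\<^sup>L M (f (X (n + K))) - integral\<^sup>L M (f z)) / (X (n + K) - z))"
        using int[OF KA] int[OF z] by simp
      finally show "((\<lambda>y. (integral\<^sup>L M (f y) - integral\<^sup>L M (f z)) / (y - z)) \<circ> X) \<longlonglongrightarrow> D"
        unfolding o_def by (rule LIMSEQ_offset)
    qed
    thus ?thesis by (auto simp: has_field_derivative_iff)
  qed
  thus ?thesis using A by (simp add: holomorphic_on_open)
qed

text \<open>A measure space of its own, so that membership in the space supplies
  \<open>0 < u < 1\<close>, which the laws for powers of u and 1 - u need, and so that the unit
  square is a product measure.\<close>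

definition unit_lborel :: "real measure" where
  "unit_lborel = restrict_space lborel {0<..<1}"

lemma space_unit_lborel [simp]: "space unit_lborel = {0<..<1}"
  by (simp add: unit_lborel_def space_restrict_space)

lemma real_beta_integrable:
  fixes a b :: real
  assumes "a > 0" "b > 0"
  shows "has_bochner_integral unit_lborel (\<lambda>u. u powr (a - 1) * (1 - u) powr (b - 1)) (Beta a b)"
proof -
  let ?f = "\<lambda>u::real. u powr (a - 1) * (1 - u) powr (b - 1)"
  have hi: "(?f has_integral Beta a b) {0<..<1}"
    using has_integral_Beta_real[OF assms] by (simp add: has_integral_Icc_iff_Ioo)
  have m: "set_borel_measurable lborel {0<..<1} ?f"
    unfolding set_borel_measurable_def by (intro borel_measurable_scaleR borel_measurable_times) measurable
  \<comment> \<open>Non-negativity upgrades gauge integrability to absolute integrability.\<close>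
  have si: "set_integrable lebesgue {0<..<1} ?f"
    using hi by (intro nonnegative_absolutely_integrable_1) auto
  have "set_integrable lborel {0<..<1} ?f"
    using si m unfolding set_integrable_def set_borel_measurable_def by (simp add: integrable_completion)
  moreover from set_borel_integral_eq_integral(2)[OF this] have "(LINT x:{0<..<1}|lborel. ?f x) = Beta a b"
    using integral_unique[OF hi] by simp
  ultimately show ?thesis
    unfolding unit_lborel_def has_bochner_integral_iff set_integrable_def set_lebesgue_integral_def
    by (simp add: integrable_restrict_space integral_restrict_space)
qed

lemma measurable_ident_unit_lborel [measurable]: "(\<lambda>x. x) \<in> borel_measurable unit_lborel"
  unfolding unit_lborel_def by (simp add: measurable_restrict_space1)

interpretation unit_lborel: finite_measure unit_lborel
  unfolding unit_lborel_def by (rule finite_measureI) (simp add: emeasure_restrict_space space_restrict_space)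

interpretation unit_sq: pair_sigma_finite unit_lborel unit_lborel ..

lemma borel_measurable_powr_complex [measurable (raw)]:
  fixes f g :: "'a \<Rightarrow> complex"
  assumes [measurable]: "f \<in> borel_measurable M" "g \<in> borel_measurable M"
  shows "(\<lambda>x. f x powr g x) \<in> borel_measurable M"
  unfolding powr_def by measurable

lemma norm_of_real_powr: "u > 0 \<Longrightarrow> cmod (of_real u powr s) = u powr Re s"
  by (subst norm_powr_real_powr) auto

definition beta_kernel :: "complex \<Rightarrow> complex \<Rightarrow> real \<Rightarrow> complex" where
  "beta_kernel a b u = of_real u powr (a - 1) * of_real (1 - u) powr (b - 1)"

lemma beta_kernel_measurable [measurable (raw)]:
  assumes [measurable]: "f \<in> borel_measurable M"
  shows "(\<lambda>x. beta_kernel a b (f x)) \<in> borel_measurable M"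
  unfolding beta_kernel_def by measurable

lemma norm_beta_kernel:
  "u \<in> {0<..<1} \<Longrightarrow> cmod (beta_kernel a b u) = u powr (Re a - 1) * (1 - u) powr (Re b - 1)"
  unfolding beta_kernel_def norm_mult
  by (subst (1 2) norm_of_real_powr) auto

lemma beta_kernel_integrable:
  assumes "Re a > 0" "Re b > 0"
  shows "integrable unit_lborel (beta_kernel a b)"
proof (rule Bochner_Integration.integrable_bound)
  show "integrable unit_lborel (\<lambda>u::real. u powr (Re a - 1) * (1 - u) powr (Re b - 1))"
    using real_beta_integrable[OF assms] by (simp add: has_bochner_integral_iff)
  show "AE u in unit_lborel. norm (beta_kernel a b u) \<le> norm (u powr (Re a - 1) * (1 - u) powr (Re b - 1))"
    by (rule AE_I2) (simp add: norm_beta_kernel)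
qed (rule beta_kernel_measurable, measurable)

lemma powr_mono_base_le_1:
  fixes u :: real
  assumes "0 < u" "u < 1" "p \<le> q"
  shows "u powr q \<le> u powr p"
  using assms by (simp add: powr_mono')

text \<open>The identity theorem is applied to one parameter at a time. It passes from two positive
  parameters to a complex first one and, after the reflection u \<mapsto> 1 - u has exchanged the
  parameters, to two complex ones.\<close>

lemma beta_kernel_integral:
  assumes "Re a > 0" "Re b > 0"
  shows "integral\<^sup>L unit_lborel (beta_kernel a b) = Beta a b"
proof -
  have op: "open {z::complex. Re z > 0}" by (rule open_halfspace_Re_gt)
  have cn: "connected {z::complex. Re z > 0}" by (intro convex_connected convex_halfspace_Re_gt)
  have lim: "1 islimpt (complex_of_real ` {0<..})"
  proof (subst islimpt_approachable, intro allI impI)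
    fix e :: real assume "e > 0"
    thus "\<exists>x'\<in>complex_of_real ` {0<..}. x' \<noteq> 1 \<and> dist x' 1 < e"
      by (intro bexI[of _ "complex_of_real (1 + e/2)"] imageI) (auto simp: dist_norm norm_divide)
  qed
  have real: "integral\<^sup>L unit_lborel (beta_kernel (of_real a) (of_real b)) = Beta (of_real a) (of_real b)"
    if "a > 0" "b > 0" for a b
  proof -
    have "integral\<^sup>L unit_lborel (beta_kernel (of_real a) (of_real b)) =
          integral\<^sup>L unit_lborel (\<lambda>u. complex_of_real (u powr (a - 1) * (1 - u) powr (b - 1)))"
      by (rule Bochner_Integration.integral_cong) (auto simp: beta_kernel_def simp flip: powr_of_real)
    also have "\<dots> = of_real (Beta a b)"
      using real_beta_integrable[OF that] by (simp only: integral_complex_of_real has_bochner_integral_iff)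
    finally show ?thesis by (simp add: Beta_complex_of_real)
  qed
  have hol: "(\<lambda>z. integral\<^sup>L unit_lborel (beta_kernel z b)) holomorphic_on {z. Re z > 0}" if b: "Re b > 0" for b
  proof (rule holomorphic_on_integral_parameter[OF op])
    fix z :: complex assume z: "z \<in> {z. Re z > 0}"
    show "\<exists>r>0. \<exists>g. cball z r \<subseteq> {z. 0 < Re z} \<and> integrable unit_lborel g \<and>
            (\<forall>y\<in>cball z r. \<forall>x\<in>space unit_lborel. cmod (beta_kernel y b x) \<le> g x)"
    proof (intro exI[of _ "Re z / 2"] exI[of _ "\<lambda>u::real. u powr (Re z / 2 - 1) * (1 - u) powr (Re b - 1)"] conjI ballI)
      have re: "Re y \<ge> Re z / 2" if "y \<in> cball z (Re z / 2)" for y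
        using that abs_Re_le_cmod[of "z - y"] by (auto simp: dist_norm)
      show "cball z (Re z / 2) \<subseteq> {z. 0 < Re z}"
        using z by (auto dest!: re)
      show "integrable unit_lborel (\<lambda>u. u powr (Re z / 2 - 1) * (1 - u) powr (Re b - 1))"
        using real_beta_integrable[of "Re z / 2" "Re b"] z b by (simp add: has_bochner_integral_iff)
      fix y u assume "y \<in> cball z (Re z / 2)" "u \<in> space unit_lborel"
      thus "cmod (beta_kernel y b u) \<le> u powr (Re z / 2 - 1) * (1 - u) powr (Re b - 1)"
        using re[of y] by (auto simp: norm_beta_kernel intro!: mult_right_mono powr_mono_base_le_1)
    qed (use z in auto)
  qed (auto intro!: holomorphic_intros beta_kernel_measurable measurable_ident_unit_lborel simp: beta_kernel_def)
  have holB: "(\<lambda>z. Beta z b) holomorphic_on {z. Re z > 0}" if "Re b > 0" for b :: complex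
    unfolding Beta_altdef
    by (intro holomorphic_intros) (use that in \<open>auto elim!: nonpos_Ints_cases\<close>)
  have cont: "integral\<^sup>L unit_lborel (beta_kernel z b) = Beta z b"
    if b: "Re b > 0" and *: "\<And>x. x > 0 \<Longrightarrow> integral\<^sup>L unit_lborel (beta_kernel (of_real x) b) = Beta (of_real x) b"
      and z: "Re z > 0" for z b :: complex
  proof -
    have "integral\<^sup>L unit_lborel (beta_kernel z b) - Beta z b = 0"
      by (rule analytic_continuation[of "\<lambda>z. integral\<^sup>L unit_lborel (beta_kernel z b) - Beta z b"
            "{z. Re z > 0}" "complex_of_real ` {0<..}" 1])
         (use lim z in \<open>auto simp: * b op cn intro!: holomorphic_on_diff hol holB\<close>)
    thus ?thesis by simp
  qed
  have sym: "integral\<^sup>L unit_lborel (beta_kernel x (of_real b)) = Beta x (of_real b)"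
    if "b > 0" "Re x > 0" for x b
    by (rule cont) (simp_all add: that real)
  have flip: "integral\<^sup>L unit_lborel (beta_kernel x y) = integral\<^sup>L unit_lborel (beta_kernel y x)" for x y
  proof -
    have "integral\<^sup>L unit_lborel (beta_kernel x y) = (\<integral>u. indicator {0<..<1} u *\<^sub>R beta_kernel x y u \<partial>lborel)"
      by (simp add: unit_lborel_def integral_restrict_space)
    also have "\<dots> = (\<integral>u. indicator {0<..<1} (1 - u) *\<^sub>R beta_kernel x y (1 - u) \<partial>lborel)"
      by (subst lborel_integral_real_affine[where c = "-1" and t = 1]) auto
    also have "\<dots> = (\<integral>u. indicator {0<..<1} u *\<^sub>R beta_kernel y x u \<partial>lborel)"
      by (rule Bochner_Integration.integral_cong) (auto simp: beta_kernel_def indicator_def)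
    finally show ?thesis by (simp add: unit_lborel_def integral_restrict_space)
  qed
  show ?thesis
  proof (rule cont)
    fix x :: real assume x: "x > 0"
    show "integral\<^sup>L unit_lborel (beta_kernel (of_real x) b) = Beta (of_real x) b"
      unfolding flip[of "of_real x" b] Beta_commute[of "of_real x" b] by (rule sym[OF x assms(2)])
  qed (fact assms)+
qed

section \<open>The hypergeometric function\<close>

lemma slit_plane_iff: "z \<in> slit_plane \<longleftrightarrow> \<not> (Im z = 0 \<and> Re z \<ge> 1)"
  unfolding slit_plane_def by (auto simp: complex_eq_iff image_iff intro: bexI[of _ "Re z"])

lemma slit_plane_scaleR:
  assumes "z \<in> slit_plane" "0 \<le> u" "u \<le> 1"
  shows "of_real u * z \<in> slit_plane"
proof -
  have "Re z \<ge> 1" if "u * Re z \<ge> 1"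
  proof -
    have "Re z > 0" using that assms(2) by (smt (verit) mult_nonneg_nonpos)
    hence "u * Re z \<le> 1 * Re z" using assms(3) by (intro mult_right_mono) auto
    thus ?thesis using that by simp
  qed
  thus ?thesis using assms by (auto simp: slit_plane_iff)
qed

lemma open_slit_plane: "open slit_plane"
proof -
  have "slit_plane = (\<lambda>z. 1 - z) -` (- \<real>\<^sub>\<le>\<^sub>0)"
    by (auto simp: slit_plane_iff complex_nonpos_Reals_iff)
  moreover have "open ((\<lambda>z::complex. 1 - z) -` (- \<real>\<^sub>\<le>\<^sub>0))"
    by (intro open_vimage) (auto intro!: continuous_intros)
  ultimately show ?thesis by simp
qed

lemma starlike_slit_plane: "starlike slit_plane"
  unfolding starlike_def
proof (intro bexI[of _ 0] ballI subsetI)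
  fix z y assume "z \<in> slit_plane" "y \<in> closed_segment 0 z"
  thus "y \<in> slit_plane"
    by (auto simp: closed_segment_def scaleR_conv_of_real intro: slit_plane_scaleR)
qed (auto simp: slit_plane_iff)

lemma connected_slit_plane: "connected slit_plane"
  using starlike_slit_plane by (rule starlike_imp_connected)

lemma ball_subset_slit_plane: "ball 0 1 \<subseteq> slit_plane"
proof
  fix z :: complex assume "z \<in> ball 0 1"
  thus "z \<in> slit_plane" using abs_Re_le_cmod[of z] by (auto simp: slit_plane_iff)
qed

lemma slit_plane_notin_cut:
  assumes "z \<in> slit_plane" "0 \<le> u" "u \<le> 1"
  shows "1 - of_real u * z \<notin> \<real>\<^sub>\<le>\<^sub>0"
  using slit_plane_scaleR[OF assms] by (auto simp: slit_plane_iff complex_nonpos_Reals_iff)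

lemma slit_plane_nonzero:
  assumes "z \<in> slit_plane" "0 \<le> u" "u \<le> 1"
  shows "1 - of_real u * z \<noteq> 0"
  using slit_plane_notin_cut[OF assms] by auto

lemma slit_plane_norm_less_1: "cmod z < 1 \<Longrightarrow> z \<in> slit_plane"
  using ball_subset_slit_plane by (simp add: subset_iff)

lemma norm_powr_le_exp:
  fixes z s :: complex
  shows "cmod (z powr s) \<le> exp (cmod s * cmod (Ln z))"
proof (cases "z = 0")
  case False
  have "Re (s * Ln z) \<le> cmod s * cmod (Ln z)"
    by (metis complex_Re_le_cmod norm_mult)
  thus ?thesis using False by (simp add: powr_def)
qed auto

text \<open>The logarithms, unlike the powers, can be bounded independently of the exponent.\<close>

lemma slit_plane_Ln_bound:
  assumes K: "compact K" "K \<subseteq> slit_plane"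
  shows "\<exists>B\<ge>0. \<forall>u\<in>{0..1}. \<forall>z\<in>K. cmod (Ln (1 - of_real u * z)) \<le> B"
proof -
  have "continuous_on ({0..1} \<times> K) (\<lambda>p. Ln (1 - of_real (fst p) * snd p))"
    by (intro continuous_intros) (use K slit_plane_notin_cut in auto)
  hence "bounded ((\<lambda>p. Ln (1 - of_real (fst p) * snd p)) ` ({0..1} \<times> K))"
    by (intro compact_imp_bounded compact_continuous_image compact_Times K) auto
  then obtain B where "\<And>x. x \<in> {0..1} \<times> K \<Longrightarrow> cmod (Ln (1 - of_real (fst x) * snd x)) \<le> B"
    unfolding bounded_iff by blast
  hence "cmod (Ln (1 - of_real u * z)) \<le> max B 0" if "u \<in> {0..1}" "z \<in> K" for u z
    using that by (fastforce simp: le_max_iff_disj)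
  thus ?thesis by (intro exI[of _ "max B 0"]) simp_all
qed

text \<open>Weierstrass majorants against an integrable weight p: only the factors
  \<open>g n\<close> have to be bounded, so the endpoint singularities of beta kernels do no
  harm.\<close>

lemma integral_sums_bounded:
  fixes p :: "'a \<Rightarrow> complex" and g :: "nat \<Rightarrow> 'a \<Rightarrow> complex"
  assumes p: "integrable M p" and m: "\<And>n. g n \<in> borel_measurable M"
    and le: "\<And>n x. x \<in> space M \<Longrightarrow> cmod (g n x) \<le> C n" and C: "summable C"
    and G: "\<And>x. x \<in> space M \<Longrightarrow> (\<lambda>n. g n x) sums G x"
  shows "(\<lambda>n. \<integral>x. p x * g n x \<partial>M) sums (\<integral>x. p x * G x \<partial>M)"
proof -
  have int: "integrable M (\<lambda>x. p x * g n x)" for n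
  proof (rule Bochner_Integration.integrable_bound)
    show "integrable M (\<lambda>x. C n * cmod (p x))" using p by simp
    show "AE x in M. norm (p x * g n x) \<le> norm (C n * cmod (p x))"
    proof (rule AE_I2)
      fix x assume "x \<in> space M"
      hence "cmod (g n x) \<le> \<bar>C n\<bar>" using le[of x n] by linarith
      thus "norm (p x * g n x) \<le> norm (C n * cmod (p x))"
        by (simp add: norm_mult abs_mult mult.commute[of "\<bar>C n\<bar>"] mult_left_mono)
    qed
  qed (intro borel_measurable_times borel_measurable_integrable p m)
  have n: "cmod (p x * g n x) \<le> C n * cmod (p x)" if "x \<in> space M" for x n
    using le[OF that, of n] by (simp add: norm_mult mult.commute[of "C n"] mult_left_mono)
  have "(\<lambda>n. \<integral>x. p x * g n x \<partial>M) sums (\<integral>x. (\<Sum>n. p x * g n x) \<partial>M)"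
  proof (rule sums_integral[OF int])
    show "AE x in M. summable (\<lambda>i. norm (p x * g i x))"
    proof (rule AE_I2)
      fix x assume x: "x \<in> space M"
      show "summable (\<lambda>i. norm (p x * g i x))"
        by (rule summable_comparison_test'[OF summable_mult2[OF C, of "cmod (p x)"]])
           (simp add: n[OF x])
    qed
    show "summable (\<lambda>i. \<integral>x. norm (p x * g i x) \<partial>M)"
    proof (rule summable_comparison_test'[OF summable_mult2[OF C, of "\<integral>x. cmod (p x) \<partial>M"]])
      fix i
      have "(\<integral>x. norm (p x * g i x) \<partial>M) \<le> (\<integral>x. C i * cmod (p x) \<partial>M)"
        using n by (intro integral_mono_AE integrable_norm int integrable_mult_right p AE_I2)
      thus "norm (\<integral>x. norm (p x * g i x) \<partial>M) \<le> C i * (\<integral>x. cmod (p x) \<partial>M)" by simp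
    qed
  qed
  also have "(\<integral>x. (\<Sum>n. p x * g n x) \<partial>M) = (\<integral>x. p x * G x \<partial>M)"
    by (rule Bochner_Integration.integral_cong[OF refl]) (rule sums_unique[symmetric], rule sums_mult, rule G)
  finally show ?thesis .
qed

lemma binomial_series_pochhammer:
  fixes a z :: complex
  assumes "cmod z < 1"
  shows "(\<lambda>n. pochhammer a n / fact n * z ^ n) sums (1 - z) powr (-a)"
proof -
  have "(\<lambda>n. ((-a) gchoose n) * (-z) ^ n) sums (1 + (-z)) powr (-a)"
    by (rule gen_binomial_complex) (use assms in simp)
  moreover have "((-a) gchoose n) * (-z) ^ n = pochhammer a n / fact n * z ^ n" for n
  proof -
    have "(-1) ^ n * (-1) ^ n = (1::complex)" by (simp flip: power_mult_distrib)
    thus ?thesis unfolding gbinomial_pochhammer power_minus[of z] by simp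
  qed
  ultimately show ?thesis by simp
qed

lemma binomial_series_abs_summable:
  fixes a :: complex and r :: real
  assumes "0 \<le> r" "r < 1"
  shows "summable (\<lambda>n. cmod (pochhammer a n / fact n) * r ^ n)"
proof -
  obtain s where s: "r < s" "s < 1" using dense assms(2) by blast
  have "summable (\<lambda>n. pochhammer a n / fact n * complex_of_real s ^ n)"
    by (rule sums_summable, rule binomial_series_pochhammer) (use s assms in auto)
  hence "summable (\<lambda>n. norm (pochhammer a n / fact n * complex_of_real r ^ n))"
    by (rule powser_insidea) (use s assms in auto)
  thus ?thesis using assms by (simp add: norm_mult norm_divide norm_power)
qed

lemma beta_kernel_mult_power:
  assumes "u \<in> {0<..<1}"
  shows "beta_kernel a b u * of_real u ^ n = beta_kernel (a + of_nat n) b u"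
    and "beta_kernel a b u * of_real (1 - u) ^ n = beta_kernel a (b + of_nat n) u"
proof -
  have *: "of_real v powr (s - 1) * of_real v ^ n = of_real v powr (s + of_nat n - 1)" if v: "v > 0" for v and s :: complex
  proof -
    have "of_real v powr (s + of_nat n - 1) = of_real v powr ((s - 1) + of_nat n)"
      by (rule arg_cong[where f = "\<lambda>z. of_real v powr z"]) simp
    also have "\<dots> = of_real v powr (s - 1) * of_real v powr of_nat n"
      by (rule powr_add)
    also have "of_real v powr of_nat n = (of_real v ^ n :: complex)"
      using v by (intro powr_nat') auto
    finally show ?thesis by (rule sym)
  qed
  have u: "0 < u" "0 < 1 - u" using assms by auto
  show "beta_kernel a b u * of_real u ^ n = beta_kernel (a + of_nat n) b u"
    unfolding beta_kernel_def *[OF u(1), of a, symmetric] by (simp only: mult_ac)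
  show "beta_kernel a b u * of_real (1 - u) ^ n = beta_kernel a (b + of_nat n) u"
    unfolding beta_kernel_def *[OF u(2), of b, symmetric] by (simp only: mult_ac)
qed

lemma Gamma_plus_of_nat:
  fixes z :: complex
  assumes "Re z > 0"
  shows "Gamma (z + of_nat n) = pochhammer z n * Gamma z"
proof -
  have "z \<notin> \<int>\<^sub>\<le>\<^sub>0" using assms by (auto elim!: nonpos_Ints_cases)
  thus ?thesis using pochhammer_Gamma[of z n] by (simp add: Gamma_eq_zero_iff)
qed

lemma rGamma_mult_Gamma:
  fixes z :: complex
  assumes "Re z > 0"
  shows "rGamma z * Gamma z = 1"
proof -
  have "z \<notin> \<int>\<^sub>\<le>\<^sub>0" using assms by (auto elim!: nonpos_Ints_cases)
  thus ?thesis by (simp add: Gamma_def rGamma_eq_zero_iff)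
qed

definition euler_2F1 :: "complex \<Rightarrow> complex \<Rightarrow> complex \<Rightarrow> complex \<Rightarrow> complex" where
  "euler_2F1 a b c z = rGamma b * rGamma (c - b) *
     (\<integral>u. beta_kernel b (c - b) u * (1 - of_real u * z) powr (-a) \<partial>unit_lborel)"

text \<open>Termwise integration of the binomial series against the beta kernel turns the moment
  \<open>Beta (b + of_nat n) (c - b)\<close> into the missing factors of the n-th coefficient. On
  the slit plane the integral is holomorphic because the logarithm of 1 - u z is bounded locally
  uniformly in z.\<close>

lemma is_reg_2F1_euler:
  assumes b: "Re b > 0" and cb: "Re c > Re b"
  shows "is_reg_2F1 a b c (euler_2F1 a b c)"
proof -
  have int: "integrable unit_lborel (beta_kernel b (c - b))"
    using assms by (intro beta_kernel_integrable) auto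
  have "(\<lambda>z. \<integral>u. beta_kernel b (c - b) u * (1 - of_real u * z) powr (-a) \<partial>unit_lborel) holomorphic_on slit_plane"
  proof (rule holomorphic_on_integral_parameter[OF open_slit_plane])
    fix u :: real assume u: "u \<in> space unit_lborel"
    show "(\<lambda>z. beta_kernel b (c - b) u * (1 - of_real u * z) powr (-a)) holomorphic_on slit_plane"
      by (intro holomorphic_intros) (rule slit_plane_notin_cut, use u in auto)
  next
    fix z assume "z \<in> slit_plane"
    then obtain r where r: "r > 0" "cball z r \<subseteq> slit_plane"
      using open_slit_plane open_contains_cball by blast
    obtain B where B: "cmod (Ln (1 - of_real u * y)) \<le> B" if "u \<in> {0..1}" "y \<in> cball z r" for u y
      using slit_plane_Ln_bound[OF compact_cball r(2)] by metis
    have "cmod (beta_kernel b (c - b) u * (1 - of_real u * y) powr (-a)) \<le> cmod (beta_kernel b (c - b) u) * exp (cmod a * B)"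
      if "y \<in> cball z r" "u \<in> {0<..<1}" for y u
      unfolding norm_mult
    proof (intro mult_left_mono norm_ge_zero order_trans[OF norm_powr_le_exp])
      have "cmod a * cmod (Ln (1 - of_real u * y)) \<le> cmod a * B"
        by (intro mult_left_mono B) (use that in auto)
      thus "exp (cmod (- a) * cmod (Ln (1 - of_real u * y))) \<le> exp (cmod a * B)" by simp
    qed
    moreover have "integrable unit_lborel (\<lambda>u. cmod (beta_kernel b (c - b) u) * exp (cmod a * B))"
      using int by simp
    ultimately show "\<exists>r>0. \<exists>g. cball z r \<subseteq> slit_plane \<and> integrable unit_lborel g \<and>
        (\<forall>y\<in>cball z r. \<forall>u\<in>space unit_lborel. cmod (beta_kernel b (c - b) u * (1 - of_real u * y) powr (-a)) \<le> g u)"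
      using r by (intro exI[of _ r] exI[of _ "\<lambda>u. cmod (beta_kernel b (c - b) u) * exp (cmod a * B)"] conjI ballI) auto
  qed measurable
  hence "euler_2F1 a b c holomorphic_on slit_plane"
    unfolding euler_2F1_def by (intro holomorphic_intros)
  moreover have "(\<lambda>n. pochhammer a n * pochhammer b n * rGamma (c + of_nat n) / fact n * x ^ n) sums euler_2F1 a b c x"
    if x: "cmod x < 1" for x
  proof -
    have "(\<lambda>n. \<integral>u. beta_kernel b (c - b) u * (pochhammer a n / fact n * (of_real u * x) ^ n) \<partial>unit_lborel) sums
       (\<integral>u. beta_kernel b (c - b) u * (1 - of_real u * x) powr (-a) \<partial>unit_lborel)"
    proof (rule integral_sums_bounded[OF int, where C = "\<lambda>n. cmod (pochhammer a n / fact n) * cmod x ^ n"])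
      show "summable (\<lambda>n. cmod (pochhammer a n / fact n) * cmod x ^ n)"
        using x by (intro binomial_series_abs_summable) auto
      fix u :: real assume u: "u \<in> space unit_lborel"
      have ux: "cmod (of_real u * x) \<le> cmod x"
        using u mult_left_le_one_le[of "cmod x" u] by (simp add: norm_mult)
      thus "(\<lambda>n. pochhammer a n / fact n * (of_real u * x) ^ n) sums (1 - of_real u * x) powr (-a)"
        using x by (intro binomial_series_pochhammer) linarith
      show "cmod (pochhammer a n / fact n * (of_real u * x) ^ n) \<le> cmod (pochhammer a n / fact n) * cmod x ^ n" for n
        using ux unfolding norm_mult norm_power by (intro mult_left_mono power_mono) (auto simp: norm_mult)
    qed measurable
    moreover have "(\<integral>u. beta_kernel b (c - b) u * (pochhammer a n / fact n * (of_real u * x) ^ n) \<partial>unit_lborel) =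
        pochhammer a n / fact n * x ^ n * Beta (b + of_nat n) (c - b)" for n
    proof -
      have "(\<integral>u. beta_kernel b (c - b) u * (pochhammer a n / fact n * (of_real u * x) ^ n) \<partial>unit_lborel) =
            (\<integral>u. pochhammer a n / fact n * x ^ n * beta_kernel (b + of_nat n) (c - b) u \<partial>unit_lborel)"
        by (rule Bochner_Integration.integral_cong[OF refl], unfold space_unit_lborel)
           (simp only: power_mult_distrib mult_ac beta_kernel_mult_power(1)[symmetric])
      also have "\<dots> = pochhammer a n / fact n * x ^ n * Beta (b + of_nat n) (c - b)"
        using assms by (subst beta_kernel_integral[symmetric]) simp_all
      finally show ?thesis .
    qed
    ultimately have "(\<lambda>n. rGamma b * rGamma (c - b) * (pochhammer a n / fact n * x ^ n * Beta (b + of_nat n) (c - b))) sums euler_2F1 a b c x"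
      unfolding euler_2F1_def by (intro sums_mult) (simp only:)
    moreover have "rGamma b * rGamma (c - b) * (pochhammer a n / fact n * x ^ n * Beta (b + of_nat n) (c - b)) =
        pochhammer a n * pochhammer b n * rGamma (c + of_nat n) / fact n * x ^ n" for n
    proof -
      have "rGamma b * Gamma b = 1" "rGamma (c - b) * Gamma (c - b) = 1"
        using assms by (auto intro!: rGamma_mult_Gamma)
      thus ?thesis
        unfolding Beta_altdef Gamma_plus_of_nat[OF b] by (simp add: algebra_simps)
    qed
    ultimately show ?thesis by (simp only:)
  qed
  ultimately show ?thesis unfolding is_reg_2F1_def by blast
qed

text \<open>Since \<open>rGamma (c - 1 + n) = (c - 1 + n) * rGamma (c + n)\<close>, the operator (c
  - 1) + z d/dz lowers c coefficient by coefficient. It extends the existence of the continuation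
  beyond Euler's integral and later yields the derivatives of \<open>inner_k\<close>.\<close>

lemma is_reg_2F1_lower_c:
  assumes "is_reg_2F1 a b c f"
  shows "is_reg_2F1 a b (c - 1) (\<lambda>z. (c - 1) * f z + z * deriv f z)"
  unfolding is_reg_2F1_def
proof (intro conjI allI impI)
  have hol: "f holomorphic_on slit_plane" and
    s: "\<And>x. cmod x < 1 \<Longrightarrow> (\<lambda>n. pochhammer a n * pochhammer b n * rGamma (c + of_nat n) / fact n * x ^ n) sums f x"
    using assms unfolding is_reg_2F1_def by blast+
  show "(\<lambda>z. (c - 1) * f z + z * deriv f z) holomorphic_on slit_plane"
    by (intro holomorphic_on_add holomorphic_on_mult holomorphic_on_const holomorphic_on_ident
          holomorphic_deriv hol open_slit_plane)
  fix x :: complex assume x: "cmod x < 1"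
  let ?t = "\<lambda>n. pochhammer a n * pochhammer b n * rGamma (c + of_nat n) / fact n"
  have "(f has_field_derivative deriv f x) (at x)"
    by (rule holomorphic_derivI[OF hol open_slit_plane]) (rule slit_plane_norm_less_1[OF x])
  hence "(\<lambda>n. diffs ?t n * x ^ n) sums deriv f x"
    by (intro termdiffs_sums_strong[where K = 1 and f = f] s x)
  hence "(\<lambda>n. x * (diffs ?t n * x ^ n)) sums (x * deriv f x)" by (rule sums_mult)
  moreover have "x * (diffs ?t n * x ^ n) = of_nat (Suc n) * ?t (Suc n) * x ^ Suc n" for n
    by (simp only: diffs_def mult_ac power_Suc)
  ultimately have "(\<lambda>n. of_nat (Suc n) * ?t (Suc n) * x ^ Suc n) sums (x * deriv f x)" by (simp only:)
  hence "(\<lambda>n. of_nat n * ?t n * x ^ n) sums (x * deriv f x)"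
    using sums_Suc_iff[of "\<lambda>n. of_nat n * ?t n * x ^ n" "x * deriv f x"] by (simp only: of_nat_0 mult_zero_left add_0_right)
  hence "(\<lambda>n. (c - 1) * (?t n * x ^ n) + of_nat n * ?t n * x ^ n) sums ((c - 1) * f x + x * deriv f x)"
    by (intro sums_add sums_mult s x)
  moreover have "(c - 1) * (?t n * x ^ n) + of_nat n * ?t n * x ^ n =
     pochhammer a n * pochhammer b n * rGamma (c - 1 + of_nat n) / fact n * x ^ n" for n
  proof -
    have "c - 1 + of_nat n + 1 = c + of_nat n" by simp
    hence "rGamma (c - 1 + of_nat n) = (c - 1 + of_nat n) * rGamma (c + of_nat n)"
      using rGamma_plus1[of "c - 1 + of_nat n"] by metis
    thus ?thesis by (simp only:) (simp add: ring_distribs add_divide_distrib diff_divide_distrib mult_ac)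
  qed
  ultimately show "(\<lambda>n. pochhammer a n * pochhammer b n * rGamma (c - 1 + of_nat n) / fact n * x ^ n) sums
      ((c - 1) * f x + x * deriv f x)" by (simp only:)
qed

text \<open>A contiguous relation: \<open>pochhammer (b + 1) n\<close> exceeds
  \<open>pochhammer b n\<close> by n times \<open>pochhammer (b + 1) (n - 1)\<close>, and the factor
  n shifts the series by one, which raises a and c. It serves to reach
  \<open>Re b \<le> 0\<close>.\<close>

lemma is_reg_2F1_lower_b:
  assumes "is_reg_2F1 a (b + 1) c f" "is_reg_2F1 (a + 1) (b + 1) (c + 1) g"
  shows "is_reg_2F1 a b c (\<lambda>z. f z - a * z * g z)"
  unfolding is_reg_2F1_def
proof (intro conjI allI impI)
  show "(\<lambda>z. f z - a * z * g z) holomorphic_on slit_plane"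
    using assms unfolding is_reg_2F1_def
    by (intro holomorphic_on_diff holomorphic_on_mult holomorphic_on_const holomorphic_on_ident) blast+
  fix x :: complex assume x: "cmod x < 1"
  let ?f = "\<lambda>n. pochhammer a n * pochhammer (b + 1) n * rGamma (c + of_nat n) / fact n * x ^ n"
  let ?g = "\<lambda>n. pochhammer (a + 1) n * pochhammer (b + 1) n * rGamma (c + 1 + of_nat n) / fact n * x ^ n"
  let ?h = "\<lambda>n. case n of 0 \<Rightarrow> 0 | Suc m \<Rightarrow> a * x * ?g m"
  have "(\<lambda>n. ?h (Suc n)) sums (a * x * g x)"
    using assms(2) x unfolding is_reg_2F1_def nat.case by (intro sums_mult) blast
  hence h: "?h sums (a * x * g x)" by (subst (asm) sums_Suc_iff) (simp only: nat.case add_0_right)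
  have "(\<lambda>n. ?f n - ?h n) sums (f x - a * x * g x)"
    by (rule sums_diff[OF _ h]) (use assms(1) x in \<open>unfold is_reg_2F1_def, blast\<close>)
  moreover have "?f n - ?h n = pochhammer a n * pochhammer b n * rGamma (c + of_nat n) / fact n * x ^ n" for n
  proof (cases n)
    case (Suc m)
    have 1: "pochhammer (b + 1) (Suc m) = pochhammer (b + 1) m * (b + 1 + of_nat m)"
      by (simp add: pochhammer_Suc)
    have 2: "pochhammer b (Suc m) = b * pochhammer (b + 1) m" "pochhammer a (Suc m) = a * pochhammer (a + 1) m"
      by (simp_all add: pochhammer_rec)
    have 3: "c + 1 + of_nat m = c + of_nat (Suc m)" by simp
    define A B R X F where "A = pochhammer (a + 1) m" and "B = pochhammer (b + 1) m"
      and "R = rGamma (c + of_nat (Suc m))" and "X = x ^ m" and "F = (fact m :: complex)"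
    have F: "F \<noteq> 0" "fact (Suc m) = (of_nat m + 1) * F" by (auto simp: F_def)
    have m: "of_nat m + 1 \<noteq> (0::complex)" by (metis of_nat_Suc of_nat_neq_0 add.commute)
    have "a * A * (B * (b + 1 + of_nat m)) * R / ((of_nat m + 1) * F) * (x * X) - a * x * (A * B * R / F * X) =
          a * A * (b * B) * R / ((of_nat m + 1) * F) * (x * X)"
      using F(1) m by (simp add: divide_simps) (simp add: algebra_simps)
    thus ?thesis
      unfolding Suc nat.case 1 2 3 F(2) power_Suc A_def[symmetric] B_def[symmetric] R_def[symmetric]
        X_def[symmetric] F_def[symmetric] .
  qed auto
  ultimately show "(\<lambda>n. pochhammer a n * pochhammer b n * rGamma (c + of_nat n) / fact n * x ^ n) sums
      (f x - a * x * g x)" by (simp only:)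
qed

text \<open>\<open>reg_2F1\<close> is a definite description and needs a witness for all parameters.
  Euler's integral gives one when \<open>Re c > Re b > 0\<close>. Then c is lowered step by step
  from c + n, and afterwards b from b + n; the second induction has to vary a and c, since its step
  raises them.\<close>

lemma is_reg_2F1_exists: "\<exists>f. is_reg_2F1 a b c f"
proof -
  have pos: "\<exists>f. is_reg_2F1 a b c f" if b: "Re b > 0" for a b c
  proof -
    obtain n where n: "real n > Re b - Re c" using reals_Archimedean2 by blast
    have "\<exists>f. is_reg_2F1 a b (c + of_nat n - of_nat k) f" for k
    proof (induction k)
      case 0
      show ?case using is_reg_2F1_euler[of b "c + of_nat n" a] b n by auto
    next
      case (Suc k)
      then obtain f where "is_reg_2F1 a b (c + of_nat n - of_nat k) f" ..
      from is_reg_2F1_lower_c[OF this] show ?case by (auto simp: algebra_simps)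
    qed
    from this[of n] show ?thesis by simp
  qed
  obtain n where n: "real n > - Re b" using reals_Archimedean2 by blast
  have "\<exists>f. is_reg_2F1 a (b + of_nat n - of_nat k) c f" for k a c
  proof (induction k arbitrary: a c)
    case 0
    show ?case using pos[of "b + of_nat n"] n by auto
  next
    case (Suc k)
    define b' where "b' = b + of_nat n - of_nat (Suc k)"
    have b': "b + of_nat n - of_nat k = b' + 1" by (simp add: b'_def)
    obtain f g where "is_reg_2F1 a (b' + 1) c f" "is_reg_2F1 (a + 1) (b' + 1) (c + 1) g"
      using Suc.IH[of a c] Suc.IH[of "a+1" "c+1"] unfolding b' by blast
    from is_reg_2F1_lower_b[OF this] show ?case unfolding b'_def by blast
  qed
  from this[of a n c] show ?thesis by simp
qed

lemma is_reg_2F1_reg_2F1: "is_reg_2F1 a b c (reg_2F1 a b c)"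
proof -
  obtain f where f: "is_reg_2F1 a b c f" using is_reg_2F1_exists by blast
  have eq: "reg_2F1 a b c x = f x" if "x \<in> slit_plane" for x
    by (rule reg_2F1_eqI[OF f that])
  have "reg_2F1 a b c holomorphic_on slit_plane"
    using f unfolding is_reg_2F1_def by (auto intro: holomorphic_transform simp: eq)
  moreover have "reg_2F1 a b c x = f x" if "cmod x < 1" for x
    by (rule eq) (rule slit_plane_norm_less_1[OF that])
  ultimately show ?thesis using f unfolding is_reg_2F1_def by simp
qed

lemma reg_2F1_holomorphic: "reg_2F1 a b c holomorphic_on slit_plane"
  and reg_2F1_sums: "cmod x < 1 \<Longrightarrow>
    (\<lambda>n. pochhammer a n * pochhammer b n * rGamma (c + of_nat n) / fact n * x ^ n) sums reg_2F1 a b c x"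
  using is_reg_2F1_reg_2F1[of a b c] unfolding is_reg_2F1_def by blast+

section \<open>Remainders of binomial series\<close>

definition binom_coeff :: "complex \<Rightarrow> nat \<Rightarrow> complex" where
  "binom_coeff b n = pochhammer b n / fact n"

text \<open>\<open>stieltjes_const b N\<close> is the total mass of the modulus of the measure representing the \<open>N\<close>-th
  remainder of the binomial series of exponent \<open>- b\<close> as a Stieltjes integral.\<close>

definition stieltjes_const :: "complex \<Rightarrow> nat \<Rightarrow> real" where
  "stieltjes_const b N = cmod (sin (of_real pi * b)) / pi * (Gamma (real N + Re b) * Gamma (1 - Re b) / fact N)"

text \<open>The tail of the binomial series is \<open>pochhammer b N * z ^ N\<close> times the
  hypergeometric series with upper parameters 1 and N + b and lower parameter N + 1. With an upper
  parameter 1, Euler's integrand is the kernel 1 / (1 - s z). The hypotheses on \<open>Re b\<close>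
  are the convergence conditions of that integral.\<close>

lemma binomial_remainder_stieltjes:
  assumes b: "- real N < Re b" "Re b < 1" and z: "z \<in> slit_plane"
  shows "(1 - z) powr (-b) - (\<Sum>l<N. binom_coeff b l * z ^ l) =
           rGamma b * rGamma (1 - b) * z ^ N *
           (\<integral>s. beta_kernel (of_nat N + b) (1 - b) s / (1 - of_real s * z) \<partial>unit_lborel)"
proof -
  let ?E = "euler_2F1 1 (of_nat N + b) (of_nat N + 1)"
  have E: "is_reg_2F1 1 (of_nat N + b) (of_nat N + 1) ?E"
    by (rule is_reg_2F1_euler) (use b in auto)
  have holE: "?E holomorphic_on slit_plane" using E unfolding is_reg_2F1_def by blast
  have eq: "(1 - z) powr (-b) - (\<Sum>l<N. binom_coeff b l * z ^ l) = pochhammer b N * z ^ N * ?E z"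
  proof (rule analytic_continuation_open[of "ball 0 1" slit_plane
        "\<lambda>z. (1 - z) powr (-b) - (\<Sum>l<N. binom_coeff b l * z ^ l)" "\<lambda>z. pochhammer b N * z ^ N * ?E z"])
    show "(\<lambda>z. (1 - z) powr (-b) - (\<Sum>l<N. binom_coeff b l * z ^ l)) holomorphic_on slit_plane"
      by (intro holomorphic_intros) (use slit_plane_notin_cut[of _ 1] in simp)
    show "(\<lambda>z. pochhammer b N * z ^ N * ?E z) holomorphic_on slit_plane"
      by (intro holomorphic_on_mult holomorphic_on_power holomorphic_on_const holomorphic_on_ident holE)
    fix w :: complex assume "w \<in> ball 0 1"
    hence w: "cmod w < 1" by simp
    have "(\<lambda>n. binom_coeff b n * w ^ n) sums (1 - w) powr (-b)"
      unfolding binom_coeff_def by (rule binomial_series_pochhammer[OF w])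
    hence 1: "(\<lambda>n. binom_coeff b (n + N) * w ^ (n + N)) sums ((1 - w) powr (-b) - (\<Sum>l<N. binom_coeff b l * w ^ l))"
      by (rule sums_split_initial_segment)
    have "(\<lambda>n. pochhammer 1 n * pochhammer (of_nat N + b) n * rGamma (of_nat N + 1 + of_nat n) / fact n * w ^ n) sums ?E w"
      using E w unfolding is_reg_2F1_def by blast
    hence "(\<lambda>n. pochhammer b N * w ^ N * (pochhammer 1 n * pochhammer (of_nat N + b) n * rGamma (of_nat N + 1 + of_nat n) / fact n * w ^ n))
        sums (pochhammer b N * w ^ N * ?E w)" by (rule sums_mult)
    moreover have "pochhammer b N * w ^ N * (pochhammer 1 n * pochhammer (of_nat N + b) n * rGamma (of_nat N + 1 + of_nat n) / fact n * w ^ n) =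
        binom_coeff b (n + N) * w ^ (n + N)" for n
    proof -
      have "rGamma (of_nat N + 1 + of_nat n :: complex) = inverse (fact (n + N))"
        using Gamma_fact[of "n + N", where 'a = complex] by (simp add: add_ac rGamma_inverse_Gamma)
      moreover have "pochhammer b (n + N) = pochhammer b N * pochhammer (of_nat N + b) n"
        by (subst add.commute) (simp add: pochhammer_product' add.commute)
      ultimately show ?thesis
        unfolding binom_coeff_def by (simp add: pochhammer_fact[symmetric] power_add inverse_eq_divide)
    qed
    ultimately have 2: "(\<lambda>n. binom_coeff b (n + N) * w ^ (n + N)) sums (pochhammer b N * w ^ N * ?E w)"
      by (simp only:)
    show "(1 - w) powr (-b) - (\<Sum>l<N. binom_coeff b l * w ^ l) = pochhammer b N * w ^ N * ?E w"
      by (rule sums_unique2[OF 1 2])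
  qed (use z open_slit_plane connected_slit_plane ball_subset_slit_plane in auto)
  \<comment> \<open>The N-dependence of the constant cancels; by the reflection formula it equals
    sin (pi b) / pi.\<close>
  have 1: "pochhammer b N * rGamma (of_nat N + b) = rGamma b"
    using pochhammer_rGamma[of b N] by (simp only: add.commute)
  have 2: "of_nat N + 1 - (of_nat N + b) = 1 - b" by simp
  have 3: "(\<integral>u. beta_kernel (of_nat N + b) (1 - b) u * (1 - of_real u * z) powr (- 1) \<partial>unit_lborel) =
      (\<integral>u. beta_kernel (of_nat N + b) (1 - b) u / (1 - of_real u * z) \<partial>unit_lborel)"
    by (rule Bochner_Integration.integral_cong) (use z slit_plane_nonzero in \<open>auto simp: powr_minus divide_inverse\<close>)
  have "pochhammer b N * z ^ N * ?E z = pochhammer b N * rGamma (of_nat N + b) * rGamma (1 - b) * z ^ N *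
      (\<integral>u. beta_kernel (of_nat N + b) (1 - b) u / (1 - of_real u * z) \<partial>unit_lborel)"
    unfolding euler_2F1_def 2 3 by (simp only: mult_ac)
  thus ?thesis unfolding eq 1 .
qed

lemma norm_integral_le:
  fixes f :: "'a \<Rightarrow> complex"
  assumes g: "integrable M g" and le: "\<And>x. x \<in> space M \<Longrightarrow> norm (f x) \<le> g x"
  shows "norm (integral\<^sup>L M f) \<le> integral\<^sup>L M g"
proof (cases "integrable M f")
  case True
  have "norm (integral\<^sup>L M f) \<le> (\<integral>x. norm (f x) \<partial>M)" by (rule integral_norm_bound)
  also have "\<dots> \<le> integral\<^sup>L M g" by (intro integral_mono_AE integrable_norm True g AE_I2 le)
  finally show ?thesis .
next
  case False
  have "0 \<le> integral\<^sup>L M g" by (rule integral_nonneg_AE, rule AE_I2) (rule order_trans[OF norm_ge_zero le])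
  thus ?thesis using False by (simp add: not_integrable_integral_eq)
qed

lemma binomial_remainder_bound:
  assumes b: "- real N < Re b" "Re b < 1" and z: "z \<in> slit_plane"
    and S: "\<And>s. s \<in> {0<..<1} \<Longrightarrow> 1 / cmod (1 - of_real s * z) \<le> S"
  shows "cmod ((1 - z) powr (-b) - (\<Sum>l<N. binom_coeff b l * z ^ l)) \<le> stieltjes_const b N * S * cmod z ^ N"
proof -
  let ?k = "beta_kernel (of_nat N + b) (1 - b)"
  have int: "integrable unit_lborel ?k" using b by (intro beta_kernel_integrable) auto
  have "cmod (\<integral>s. ?k s / (1 - of_real s * z) \<partial>unit_lborel) \<le> (\<integral>s. cmod (?k s) * S \<partial>unit_lborel)"
  proof (rule norm_integral_le)
    show "integrable unit_lborel (\<lambda>s. cmod (?k s) * S)" using int by simp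
    show "norm (?k s / (1 - of_real s * z)) \<le> cmod (?k s) * S" if "s \<in> space unit_lborel" for s
      using mult_left_mono[OF S[of s], of "cmod (?k s)"] that by (simp add: norm_divide)
  qed
  also have "\<dots> = Beta (real N + Re b) (1 - Re b) * S"
  proof -
    have "(\<integral>s. cmod (?k s) \<partial>unit_lborel) = (\<integral>s. s powr (real N + Re b - 1) * (1 - s) powr (1 - Re b - 1) \<partial>unit_lborel)"
      by (rule Bochner_Integration.integral_cong) (auto simp: norm_beta_kernel)
    also have "\<dots> = Beta (real N + Re b) (1 - Re b)"
      using real_beta_integrable[of "real N + Re b" "1 - Re b"] b by (simp only: has_bochner_integral_iff)
    finally show ?thesis by simp
  qed
  also have "Beta (real N + Re b) (1 - Re b) = Gamma (real N + Re b) * Gamma (1 - Re b) / fact N"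
    by (simp add: Beta_def Gamma_fact[symmetric] add.commute)
  finally have *: "cmod (\<integral>s. ?k s / (1 - of_real s * z) \<partial>unit_lborel) \<le> Gamma (real N + Re b) * Gamma (1 - Re b) / fact N * S" .
  have "cmod ((1 - z) powr (-b) - (\<Sum>l<N. binom_coeff b l * z ^ l)) =
      cmod (sin (of_real pi * b)) / pi * cmod z ^ N * cmod (\<integral>s. ?k s / (1 - of_real s * z) \<partial>unit_lborel)"
    unfolding binomial_remainder_stieltjes[OF b z] rGamma_reflection_complex
    by (simp add: norm_mult norm_power norm_divide)
  also have "\<dots> \<le> cmod (sin (of_real pi * b)) / pi * cmod z ^ N * (Gamma (real N + Re b) * Gamma (1 - Re b) / fact N * S)"
    by (intro mult_left_mono *) auto
  finally show ?thesis by (simp add: stieltjes_const_def mult_ac)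
qed

lemma stieltjes_const_nonneg:
  assumes "- real N < Re b" "Re b < 1"
  shows "stieltjes_const b N \<ge> 0"
  unfolding stieltjes_const_def using assms by (intro mult_nonneg_nonneg divide_nonneg_nonneg Gamma_real_nonneg) auto

lemma sum_double_triangle:
  fixes f :: "nat \<Rightarrow> nat \<Rightarrow> 'a::comm_monoid_add"
  shows "(\<Sum>n<N. \<Sum>l\<le>n. f l (n - l)) = (\<Sum>l<N. \<Sum>k<N - l. f l k)"
proof (induction N)
  case (Suc N)
  have "(\<Sum>l<Suc N. \<Sum>k<Suc N - l. f l k) = (\<Sum>l\<le>N. (\<Sum>k<N - l. f l k) + f l (N - l))"
    unfolding lessThan_Suc_atMost by (rule sum.cong[OF refl]) (simp add: Suc_diff_le)
  also have "\<dots> = (\<Sum>l\<le>N. \<Sum>k<N - l. f l k) + (\<Sum>l\<le>N. f l (N - l))"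
    by (rule sum.distrib)
  also have "(\<Sum>l\<le>N. \<Sum>k<N - l. f l k) = (\<Sum>l<N. \<Sum>k<N - l. f l k)"
    unfolding lessThan_Suc_atMost[symmetric] by simp
  finally show ?case using Suc.IH by simp
qed simp

text \<open>With T_a the partial sum of the first binomial f_a, the product f_a f_b is (f_a - T_a)
  f_b, plus each term of T_a times the remainder of f_b of the complementary order N - l, plus the
  triangle of total degree below N. So the kernel in x enters the first part only, the kernel in y
  both. The order 0 occurs for f_b, hence \<open>0 < Re b\<close>. U and V are arbitrary so that the
  two variables can exchange roles.\<close>

lemma product_remainder_bound:
  fixes p :: "'a \<Rightarrow> complex" and U V :: "'a \<Rightarrow> real"
  assumes p: "integrable M p" and [measurable]: "U \<in> borel_measurable M" "V \<in> borel_measurable M"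
    and U: "\<And>t. t \<in> space M \<Longrightarrow> U t \<in> {0..1}" and V: "\<And>t. t \<in> space M \<Longrightarrow> V t \<in> {0..1}"
    and x: "x \<in> slit_plane" and y: "y \<in> slit_plane"
    and Sx: "\<And>s. s \<in> {0..1} \<Longrightarrow> 1 / cmod (1 - of_real s * x) \<le> Sx"
    and Sy: "\<And>s. s \<in> {0..1} \<Longrightarrow> 1 / cmod (1 - of_real s * y) \<le> Sy"
    and a: "- real N < Re a" "Re a < 1" and b: "0 < Re b" "Re b < 1"
  shows "cmod ((\<integral>t. p t * ((1 - of_real (U t) * x) powr (-a) * (1 - of_real (V t) * y) powr (-b)) \<partial>M) -
            (\<Sum>n<N. \<Sum>l\<le>n. binom_coeff a l * binom_coeff b (n - l) * x ^ l * y ^ (n - l) *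
                       (\<integral>t. p t * of_real (U t) ^ l * of_real (V t) ^ (n - l) \<partial>M)))
         \<le> stieltjes_const a N * Sx * (stieltjes_const b 0 * Sy) * cmod x ^ N * (\<integral>t. cmod (p t) * U t ^ N \<partial>M)
           + (\<Sum>l<N. cmod (binom_coeff a l) * (stieltjes_const b (N - l) * Sy) * cmod x ^ l * cmod y ^ (N - l) *
               (\<integral>t. cmod (p t) * U t ^ l * V t ^ (N - l) \<partial>M))"
proof -
  define fa where "fa t = (1 - of_real (U t) * x) powr (-a)" for t
  define fb where "fb t = (1 - of_real (V t) * y) powr (-b)" for t
  define Ta where "Ta l t = binom_coeff a l * (of_real (U t) * x) ^ l" for l t
  define Tb where "Tb l t = binom_coeff b l * (of_real (V t) * y) ^ l" for l t
  have [measurable]: "p \<in> borel_measurable M" using p by simp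
  have [measurable]: "fa \<in> borel_measurable M" "fb \<in> borel_measurable M"
    "\<And>l. Ta l \<in> borel_measurable M" "\<And>l. Tb l \<in> borel_measurable M"
    unfolding fa_def[abs_def] fb_def[abs_def] Ta_def[abs_def] Tb_def[abs_def] by measurable
  have Sx': "1 / cmod (1 - of_real s * (of_real (U t) * x)) \<le> Sx" if "s \<in> {0<..<1}" "t \<in> space M" for s t
    using Sx[of "s * U t"] U[OF that(2)] that(1) by (auto simp: mult_le_one mult.assoc)
  have Sy': "1 / cmod (1 - of_real s * (of_real (V t) * y)) \<le> Sy" if "s \<in> {0<..<1}" "t \<in> space M" for s t
    using Sy[of "s * V t"] V[OF that(2)] that(1) by (auto simp: mult_le_one mult.assoc)
  have S0: "Sx \<ge> 0" "Sy \<ge> 0" using Sx[of 0] Sy[of 0] by auto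
  have ra: "cmod (fa t - (\<Sum>l<N. Ta l t)) \<le> stieltjes_const a N * Sx * cmod x ^ N * U t ^ N" if t: "t \<in> space M" for t
    using binomial_remainder_bound[OF a slit_plane_scaleR[OF x, of "U t"] Sx'[OF _ t]] U[OF t]
    unfolding fa_def Ta_def by (simp add: norm_mult power_mult_distrib mult_ac)
  have rb: "cmod (fb t - (\<Sum>l<K. Tb l t)) \<le> stieltjes_const b K * Sy * cmod y ^ K * V t ^ K" if t: "t \<in> space M" for t K
    using binomial_remainder_bound[OF _ b(2) slit_plane_scaleR[OF y, of "V t"] Sy'[OF _ t], of K] V[OF t] b
    unfolding fb_def Tb_def by (simp add: norm_mult power_mult_distrib mult_ac)
  have bnd: "integrable M (\<lambda>t. p t * h t)" if [measurable]: "h \<in> borel_measurable M" and h: "\<And>t. t \<in> space M \<Longrightarrow> cmod (h t) \<le> K" for h K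
  proof (rule Bochner_Integration.integrable_bound)
    show "integrable M (\<lambda>t. cmod (p t) * K)" using p by simp
    show "AE t in M. norm (p t * h t) \<le> norm (cmod (p t) * K)"
    proof (rule AE_I2)
      fix t assume "t \<in> space M"
      hence "cmod (h t) \<le> \<bar>K\<bar>" using h by fastforce
      thus "norm (p t * h t) \<le> norm (cmod (p t) * K)" by (simp add: norm_mult abs_mult mult_left_mono)
    qed
  qed measurable
  have pw: "U t ^ l \<in> {0..1}" "V t ^ l \<in> {0..1}" if "t \<in> space M" for t l
    using U[OF that] V[OF that] by (auto simp: power_le_one)
  \<comment> \<open>The remainder of order 0 is the function itself.\<close>
  have Ble: "cmod (fb t) \<le> stieltjes_const b 0 * Sy" if "t \<in> space M" for t
    using rb[OF that, of 0] by simp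
  have cx: "0 \<le> stieltjes_const a N" "\<And>k. 0 \<le> stieltjes_const b k"
    using a b by (auto intro!: stieltjes_const_nonneg)
  define R1 where "R1 t = (fa t - (\<Sum>l<N. Ta l t)) * fb t" for t
  define R2 where "R2 l t = Ta l t * (fb t - (\<Sum>k<N - l. Tb k t))" for l t
  have [measurable]: "R1 \<in> borel_measurable M" "\<And>l. R2 l \<in> borel_measurable M"
    unfolding R1_def[abs_def] R2_def[abs_def] by measurable
  have R1: "cmod (R1 t) \<le> stieltjes_const a N * Sx * (stieltjes_const b 0 * Sy) * cmod x ^ N * U t ^ N" if t: "t \<in> space M" for t
  proof -
    have "cmod (R1 t) \<le> (stieltjes_const a N * Sx * cmod x ^ N * U t ^ N) * (stieltjes_const b 0 * Sy)"
      unfolding R1_def norm_mult using U[OF t] S0 cx by (intro mult_mono ra[OF t] Ble[OF t]) auto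
    thus ?thesis by (simp add: mult_ac)
  qed
  have R2: "cmod (R2 l t) \<le> cmod (binom_coeff a l) * (stieltjes_const b (N - l) * Sy) * cmod x ^ l * cmod y ^ (N - l) * (U t ^ l * V t ^ (N - l))"
    if t: "t \<in> space M" for t l
  proof -
    have "cmod (R2 l t) \<le> (cmod (binom_coeff a l) * (U t * cmod x) ^ l) * (stieltjes_const b (N - l) * Sy * cmod y ^ (N - l) * V t ^ (N - l))"
      unfolding R2_def norm_mult using U[OF t] V[OF t] by (intro mult_mono rb[OF t]) (auto simp: Ta_def norm_mult norm_power)
    thus ?thesis by (simp add: mult_ac power_mult_distrib)
  qed
  have iR1: "integrable M (\<lambda>t. p t * R1 t)"
  proof (rule bnd)
    fix t assume t: "t \<in> space M"
    show "cmod (R1 t) \<le> stieltjes_const a N * Sx * (stieltjes_const b 0 * Sy) * cmod x ^ N"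
      using R1[OF t] mult_left_le[of "U t ^ N" "stieltjes_const a N * Sx * (stieltjes_const b 0 * Sy) * cmod x ^ N"]
        pw[OF t, of N] S0 cx by (smt (verit) atLeastAtMost_iff mult_nonneg_nonneg norm_ge_zero zero_le_power)
  qed measurable
  have iR2: "integrable M (\<lambda>t. p t * R2 l t)" for l
  proof (rule bnd)
    fix t assume t: "t \<in> space M"
    let ?c = "cmod (binom_coeff a l) * (stieltjes_const b (N - l) * Sy) * cmod x ^ l * cmod y ^ (N - l)"
    have "U t ^ l * V t ^ (N - l) \<le> 1" using pw[OF t] by (intro mult_le_one) auto
    moreover have "?c \<ge> 0" using S0 cx by simp
    ultimately have "?c * (U t ^ l * V t ^ (N - l)) \<le> ?c" by (intro mult_left_le) auto
    thus "cmod (R2 l t) \<le> ?c" using R2[OF t, of l] by linarith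
  qed measurable
  have iT: "integrable M (\<lambda>t. p t * (Ta l t * Tb k t))" for l k
  proof (rule bnd)
    fix t assume t: "t \<in> space M"
    have "cmod (Ta l t * Tb k t) = cmod (binom_coeff a l) * cmod (binom_coeff b k) * cmod x ^ l * cmod y ^ k * (U t ^ l * V t ^ k)"
      using U[OF t] V[OF t] by (simp add: Ta_def Tb_def norm_mult norm_power power_mult_distrib)
    also have "\<dots> \<le> cmod (binom_coeff a l) * cmod (binom_coeff b k) * cmod x ^ l * cmod y ^ k"
      using pw[OF t] by (intro mult_left_le mult_le_one) auto
    finally show "cmod (Ta l t * Tb k t) \<le> cmod (binom_coeff a l) * cmod (binom_coeff b k) * cmod x ^ l * cmod y ^ k" .
  qed measurable
  have dec: "fa t * fb t = R1 t + (\<Sum>l<N. R2 l t) + (\<Sum>n<N. \<Sum>l\<le>n. Ta l t * Tb (n - l) t)" for t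
  proof -
    have "(\<Sum>n<N. \<Sum>l\<le>n. Ta l t * Tb (n - l) t) = (\<Sum>l<N. Ta l t * (\<Sum>k<N - l. Tb k t))"
      unfolding sum_double_triangle[of "\<lambda>l k. Ta l t * Tb k t"] sum_distrib_left ..
    moreover have "(\<Sum>l<N. R2 l t) + (\<Sum>l<N. Ta l t * (\<Sum>k<N - l. Tb k t)) = (\<Sum>l<N. Ta l t) * fb t"
      unfolding sum.distrib[symmetric] R2_def sum_distrib_right
      by (rule sum.cong[OF refl]) (simp add: right_diff_distrib)
    ultimately show ?thesis unfolding R1_def by (simp add: algebra_simps)
  qed
  have "(\<integral>t. p t * (fa t * fb t) \<partial>M) = (\<integral>t. p t * R1 t + (\<Sum>l<N. p t * R2 l t) + (\<Sum>n<N. \<Sum>l\<le>n. p t * (Ta l t * Tb (n - l) t)) \<partial>M)"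
    unfolding dec by (simp add: ring_distribs sum_distrib_left)
  also have "\<dots> = (\<integral>t. p t * R1 t \<partial>M) + (\<Sum>l<N. \<integral>t. p t * R2 l t \<partial>M) + (\<Sum>n<N. \<Sum>l\<le>n. \<integral>t. p t * (Ta l t * Tb (n - l) t) \<partial>M)"
    using iR1 iR2 iT by (simp add: Bochner_Integration.integral_sum)
  finally have 1: "(\<integral>t. p t * (fa t * fb t) \<partial>M) - (\<Sum>n<N. \<Sum>l\<le>n. \<integral>t. p t * (Ta l t * Tb (n - l) t) \<partial>M) =
     (\<integral>t. p t * R1 t \<partial>M) + (\<Sum>l<N. \<integral>t. p t * R2 l t \<partial>M)" by simp
  have 2: "(\<integral>t. p t * (Ta l t * Tb k t) \<partial>M) = binom_coeff a l * binom_coeff b k * x ^ l * y ^ k * (\<integral>t. p t * of_real (U t) ^ l * of_real (V t) ^ k \<partial>M)" for l k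
    unfolding Ta_def Tb_def power_mult_distrib integral_mult_right_zero[symmetric] by (simp only: mult_ac)
  have pU: "integrable M (\<lambda>t. cmod (p t) * U t ^ l * V t ^ k)" for l k
  proof -
    have "integrable M (\<lambda>t. p t * of_real (U t ^ l * V t ^ k))"
    proof (rule bnd[where K = 1])
      fix t assume t: "t \<in> space M"
      have "U t ^ l * V t ^ k \<le> 1" "0 \<le> U t ^ l * V t ^ k" using pw[OF t] by (auto intro!: mult_le_one)
      thus "cmod (of_real (U t ^ l * V t ^ k)) \<le> 1" by (simp only: norm_of_real abs_of_nonneg)
    qed measurable
    hence "integrable M (\<lambda>t. cmod (p t * of_real (U t ^ l * V t ^ k)))" by (rule integrable_norm)
    moreover have "cmod (p t * of_real (U t ^ l * V t ^ k)) = cmod (p t) * U t ^ l * V t ^ k" if "t \<in> space M" for t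
      using pw[OF that] by (simp add: norm_mult abs_mult norm_power power_abs[symmetric] del: of_real_mult of_real_power)
    ultimately show ?thesis by (subst (asm) Bochner_Integration.integrable_cong) auto
  qed
  have "cmod (\<integral>t. p t * R1 t \<partial>M) \<le> (\<integral>t. stieltjes_const a N * Sx * (stieltjes_const b 0 * Sy) * cmod x ^ N * (cmod (p t) * U t ^ N) \<partial>M)"
  proof (rule norm_integral_le)
    show "integrable M (\<lambda>t. stieltjes_const a N * Sx * (stieltjes_const b 0 * Sy) * cmod x ^ N * (cmod (p t) * U t ^ N))"
      using pU[of N 0] by simp
    fix t assume t: "t \<in> space M"
    show "norm (p t * R1 t) \<le> stieltjes_const a N * Sx * (stieltjes_const b 0 * Sy) * cmod x ^ N * (cmod (p t) * U t ^ N)"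
      using mult_left_mono[OF R1[OF t], of "cmod (p t)"] by (simp add: norm_mult mult_ac)
  qed
  hence 3: "cmod (\<integral>t. p t * R1 t \<partial>M) \<le> stieltjes_const a N * Sx * (stieltjes_const b 0 * Sy) * cmod x ^ N * (\<integral>t. cmod (p t) * U t ^ N \<partial>M)"
    by simp
  have 4: "cmod (\<integral>t. p t * R2 l t \<partial>M) \<le> cmod (binom_coeff a l) * (stieltjes_const b (N - l) * Sy) * cmod x ^ l * cmod y ^ (N - l) *
               (\<integral>t. cmod (p t) * U t ^ l * V t ^ (N - l) \<partial>M)" for l
  proof -
    let ?c = "cmod (binom_coeff a l) * (stieltjes_const b (N - l) * Sy) * cmod x ^ l * cmod y ^ (N - l)"
    have "cmod (\<integral>t. p t * R2 l t \<partial>M) \<le> (\<integral>t. ?c * (cmod (p t) * U t ^ l * V t ^ (N - l)) \<partial>M)"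
    proof (rule norm_integral_le)
      show "integrable M (\<lambda>t. ?c * (cmod (p t) * U t ^ l * V t ^ (N - l)))" using pU by simp
      fix t assume t: "t \<in> space M"
      show "norm (p t * R2 l t) \<le> ?c * (cmod (p t) * U t ^ l * V t ^ (N - l))"
        using mult_left_mono[OF R2[OF t, of l], of "cmod (p t)"] by (simp add: norm_mult mult_ac)
    qed
    thus ?thesis by simp
  qed
  have "cmod ((\<integral>t. p t * (fa t * fb t) \<partial>M) - (\<Sum>n<N. \<Sum>l\<le>n. \<integral>t. p t * (Ta l t * Tb (n - l) t) \<partial>M)) \<le>
      cmod (\<integral>t. p t * R1 t \<partial>M) + (\<Sum>l<N. cmod (\<integral>t. p t * R2 l t \<partial>M))"
    unfolding 1 by (intro norm_triangle_le add_left_mono norm_sum)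
  also have "\<dots> \<le> stieltjes_const a N * Sx * (stieltjes_const b 0 * Sy) * cmod x ^ N * (\<integral>t. cmod (p t) * U t ^ N \<partial>M)
           + (\<Sum>l<N. cmod (binom_coeff a l) * (stieltjes_const b (N - l) * Sy) * cmod x ^ l * cmod y ^ (N - l) *
               (\<integral>t. cmod (p t) * U t ^ l * V t ^ (N - l) \<partial>M))"
    by (intro add_mono 3 sum_mono 4)
  finally show ?thesis unfolding 2 unfolding fa_def fb_def .
qed

section \<open>The Appell function\<close>

lemma compact_Re_lower_bound:
  fixes f :: "complex \<Rightarrow> complex"
  assumes "compact K" "continuous_on K f" "\<And>z. z \<in> K \<Longrightarrow> c < Re (f z)"
  shows "\<exists>m>c. \<forall>z\<in>K. m \<le> Re (f z)"
proof (cases "K = {}")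
  case False
  have "continuous_on K (\<lambda>z. Re (f z))" by (intro continuous_intros assms)
  then obtain z where "z \<in> K" "\<And>y. y \<in> K \<Longrightarrow> Re (f z) \<le> Re (f y)"
    using continuous_attains_inf[OF assms(1) False] by blast
  thus ?thesis using assms(3) by blast
qed (auto intro: gt_ex)

lemma compact_norm_upper_bound:
  fixes f :: "complex \<Rightarrow> complex"
  assumes "compact K" "continuous_on K f"
  shows "\<exists>m\<ge>0. \<forall>z\<in>K. cmod (f z) \<le> m"
proof -
  have "bounded (f ` K)" by (intro compact_imp_bounded compact_continuous_image assms)
  then obtain m where "\<And>z. z \<in> K \<Longrightarrow> cmod (f z) \<le> m" unfolding bounded_iff by blast
  hence "\<forall>z\<in>K. cmod (f z) \<le> max m 0" by (simp add: le_max_iff_disj)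
  thus ?thesis by (intro exI[of _ "max m 0"]) simp
qed

abbreviation unit_square :: "(real \<times> real) measure" where
  "unit_square \<equiv> unit_lborel \<Otimes>\<^sub>M unit_lborel"

lemma space_unit_square: "space unit_square = {0<..<1} \<times> {0<..<1}"
  by (simp add: space_pair_measure)

lemma measurable_fst_snd_unit_square [measurable]:
  "fst \<in> borel_measurable unit_square" "snd \<in> borel_measurable unit_square"
  by (rule measurable_compose[OF measurable_fst measurable_ident_unit_lborel, unfolded o_def],
      rule measurable_compose[OF measurable_snd measurable_ident_unit_lborel, unfolded o_def])

lemma unit_square_integral_mult:
  fixes f h :: "real \<Rightarrow> 'b::{real_normed_field, banach, second_countable_topology}"
  assumes f: "integrable unit_lborel f" and h: "integrable unit_lborel h"
  shows "has_bochner_integral unit_square (\<lambda>p. f (fst p) * h (snd p)) (integral\<^sup>L unit_lborel f * integral\<^sup>L unit_lborel h)"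
proof -
  have [measurable]: "f \<in> borel_measurable unit_lborel" "h \<in> borel_measurable unit_lborel" using f h by auto
  have int: "integrable unit_square (\<lambda>p. f (fst p) * h (snd p))"
  proof (rule unit_sq.Fubini_integrable)
    show "integrable unit_lborel (\<lambda>x. \<integral>y. norm (f (fst (x, y)) * h (snd (x, y))) \<partial>unit_lborel)"
      using f by (simp add: norm_mult)
    show "AE x in unit_lborel. integrable unit_lborel (\<lambda>y. f (fst (x, y)) * h (snd (x, y)))"
      using h by simp
  qed measurable
  have "integral\<^sup>L unit_square (\<lambda>p. f (fst p) * h (snd p)) = (\<integral>x. (\<integral>y. f x * h y \<partial>unit_lborel) \<partial>unit_lborel)"
    using unit_sq.integral_fst'[OF int] by simp
  also have "\<dots> = integral\<^sup>L unit_lborel f * integral\<^sup>L unit_lborel h" by simp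
  finally show ?thesis using int by (simp add: has_bochner_integral_iff)
qed

text \<open>The Dirichlet density
  \<open>u powr (A - 1/2) * v powr (B - 1/2) * (1 - u - v) powr g\<close> in the coordinates u and w
  with v = (1 - u) w. The powers of 1 - u coming from v, from 1 - u - v and from the Jacobian add up
  to the parameter g + B + 3/2.\<close>

definition sq_weight :: "complex \<Rightarrow> complex \<Rightarrow> complex \<Rightarrow> real \<times> real \<Rightarrow> complex" where
  "sq_weight A B g p = beta_kernel (A + 1/2) (g + B + 3/2) (fst p) * beta_kernel (B + 1/2) (g + 1) (snd p)"

definition sq_second :: "real \<times> real \<Rightarrow> real" where
  "sq_second p = (1 - fst p) * snd p"

lemma measurable_sq [measurable]:
  "sq_weight A B g \<in> borel_measurable unit_square" "sq_second \<in> borel_measurable unit_square"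
  unfolding sq_weight_def[abs_def] sq_second_def[abs_def] by measurable

lemma sq_second_range: "p \<in> space unit_square \<Longrightarrow> sq_second p \<in> {0..1}"
  by (auto simp: space_unit_square sq_second_def intro!: mult_le_one mult_nonneg_nonneg)

lemma fst_range: "p \<in> space unit_square \<Longrightarrow> fst p \<in> {0..1}"
  by (auto simp: space_unit_square)

text \<open>In the application g = \<sigma> - A - B, so that \<open>Re g > -1\<close> is the
  hypothesis that relates \<sigma> to the primed parameters.\<close>

locale appell_params =
  fixes A B g :: complex
  assumes A: "Re A > -1/2" and B: "Re B > -1/2" and g: "Re g > -1"
begin

lemma sq_weight_power:
  assumes "p \<in> space unit_square"
  shows "sq_weight A B g p * of_real (fst p) ^ l * of_real (sq_second p) ^ k =
     beta_kernel (A + 1/2 + of_nat l) (g + B + 3/2 + of_nat k) (fst p) * beta_kernel (B + 1/2 + of_nat k) (g + 1) (snd p)"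
proof -
  have p: "fst p \<in> {0<..<1}" "snd p \<in> {0<..<1}" using assms by (auto simp: space_unit_square)
  have "sq_weight A B g p * of_real (fst p) ^ l * of_real (sq_second p) ^ k =
    (beta_kernel (A + 1/2) (g + B + 3/2) (fst p) * of_real (fst p) ^ l * of_real (1 - fst p) ^ k) *
    (beta_kernel (B + 1/2) (g + 1) (snd p) * of_real (snd p) ^ k)"
    unfolding sq_weight_def sq_second_def of_real_mult power_mult_distrib by (simp only: mult_ac)
  thus ?thesis unfolding beta_kernel_mult_power(1)[OF p(1)] beta_kernel_mult_power(2)[OF p(1)] beta_kernel_mult_power(1)[OF p(2)] .
qed

text \<open>\<open>Gamma (g + B + 3/2 + of_nat k)\<close> occurs in both beta integrals and cancels.
  The remaining denominator depends on l + k only, which is why terms of equal total degree share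
  one inverse factorial.\<close>

lemma sq_weight_moment:
  "(\<integral>p. sq_weight A B g p * of_real (fst p) ^ l * of_real (sq_second p) ^ k \<partial>unit_square) =
     Gamma (A + 1/2 + of_nat l) * Gamma (B + 1/2 + of_nat k) * Gamma (g + 1) * rGamma (A + B + g + 2 + of_nat (l + k))"
proof -
  have "(\<integral>p. sq_weight A B g p * of_real (fst p) ^ l * of_real (sq_second p) ^ k \<partial>unit_square) =
    (\<integral>p. beta_kernel (A + 1/2 + of_nat l) (g + B + 3/2 + of_nat k) (fst p) * beta_kernel (B + 1/2 + of_nat k) (g + 1) (snd p) \<partial>unit_square)"
    by (rule Bochner_Integration.integral_cong[OF refl]) (rule sq_weight_power)
  also have "\<dots> = integral\<^sup>L unit_lborel (beta_kernel (A + 1/2 + of_nat l) (g + B + 3/2 + of_nat k)) *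
      integral\<^sup>L unit_lborel (beta_kernel (B + 1/2 + of_nat k) (g + 1))"
    using A B g by (intro has_bochner_integral_integral_eq unit_square_integral_mult beta_kernel_integrable) auto
  also have "\<dots> = Beta (A + 1/2 + of_nat l) (g + B + 3/2 + of_nat k) * Beta (B + 1/2 + of_nat k) (g + 1)"
    using A B g by (subst (1 2) beta_kernel_integral) auto
  also have "\<dots> = Gamma (A + 1/2 + of_nat l) * Gamma (B + 1/2 + of_nat k) * Gamma (g + 1) *
      rGamma (A + 1/2 + of_nat l + (g + B + 3/2 + of_nat k)) *
      (rGamma (B + 1/2 + of_nat k + (g + 1)) * Gamma (g + B + 3/2 + of_nat k))"
    unfolding Beta_altdef by (simp only: mult_ac)
  also have "B + 1/2 + of_nat k + (g + 1) = g + B + 3/2 + of_nat k" by simp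
  also have "rGamma (g + B + 3/2 + of_nat k) * Gamma (g + B + 3/2 + of_nat k) = 1"
    using B g by (intro rGamma_mult_Gamma) auto
  also have "A + 1/2 + of_nat l + (g + B + 3/2 + of_nat k) = A + B + g + 2 + of_nat (l + k)" by simp
  finally show ?thesis by simp
qed

lemma sq_weight_integrable: "integrable unit_square (sq_weight A B g)"
proof -
  have "has_bochner_integral unit_square (\<lambda>p. beta_kernel (A + 1/2) (g + B + 3/2) (fst p) * beta_kernel (B + 1/2) (g + 1) (snd p))
     (integral\<^sup>L unit_lborel (beta_kernel (A + 1/2) (g + B + 3/2)) * integral\<^sup>L unit_lborel (beta_kernel (B + 1/2) (g + 1)))"
    using A B g by (intro unit_square_integral_mult beta_kernel_integrable) auto
  thus ?thesis unfolding sq_weight_def[abs_def] by (simp add: has_bochner_integral_iff)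
qed

text \<open>Moduli replace all parameters by their real parts. The discrepancy to
  \<open>sq_weight_moment\<close> is what \<open>kappa\<close> and \<open>rho\<close>
  record.\<close>

lemma sq_weight_norm_moment:
  "(\<integral>p. cmod (sq_weight A B g p) * fst p ^ l * sq_second p ^ k \<partial>unit_square) =
     Gamma (Re A + 1/2 + real l) * Gamma (Re B + 1/2 + real k) * Gamma (Re g + 1) / Gamma (Re A + Re B + Re g + 2 + real (l + k))"
proof -
  have nint: "(\<integral>u. cmod (beta_kernel a b u) \<partial>unit_lborel) = Beta (Re a) (Re b)" if "Re a > 0" "Re b > 0" for a b
  proof -
    have "(\<integral>u. cmod (beta_kernel a b u) \<partial>unit_lborel) = (\<integral>u. u powr (Re a - 1) * (1 - u) powr (Re b - 1) \<partial>unit_lborel)"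
      by (rule Bochner_Integration.integral_cong) (auto simp: norm_beta_kernel)
    also have "\<dots> = Beta (Re a) (Re b)"
      using real_beta_integrable[OF that] by (simp only: has_bochner_integral_iff)
    finally show ?thesis .
  qed
  have "(\<integral>p. cmod (sq_weight A B g p) * fst p ^ l * sq_second p ^ k \<partial>unit_square) =
    (\<integral>p. cmod (beta_kernel (A + 1/2 + of_nat l) (g + B + 3/2 + of_nat k) (fst p)) * cmod (beta_kernel (B + 1/2 + of_nat k) (g + 1) (snd p)) \<partial>unit_square)"
  proof (rule Bochner_Integration.integral_cong[OF refl])
    fix p assume p: "p \<in> space unit_square"
    show "cmod (sq_weight A B g p) * fst p ^ l * sq_second p ^ k =
      cmod (beta_kernel (A + 1/2 + of_nat l) (g + B + 3/2 + of_nat k) (fst p)) * cmod (beta_kernel (B + 1/2 + of_nat k) (g + 1) (snd p))"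
      unfolding norm_mult[symmetric] sq_weight_power[OF p, symmetric]
      using fst_range[OF p] sq_second_range[OF p] by (simp add: norm_mult norm_power)
  qed
  also have "\<dots> = (\<integral>u. cmod (beta_kernel (A + 1/2 + of_nat l) (g + B + 3/2 + of_nat k) u) \<partial>unit_lborel) *
      (\<integral>u. cmod (beta_kernel (B + 1/2 + of_nat k) (g + 1) u) \<partial>unit_lborel)"
    using A B g by (intro has_bochner_integral_integral_eq unit_square_integral_mult integrable_norm beta_kernel_integrable) auto
  also have "\<dots> = Beta (Re A + 1/2 + real l) (Re g + Re B + 3/2 + real k) * Beta (Re B + 1/2 + real k) (Re g + 1)"
    using A B g by (subst (1 2) nint) auto
  also have "\<dots> = Gamma (Re A + 1/2 + real l) * Gamma (Re B + 1/2 + real k) * Gamma (Re g + 1) /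
      Gamma (Re A + 1/2 + real l + (Re g + Re B + 3/2 + real k)) *
      (Gamma (Re g + Re B + 3/2 + real k) / Gamma (Re B + 1/2 + real k + (Re g + 1)))"
    unfolding Beta_def by simp
  also have "Re B + 1/2 + real k + (Re g + 1) = Re g + Re B + 3/2 + real k" by simp
  also have "Gamma (Re g + Re B + 3/2 + real k) / Gamma (Re g + Re B + 3/2 + real k) = 1"
  proof -
    have "Re g + Re B + 3/2 + real k > 0" using B g by simp
    from Gamma_real_pos[OF this] show ?thesis by simp
  qed
  also have "Re A + 1/2 + real l + (Re g + Re B + 3/2 + real k) = Re A + Re B + Re g + 2 + real (l + k)" by simp
  finally show ?thesis by simp
qed

end

text \<open>The double integral representation of the Appell function \<open>F\<^sub>3\<close> with parameters \<open>1/2 \<plusminus> A\<close> and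
  \<open>1/2 \<plusminus> B\<close>, on the simplex parametrised by \<open>(u, (1 - u) w)\<close>.\<close>

definition appell_E :: "complex \<Rightarrow> complex \<Rightarrow> complex \<Rightarrow> complex \<Rightarrow> complex \<Rightarrow> complex" where
  "appell_E A B g x y = rGamma (A + 1/2) * rGamma (B + 1/2) * rGamma (g + 1) *
     (\<integral>p. sq_weight A B g p * ((1 - of_real (fst p) * x) powr (-(1/2 - A)) *
           (1 - of_real (sq_second p) * y) powr (-(1/2 - B))) \<partial>unit_square)"

lemma (in appell_params) normalised_moment:
  "rGamma (A + 1/2) * rGamma (B + 1/2) * rGamma (g + 1) *
     (\<integral>p. sq_weight A B g p * of_real (fst p) ^ l * of_real (sq_second p) ^ k \<partial>unit_square) =
   pochhammer (1/2 + A) l * pochhammer (1/2 + B) k * rGamma (A + B + g + 2 + of_nat (l + k))"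
proof -
  have 1: "rGamma (z + 1/2) * Gamma (z + 1/2 + of_nat l) = pochhammer (1/2 + z) l" if "Re z > -1/2" for z :: complex and l
  proof -
    have z: "Re (z + 1/2) > 0" using that by simp
    show ?thesis
      unfolding Gamma_plus_of_nat[OF z] using rGamma_mult_Gamma[OF z] by (simp add: mult_ac add.commute)
  qed
  have 2: "rGamma (g + 1) * Gamma (g + 1) = 1" using g by (intro rGamma_mult_Gamma) auto
  have "rGamma (A + 1/2) * rGamma (B + 1/2) * rGamma (g + 1) *
     (Gamma (A + 1/2 + of_nat l) * Gamma (B + 1/2 + of_nat k) * Gamma (g + 1) * rGamma (A + B + g + 2 + of_nat (l + k))) =
     (rGamma (A + 1/2) * Gamma (A + 1/2 + of_nat l)) * (rGamma (B + 1/2) * Gamma (B + 1/2 + of_nat k)) * (rGamma (g + 1) * Gamma (g + 1)) *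
       rGamma (A + B + g + 2 + of_nat (l + k))"
    by (simp only: mult_ac)
  thus ?thesis unfolding sq_weight_moment unfolding 1[OF A] 1[OF B] 2 by simp
qed

text \<open>Taylor coefficient times normalised moment. The factor \<open>(-2) ^ l\<close> later
  splits into the sign of the series and the factors 2 in \<open>XY_cayley\<close>.\<close>

lemma binom_coeff_coeff_a:
  "binom_coeff (1/2 - A) l * pochhammer (1/2 + A) l = (-2) ^ l * coeff_a l A"
  unfolding binom_coeff_def coeff_a_def by simp

text \<open>Although confined to the bidisc, this expansion shows that A and B enter only through
  \<open>coeff_a\<close>, which is even, and through the sum A + B + g. It is the source of
  \<open>jacobi_E_symmetric\<close>.\<close>

lemma (in appell_params) appell_E_sums:
  assumes x: "cmod x < 1" and y: "cmod y < 1"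
  shows "(\<lambda>n. \<Sum>l\<le>n. (-2) ^ n * coeff_a l A * coeff_a (n - l) B * x ^ l * y ^ (n - l) * rGamma (A + B + g + 2 + of_nat n))
           sums appell_E A B g x y"
proof -
  let ?a = "binom_coeff (1/2 - A)" and ?b = "binom_coeff (1/2 - B)"
  let ?G = "\<lambda>(n::nat) (p :: real \<times> real). \<Sum>l\<le>n. ?a l * (of_real (fst p) * x) ^ l * (?b (n - l) * (of_real (sq_second p) * y) ^ (n - l))"
  let ?C = "\<lambda>n::nat. \<Sum>l\<le>n. (cmod (?a l) * cmod x ^ l) * (cmod (?b (n - l)) * cmod y ^ (n - l))"
  have abs: "summable (\<lambda>n. cmod (binom_coeff c n) * cmod z ^ n)" if "cmod z < 1" for c z
    unfolding binom_coeff_def using that by (intro binomial_series_abs_summable) auto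
  have C: "summable ?C"
    by (rule summable_Cauchy_product[of "\<lambda>n. cmod (?a n) * cmod x ^ n" "\<lambda>n. cmod (?b n) * cmod y ^ n"])
       (simp_all add: abs_mult abs[OF x] abs[OF y])
  have "(\<lambda>n. \<integral>p. sq_weight A B g p * ?G n p \<partial>unit_square) sums
      (\<integral>p. sq_weight A B g p * ((1 - of_real (fst p) * x) powr (-(1/2 - A)) * (1 - of_real (sq_second p) * y) powr (-(1/2 - B))) \<partial>unit_square)"
  proof (rule integral_sums_bounded[OF sq_weight_integrable, where C = ?C])
    fix p assume p: "p \<in> space unit_square"
    have le: "cmod (of_real (fst p) * x) \<le> cmod x" "cmod (of_real (sq_second p) * y) \<le> cmod y"
      using fst_range[OF p] sq_second_range[OF p] by (auto simp: norm_mult intro!: mult_left_le_one_le)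
    show "cmod (?G n p) \<le> ?C n" for n
    proof (rule order_trans[OF norm_sum sum_mono])
      fix l
      show "cmod (?a l * (of_real (fst p) * x) ^ l * (?b (n - l) * (of_real (sq_second p) * y) ^ (n - l))) \<le>
          (cmod (?a l) * cmod x ^ l) * (cmod (?b (n - l)) * cmod y ^ (n - l))"
        unfolding norm_mult[of "_ ^ _"] norm_mult[of "binom_coeff _ _"] norm_mult[of "binom_coeff _ _ * _"] norm_power
        using le by (intro mult_mono mult_left_mono power_mono) auto
    qed
    have s: "summable (\<lambda>k. norm (binom_coeff c k * z ^ k))" if "cmod z < 1" for c z
      using abs[OF that] by (simp add: norm_mult norm_power)
    have bs: "(\<Sum>k. binom_coeff c k * z ^ k) = (1 - z) powr (- c)" if "cmod z < 1" for c z
      using binomial_series_pochhammer[OF that, of c] unfolding binom_coeff_def by (rule sums_unique[symmetric])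
    have lt: "cmod (of_real (fst p) * x) < 1" "cmod (of_real (sq_second p) * y) < 1" using le x y by auto
    show "(\<lambda>n. ?G n p) sums ((1 - of_real (fst p) * x) powr (-(1/2 - A)) * (1 - of_real (sq_second p) * y) powr (-(1/2 - B)))"
      using Cauchy_product_sums[OF s[OF lt(1), of "1/2 - A"] s[OF lt(2), of "1/2 - B"]] unfolding bs[OF lt(1)] bs[OF lt(2)] .
  next
    show "(\<lambda>p. ?G n p) \<in> borel_measurable unit_square" for n by measurable
  qed (rule C)
  hence "(\<lambda>n. rGamma (A + 1/2) * rGamma (B + 1/2) * rGamma (g + 1) * (\<integral>p. sq_weight A B g p * ?G n p \<partial>unit_square)) sums appell_E A B g x y"
    unfolding appell_E_def by (rule sums_mult)
  moreover have "rGamma (A + 1/2) * rGamma (B + 1/2) * rGamma (g + 1) * (\<integral>p. sq_weight A B g p * ?G n p \<partial>unit_square) =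
     (\<Sum>l\<le>n. (-2) ^ n * coeff_a l A * coeff_a (n - l) B * x ^ l * y ^ (n - l) * rGamma (A + B + g + 2 + of_nat n))" for n
  proof -
    let ?m = "\<lambda>l k. \<integral>p. sq_weight A B g p * of_real (fst p) ^ l * of_real (sq_second p) ^ k \<partial>unit_square"
    have ip: "integrable unit_square (\<lambda>p. sq_weight A B g p * of_real (fst p) ^ l * of_real (sq_second p) ^ k)" for l k
    proof (rule Bochner_Integration.integrable_bound[OF sq_weight_integrable])
      show "AE p in unit_square. norm (sq_weight A B g p * of_real (fst p) ^ l * of_real (sq_second p) ^ k) \<le> norm (sq_weight A B g p)"
      proof (rule AE_I2)
        fix p assume p: "p \<in> space unit_square"
        have "fst p ^ l * sq_second p ^ k \<le> 1"
          using fst_range[OF p] sq_second_range[OF p] by (intro mult_le_one power_le_one) auto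
        hence "norm (sq_weight A B g p) * (fst p ^ l * sq_second p ^ k) \<le> norm (sq_weight A B g p)"
          by (intro mult_left_le) auto
        thus "norm (sq_weight A B g p * of_real (fst p) ^ l * of_real (sq_second p) ^ k) \<le> norm (sq_weight A B g p)"
          using fst_range[OF p] sq_second_range[OF p] by (simp add: norm_mult norm_power mult_ac)
      qed
    qed measurable
    have "(\<integral>p. sq_weight A B g p * ?G n p \<partial>unit_square) =
        (\<integral>p. (\<Sum>l\<le>n. (?a l * ?b (n - l) * x ^ l * y ^ (n - l)) * (sq_weight A B g p * of_real (fst p) ^ l * of_real (sq_second p) ^ (n - l))) \<partial>unit_square)"
      unfolding sum_distrib_left power_mult_distrib by (simp only: mult_ac)
    also have "\<dots> = (\<Sum>l\<le>n. (?a l * ?b (n - l) * x ^ l * y ^ (n - l)) * ?m l (n - l))"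
      using ip by (subst Bochner_Integration.integral_sum) auto
    finally have "rGamma (A + 1/2) * rGamma (B + 1/2) * rGamma (g + 1) * (\<integral>p. sq_weight A B g p * ?G n p \<partial>unit_square) =
        (\<Sum>l\<le>n. (?a l * ?b (n - l) * x ^ l * y ^ (n - l)) * (rGamma (A + 1/2) * rGamma (B + 1/2) * rGamma (g + 1) * ?m l (n - l)))"
      by (simp only: sum_distrib_left mult_ac)
    also have "\<dots> = (\<Sum>l\<le>n. (-2) ^ n * coeff_a l A * coeff_a (n - l) B * x ^ l * y ^ (n - l) * rGamma (A + B + g + 2 + of_nat n))"
    proof (rule sum.cong[OF refl])
      fix l assume l: "l \<in> {..n}"
      have "(?a l * ?b (n - l) * x ^ l * y ^ (n - l)) * (pochhammer (1/2 + A) l * pochhammer (1/2 + B) (n - l) * rGamma (A + B + g + 2 + of_nat (l + (n - l)))) =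
         (?a l * pochhammer (1/2 + A) l) * (?b (n - l) * pochhammer (1/2 + B) (n - l)) * x ^ l * y ^ (n - l) * rGamma (A + B + g + 2 + of_nat (l + (n - l)))"
        by (simp only: mult_ac)
      also have "\<dots> = ((-2) ^ l * (-2) ^ (n - l)) * coeff_a l A * coeff_a (n - l) B * x ^ l * y ^ (n - l) * rGamma (A + B + g + 2 + of_nat (l + (n - l)))"
        unfolding binom_coeff_coeff_a by (simp only: mult_ac)
      also have "(-2 :: complex) ^ l * (-2) ^ (n - l) = (-2) ^ n" using l by (simp flip: power_add)
      also have "l + (n - l) = n" using l by simp
      finally show "(?a l * ?b (n - l) * x ^ l * y ^ (n - l)) * (rGamma (A + 1/2) * rGamma (B + 1/2) * rGamma (g + 1) * ?m l (n - l)) =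
         (-2) ^ n * coeff_a l A * coeff_a (n - l) B * x ^ l * y ^ (n - l) * rGamma (A + B + g + 2 + of_nat n)"
        unfolding normalised_moment using l by simp
    qed
    finally show ?thesis .
  qed
  ultimately show ?thesis by (simp only:)
qed

text \<open>All five arguments may vary together, since the continuations move the parameters along
  a line and W in a half-plane.\<close>

lemma appell_E_holomorphic:
  assumes Z: "open Z" and hol: "A holomorphic_on Z" "B holomorphic_on Z" "g holomorphic_on Z" "x holomorphic_on Z" "y holomorphic_on Z"
    and par: "\<And>z. z \<in> Z \<Longrightarrow> Re (A z) > -1/2" "\<And>z. z \<in> Z \<Longrightarrow> Re (B z) > -1/2" "\<And>z. z \<in> Z \<Longrightarrow> Re (g z) > -1"
    and xy: "\<And>z. z \<in> Z \<Longrightarrow> x z \<in> slit_plane" "\<And>z. z \<in> Z \<Longrightarrow> y z \<in> slit_plane"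
  shows "(\<lambda>z. appell_E (A z) (B z) (g z) (x z) (y z)) holomorphic_on Z"
proof -
  let ?f = "\<lambda>z p. sq_weight (A z) (B z) (g z) p * ((1 - of_real (fst p) * x z) powr (-(1/2 - A z)) *
           (1 - of_real (sq_second p) * y z) powr (-(1/2 - B z)))"
  have "(\<lambda>z. integral\<^sup>L unit_square (?f z)) holomorphic_on Z"
  proof (rule holomorphic_on_integral_parameter[OF Z])
    fix p assume p: "p \<in> space unit_square"
    have b: "(\<lambda>z. beta_kernel (a z) (b z) u) holomorphic_on Z" if "a holomorphic_on Z" "b holomorphic_on Z" "u \<in> {0<..<1}" for a b u
      unfolding beta_kernel_def using that by (intro holomorphic_intros) auto
    have q: "(\<lambda>z. (1 - of_real u * w z) powr c z) holomorphic_on Z"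
      if "w holomorphic_on Z" "c holomorphic_on Z" "\<And>z. z \<in> Z \<Longrightarrow> w z \<in> slit_plane" "u \<in> {0..1}" for w c u
    proof (intro holomorphic_intros that(1,2))
      fix z assume "z \<in> Z"
      thus "1 - of_real u * w z \<notin> \<real>\<^sub>\<le>\<^sub>0" using that(3,4) by (intro slit_plane_notin_cut) auto
    qed
    show "(\<lambda>z. ?f z p) holomorphic_on Z"
      unfolding sq_weight_def
      by (intro holomorphic_on_mult b q holomorphic_on_add holomorphic_on_minus holomorphic_on_diff holomorphic_on_const hol xy
            fst_range[OF p] sq_second_range[OF p]) (use p in \<open>auto simp: space_unit_square\<close>)
  next
    fix z assume "z \<in> Z"
    then obtain r where r: "r > 0" "cball z r \<subseteq> Z" using Z open_contains_cball by blast
    let ?K = "cball z r"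
    have cont: "continuous_on ?K h" if "h holomorphic_on Z" for h
      using that r(2) holomorphic_on_imp_continuous_on continuous_on_subset by blast
    have parK: "\<And>w. w \<in> ?K \<Longrightarrow> -1/2 < Re (A w)" "\<And>w. w \<in> ?K \<Longrightarrow> -1/2 < Re (B w)" "\<And>w. w \<in> ?K \<Longrightarrow> -1 < Re (g w)"
      using par r(2) by (meson subsetD)+
    \<comment> \<open>On a compact disc the real parts stay above their thresholds by a margin. On
      the open unit interval the kernel with the smallest real parts dominates all the others, and
      the bounds on the logarithms dominate the powers.\<close>
    obtain A0 where A0: "A0 > -1/2" "\<forall>w\<in>?K. A0 \<le> Re (A w)"
      using compact_Re_lower_bound[OF compact_cball cont[OF hol(1)] parK(1)] by blast
    obtain B0 where B0: "B0 > -1/2" "\<forall>w\<in>?K. B0 \<le> Re (B w)"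
      using compact_Re_lower_bound[OF compact_cball cont[OF hol(2)] parK(2)] by blast
    obtain g0 where g0: "g0 > -1" "\<forall>w\<in>?K. g0 \<le> Re (g w)"
      using compact_Re_lower_bound[OF compact_cball cont[OF hol(3)] parK(3)] by blast
    obtain mA where mA: "mA \<ge> 0" "\<forall>w\<in>?K. cmod (-(1/2 - A w)) \<le> mA"
      using compact_norm_upper_bound[OF compact_cball cont[OF holomorphic_on_minus[OF holomorphic_on_diff[OF holomorphic_on_const hol(1)]]]]
      by metis
    obtain mB where mB: "mB \<ge> 0" "\<forall>w\<in>?K. cmod (-(1/2 - B w)) \<le> mB"
      using compact_norm_upper_bound[OF compact_cball cont[OF holomorphic_on_minus[OF holomorphic_on_diff[OF holomorphic_on_const hol(2)]]]]
      by metis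
    have im: "compact (x ` ?K)" "x ` ?K \<subseteq> slit_plane" "compact (y ` ?K)" "y ` ?K \<subseteq> slit_plane"
      using cont[OF hol(4)] cont[OF hol(5)] xy r(2) by (auto intro!: compact_continuous_image)
    obtain Lx where Lx: "Lx \<ge> 0" "\<forall>u\<in>{0..1}. \<forall>w\<in>x ` ?K. cmod (Ln (1 - of_real u * w)) \<le> Lx"
      using slit_plane_Ln_bound[OF im(1,2)] by metis
    obtain Ly where Ly: "Ly \<ge> 0" "\<forall>u\<in>{0..1}. \<forall>w\<in>y ` ?K. cmod (Ln (1 - of_real u * w)) \<le> Ly"
      using slit_plane_Ln_bound[OF im(3,4)] by metis
    let ?h1 = "\<lambda>u. u powr (A0 + 1/2 - 1) * (1 - u) powr (g0 + B0 + 3/2 - 1)"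
    let ?h2 = "\<lambda>u. u powr (B0 + 1/2 - 1) * (1 - u) powr (g0 + 1 - 1)"
    let ?h = "\<lambda>p. ?h1 (fst p) * ?h2 (snd p) * (exp (mA * Lx) * exp (mB * Ly))"
    have "has_bochner_integral unit_square (\<lambda>p. ?h1 (fst p) * ?h2 (snd p)) (integral\<^sup>L unit_lborel ?h1 * integral\<^sup>L unit_lborel ?h2)"
      using A0 B0 g0 real_beta_integrable[of "A0 + 1/2" "g0 + B0 + 3/2"] real_beta_integrable[of "B0 + 1/2" "g0 + 1"]
      by (intro unit_square_integral_mult) (simp_all add: has_bochner_integral_iff)
    hence int: "integrable unit_square ?h" by (simp add: has_bochner_integral_iff)
    have "cmod (?f w p) \<le> ?h p" if w: "w \<in> ?K" and p: "p \<in> space unit_square" for w p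
    proof -
      have u: "fst p \<in> {0<..<1}" "snd p \<in> {0<..<1}" using p by (auto simp: space_unit_square)
      have 1: "cmod (beta_kernel (A w + 1/2) (g w + B w + 3/2) (fst p)) \<le> ?h1 (fst p)"
        unfolding norm_beta_kernel[OF u(1)] using u A0(2) B0(2) g0(2) w
        by (intro mult_mono powr_mono_base_le_1) (auto simp: add_mono)
      have 2: "cmod (beta_kernel (B w + 1/2) (g w + 1) (snd p)) \<le> ?h2 (snd p)"
        unfolding norm_beta_kernel[OF u(2)] using u B0(2) g0(2) w
        by (intro mult_mono powr_mono_base_le_1) auto
      have 3: "cmod ((1 - of_real (fst p) * x w) powr (-(1/2 - A w))) \<le> exp (mA * Lx)"
      proof (rule order_trans[OF norm_powr_le_exp])
        have "cmod (-(1/2 - A w)) * cmod (Ln (1 - of_real (fst p) * x w)) \<le> mA * Lx"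
          using mA Lx w fst_range[OF p] by (intro mult_mono) auto
        thus "exp (cmod (-(1/2 - A w)) * cmod (Ln (1 - of_real (fst p) * x w))) \<le> exp (mA * Lx)" by (simp only: exp_le_cancel_iff)
      qed
      have 4: "cmod ((1 - of_real (sq_second p) * y w) powr (-(1/2 - B w))) \<le> exp (mB * Ly)"
      proof (rule order_trans[OF norm_powr_le_exp])
        have "cmod (-(1/2 - B w)) * cmod (Ln (1 - of_real (sq_second p) * y w)) \<le> mB * Ly"
          using mB Ly w sq_second_range[OF p] by (intro mult_mono) auto
        thus "exp (cmod (-(1/2 - B w)) * cmod (Ln (1 - of_real (sq_second p) * y w))) \<le> exp (mB * Ly)" by (simp only: exp_le_cancel_iff)
      qed
      show ?thesis unfolding norm_mult sq_weight_def
        by (intro mult_mono 1 2 3 4) (auto intro!: mult_nonneg_nonneg)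
    qed
    thus "\<exists>r>0. \<exists>h. cball z r \<subseteq> Z \<and> integrable unit_square h \<and> (\<forall>w\<in>cball z r. \<forall>p\<in>space unit_square. cmod (?f w p) \<le> h p)"
      using r int by (intro exI[of _ r] conjI exI[of _ ?h] ballI) auto
  qed measurable
  thus ?thesis unfolding appell_E_def
    by (intro holomorphic_on_mult holomorphic_rGamma' holomorphic_on_add holomorphic_on_const hol)
qed

section \<open>Remainder bounds for the Appell function\<close>

text \<open>The reflection formula at 1/2 + x, with both Gamma factors moved up n steps. It exhibits
  a_n(x) / cos (pi x) as a function that has no singularity for |x| < n + 1/2, which is what gives
  the limiting values in \<open>hat_a\<close> a meaning.\<close>

lemma pochhammer_half_product:
  fixes x :: real
  assumes "\<bar>x\<bar> < real n + 1/2"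
  shows "pochhammer (1/2 + x) n * pochhammer (1/2 - x) n =
           cos (pi * x) * Gamma (1/2 + x + real n) * Gamma (1/2 - x + real n) / pi"
proof -
  define a where "a = 1/2 + x"
  have a: "1/2 - x = 1 - a" by (simp add: a_def)
  have "complex_of_real (rGamma a * rGamma (1 - a)) = rGamma (of_real a) * rGamma (of_real (1 - a))"
    by (simp only: rGamma_complex_of_real of_real_mult)
  also have "\<dots> = rGamma (of_real a) * rGamma (1 - of_real a)" by simp
  also have "\<dots> = sin (of_real (pi * a)) / of_real pi"
    unfolding rGamma_reflection_complex by simp
  also have "\<dots> = of_real (sin (pi * a) / pi)"
    by (simp only: sin_of_real of_real_divide)
  finally have "rGamma a * rGamma (1 - a) = sin (pi * a) / pi"
    by (simp only: of_real_eq_iff)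
  moreover have "sin (pi * a) = cos (pi * x)"
    by (simp add: a_def ring_distribs sin_add)
  ultimately have r: "rGamma (1/2 + x) * rGamma (1/2 - x) = cos (pi * x) / pi"
    unfolding a by (simp only: a_def)
  have pos: "1/2 + x + real n > 0" "1/2 - x + real n > 0" using assms by auto
  have g: "rGamma (1/2 + x + real n) * Gamma (1/2 + x + real n) = 1" "rGamma (1/2 - x + real n) * Gamma (1/2 - x + real n) = 1"
    using Gamma_real_pos[OF pos(1)] Gamma_real_pos[OF pos(2)] by (simp_all add: rGamma_inverse_Gamma)
  have "pochhammer (1/2 + x) n * pochhammer (1/2 - x) n =
     (pochhammer (1/2 + x) n * (rGamma (1/2 + x + real n) * Gamma (1/2 + x + real n))) *
     (pochhammer (1/2 - x) n * (rGamma (1/2 - x + real n) * Gamma (1/2 - x + real n)))"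
    unfolding g by simp
  also have "\<dots> = (pochhammer (1/2 + x) n * rGamma (1/2 + x + real n)) * (pochhammer (1/2 - x) n * rGamma (1/2 - x + real n)) *
      (Gamma (1/2 + x + real n) * Gamma (1/2 - x + real n))"
    by (simp only: mult_ac)
  also have "\<dots> = rGamma (1/2 + x) * rGamma (1/2 - x) * (Gamma (1/2 + x + real n) * Gamma (1/2 - x + real n))"
    using pochhammer_rGamma[of "1/2 + x" n] pochhammer_rGamma[of "1/2 - x" n] by simp
  finally show ?thesis unfolding r by simp
qed

lemma hat_a_eq:
  assumes "\<bar>Re \<mu>\<bar> < real n + 1/2"
  shows "hat_a n \<mu> = cmod (cos (of_real pi * \<mu>)) / pi * (Gamma (1/2 + Re \<mu> + real n) * Gamma (1/2 - Re \<mu> + real n) / (2 ^ n * fact n))"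
proof -
  define G where "G x = Gamma (1/2 + x + real n) * Gamma (1/2 - x + real n) / (pi * ((-2) ^ n * fact n))" for x :: real
  have eq: "coeff_a n x / cos (pi * x) = G x" if "\<bar>x\<bar> < real n + 1/2" "cos (pi * x) \<noteq> 0" for x
    unfolding coeff_a_def pochhammer_half_product[OF that(1)] G_def using that(2) by simp
  have zero: "\<exists>k::int. odd k \<and> 2 * x = of_int k" if c: "cos (pi * x) = 0" for x
  proof -
    obtain i :: int where "odd i" "pi * x = of_int i * (pi / 2)" using c unfolding cos_zero_iff_int by auto
    hence "2 * x = of_int i" by (simp add: field_simps)
    thus ?thesis using \<open>odd i\<close> by blast
  qed
  have val: "(if \<exists>k::int. odd k \<and> 2 * Re \<mu> = of_int k
      then Lim (at (Re \<mu>)) (\<lambda>x::real. coeff_a n x / cos (pi * x))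
      else coeff_a n (Re \<mu>) / cos (pi * Re \<mu>)) = G (Re \<mu>)"
  proof (cases "\<exists>k::int. odd k \<and> 2 * Re \<mu> = of_int k")
    case True
    then obtain k :: int where k: "odd k" "2 * Re \<mu> = of_int k" by blast
    \<comment> \<open>Within distance 1/2 of \<open>Re \<mu>\<close> there is no other multiple of
      1/2, so the cosine does not vanish there. The second bound keeps x in the range of the product
      formula.\<close>
    define e where "e = min (1/2) (real n + 1/2 - \<bar>Re \<mu>\<bar>)"
    have e: "e > 0" using assms by (auto simp: e_def)
    have ne: "cos (pi * x) \<noteq> 0" if "x \<noteq> Re \<mu>" "dist x (Re \<mu>) < e" for x
    proof
      assume "cos (pi * x) = 0"
      from zero[OF this] obtain j :: int where j: "2 * x = of_int j" by blast
      have "real_of_int (j - k) = 2 * (x - Re \<mu>)" using j k(2) by simp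
      hence "\<bar>real_of_int (j - k)\<bar> < 1" using that(2) by (simp only: abs_mult) (simp add: dist_real_def e_def)
      hence "j = k" by linarith
      thus False using that(1) j k by simp
    qed
    have ev: "\<forall>\<^sub>F x in at (Re \<mu>). coeff_a n x / cos (pi * x) = G x"
      unfolding eventually_at
    proof (intro exI[of _ e] conjI ballI impI e)
      fix x assume x: "x \<noteq> Re \<mu> \<and> dist x (Re \<mu>) < e"
      show "coeff_a n x / cos (pi * x) = G x"
        by (rule eq[OF _ ne]) (use x in \<open>auto simp: e_def dist_real_def\<close>)
    qed
    have "isCont G (Re \<mu>)"
      unfolding G_def using assms by (intro continuous_intros) (auto elim!: nonpos_Ints_cases)
    hence "(G \<longlongrightarrow> G (Re \<mu>)) (at (Re \<mu>))" by (simp add: isCont_def)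
    hence "((\<lambda>x. coeff_a n x / cos (pi * x)) \<longlongrightarrow> G (Re \<mu>)) (at (Re \<mu>))"
      by (subst tendsto_cong[OF ev])
    thus ?thesis using True by (simp add: tendsto_Lim)
  next
    case False
    hence "cos (pi * Re \<mu>) \<noteq> 0" using zero by blast
    from eq[OF assms this] show ?thesis unfolding if_not_P[OF False] .
  qed
  have "1/2 + Re \<mu> + real n > 0" "1/2 - Re \<mu> + real n > 0" using assms by auto
  hence "\<bar>G (Re \<mu>)\<bar> = Gamma (1/2 + Re \<mu> + real n) * Gamma (1/2 - Re \<mu> + real n) / (pi * (2 ^ n * fact n))"
    unfolding G_def by (simp add: abs_mult power_abs Gamma_real_nonneg)
  thus ?thesis unfolding hat_a_def val by (simp add: norm_mult)
qed

lemma hat_a_minus: "\<bar>Re \<mu>\<bar> < real n + 1/2 \<Longrightarrow> hat_a n (- \<mu>) = hat_a n \<mu>"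
  by (simp add: hat_a_eq mult_ac)

lemma coeff_a_minus: "coeff_a n (- \<mu>) = coeff_a n \<mu>"
  by (simp add: coeff_a_def mult_ac)

lemma norm_rGamma: "cmod (rGamma z) = 1 / cmod (Gamma z)"
  by (simp add: rGamma_inverse_Gamma norm_inverse norm_divide inverse_eq_divide)

text \<open>This is where \<open>hat_a\<close> comes from: for the exponent b = 1/2 - A the factor
  sin (pi b) is cos (pi A), and the total mass times the Gamma factor of the moment contains the
  product in \<open>hat_a_eq\<close>. What is left is \<open>Gamma (Re A + 1/2)\<close> against
  \<open>rGamma (A + 1/2)\<close>, that is \<open>rho 0 A\<close>.\<close>

lemma stieltjes_const_hat_a:
  assumes "-1/2 < Re A" "Re A < real n + 1/2"
  shows "cmod (rGamma (A + 1/2)) * (stieltjes_const (1/2 - A) n * Gamma (Re A + 1/2 + real n)) = 2 ^ n * rho 0 A * hat_a n A"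
proof -
  have "sin (of_real pi * (1/2 - A)) = cos (of_real pi * A)"
    by (simp add: ring_distribs sin_diff sin_of_real[symmetric] cos_of_real[symmetric] del: sin_of_real cos_of_real)
  moreover have "hat_a n A = cmod (cos (of_real pi * A)) / pi * (Gamma (1/2 + Re A + real n) * Gamma (1/2 - Re A + real n) / (2 ^ n * fact n))"
    by (rule hat_a_eq) (use assms in auto)
  ultimately show ?thesis
    unfolding stieltjes_const_def rho_def norm_rGamma by (simp add: add_ac)
qed

text \<open>Here the Taylor coefficient is kept exactly and moduli are taken only in the l-th
  moment, so the excess is \<open>rho l A\<close> rather than \<open>rho 0 A\<close>.\<close>

lemma binom_coeff_rho:
  assumes "-1/2 < Re A"
  shows "cmod (rGamma (A + 1/2)) * (cmod (binom_coeff (1/2 - A) l) * Gamma (Re A + 1/2 + real l)) = 2 ^ l * rho l A * cmod (coeff_a l A)"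
proof -
  have "cmod (binom_coeff (1/2 - A) l) * cmod (pochhammer (1/2 + A) l) = 2 ^ l * cmod (coeff_a l A)"
    unfolding norm_mult[symmetric] binom_coeff_coeff_a by (simp add: norm_mult norm_power)
  moreover have "cmod (rGamma (A + 1/2)) = cmod (pochhammer (1/2 + A) l) * (1 / cmod (Gamma (A + of_nat l + 1/2)))"
    unfolding norm_rGamma[symmetric] norm_mult[symmetric] using pochhammer_rGamma[of "A + 1/2" l] by (simp add: add_ac)
  ultimately show ?thesis unfolding rho_def by (simp add: add_ac mult_ac)
qed

text \<open>Truncated by total degree. \<sigma> stands for A + B + g, so that all sign choices of A
  and B give the same value.\<close>

definition appell_partial :: "nat \<Rightarrow> complex \<Rightarrow> complex \<Rightarrow> complex \<Rightarrow> complex \<Rightarrow> complex \<Rightarrow> complex" where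
  "appell_partial N A B \<sigma> x y = (\<Sum>n<N. \<Sum>l\<le>n. (-2) ^ n * coeff_a l A * coeff_a (n - l) B * x ^ l * y ^ (n - l) * rGamma (\<sigma> + 2 + of_nat n))"

context appell_params
begin

lemma appell_E_partial_diff:
  "appell_E A B g x y - appell_partial N A B (A + B + g) x y = rGamma (A + 1/2) * rGamma (B + 1/2) * rGamma (g + 1) *
     ((\<integral>p. sq_weight A B g p * ((1 - of_real (fst p) * x) powr (-(1/2 - A)) *
           (1 - of_real (sq_second p) * y) powr (-(1/2 - B))) \<partial>unit_square) -
      (\<Sum>n<N. \<Sum>l\<le>n. binom_coeff (1/2 - A) l * binom_coeff (1/2 - B) (n - l) * x ^ l * y ^ (n - l) *
          (\<integral>p. sq_weight A B g p * of_real (fst p) ^ l * of_real (sq_second p) ^ (n - l) \<partial>unit_square)))"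
proof -
  let ?c = "rGamma (A + 1/2) * rGamma (B + 1/2) * rGamma (g + 1)"
  let ?m = "\<lambda>l k. \<integral>p. sq_weight A B g p * of_real (fst p) ^ l * of_real (sq_second p) ^ k \<partial>unit_square"
  have eq: "?c * (binom_coeff (1/2 - A) l * binom_coeff (1/2 - B) (n - l) * x ^ l * y ^ (n - l) * ?m l (n - l)) =
     (-2) ^ n * coeff_a l A * coeff_a (n - l) B * x ^ l * y ^ (n - l) * rGamma (A + B + g + 2 + of_nat n)" if l: "l \<le> n" for l n
  proof -
    have "?c * (binom_coeff (1/2 - A) l * binom_coeff (1/2 - B) (n - l) * x ^ l * y ^ (n - l) * ?m l (n - l)) =
       binom_coeff (1/2 - A) l * binom_coeff (1/2 - B) (n - l) * x ^ l * y ^ (n - l) * (?c * ?m l (n - l))" by (simp only: mult_ac)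
    also have "\<dots> = (binom_coeff (1/2 - A) l * pochhammer (1/2 + A) l) * (binom_coeff (1/2 - B) (n - l) * pochhammer (1/2 + B) (n - l)) *
       x ^ l * y ^ (n - l) * rGamma (A + B + g + 2 + of_nat (l + (n - l)))"
      unfolding normalised_moment by (simp only: mult_ac)
    also have "\<dots> = ((-2) ^ l * (-2) ^ (n - l)) * coeff_a l A * coeff_a (n - l) B * x ^ l * y ^ (n - l) * rGamma (A + B + g + 2 + of_nat (l + (n - l)))"
      unfolding binom_coeff_coeff_a by (simp only: mult_ac)
    also have "(-2 :: complex) ^ l * (-2) ^ (n - l) = (-2) ^ n" using l by (simp flip: power_add)
    also have "l + (n - l) = n" using l by simp
    finally show ?thesis .
  qed
  have "appell_partial N A B (A + B + g) x y = ?c * (\<Sum>n<N. \<Sum>l\<le>n. binom_coeff (1/2 - A) l * binom_coeff (1/2 - B) (n - l) * x ^ l * y ^ (n - l) * ?m l (n - l))"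
    unfolding appell_partial_def sum_distrib_left by (intro sum.cong refl eq[symmetric]) simp
  thus ?thesis unfolding appell_E_def by (simp only: right_diff_distrib)
qed

lemma kappa_fac_H:
  "cmod (Gamma (A + B + g + 2)) * cmod (rGamma (g + 1)) * (Gamma (Re g + 1) / Gamma (Re A + Re B + Re g + 2 + real N)) =
     kappa (A + B + g) A B * fac_H N (A + B + g)"
  unfolding kappa_def fac_H_def norm_rGamma by (simp add: add_ac)

text \<open>The binomial in A is expanded to order N, the one in B to the complementary orders.
  Terms that keep an exact monomial in x pay for the kernel in y alone, hence the single
  \<open>Sy\<close>.\<close>

lemma appell_E_remainder_1:
  assumes x: "x \<in> slit_plane" and y: "y \<in> slit_plane"
    and Sx: "\<And>s. s \<in> {0..1} \<Longrightarrow> 1 / cmod (1 - of_real s * x) \<le> Sx"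
    and Sy: "\<And>s. s \<in> {0..1} \<Longrightarrow> 1 / cmod (1 - of_real s * y) \<le> Sy"
    and AN: "Re A < real N + 1/2" and B2: "Re B < 1/2"
  shows "cmod (Gamma (A + B + g + 2) * (appell_E A B g x y - appell_partial N A B (A + B + g) x y)) \<le>
     kappa (A + B + g) A B * fac_H N (A + B + g) * rho 0 A * rho 0 B * hat_a N A * hat_a 0 B * (2 * cmod x) ^ N * (Sx * Sy) +
     kappa (A + B + g) A B * fac_H N (A + B + g) * rho 0 B *
       (\<Sum>l<N. rho l A * cmod (coeff_a l A) * hat_a (N - l) B * (2 * cmod x) ^ l * (2 * cmod y) ^ (N - l)) * Sy"
proof -
  let ?cA = "cmod (rGamma (A + 1/2))" and ?cB = "cmod (rGamma (B + 1/2))" and ?cg = "cmod (rGamma (g + 1))"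
  let ?G = "cmod (Gamma (A + B + g + 2))" and ?D = "Gamma (Re g + 1) / Gamma (Re A + Re B + Re g + 2 + real N)"
  let ?K = "kappa (A + B + g) A B * fac_H N (A + B + g)"
  have "cmod (Gamma (A + B + g + 2) * (appell_E A B g x y - appell_partial N A B (A + B + g) x y)) \<le>
    ?G * (?cA * ?cB * ?cg) * (stieltjes_const (1/2 - A) N * Sx * (stieltjes_const (1/2 - B) 0 * Sy) * cmod x ^ N *
        (\<integral>p. cmod (sq_weight A B g p) * fst p ^ N \<partial>unit_square)
           + (\<Sum>l<N. cmod (binom_coeff (1/2 - A) l) * (stieltjes_const (1/2 - B) (N - l) * Sy) * cmod x ^ l * cmod y ^ (N - l) *
               (\<integral>p. cmod (sq_weight A B g p) * fst p ^ l * sq_second p ^ (N - l) \<partial>unit_square)))"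
    unfolding appell_E_partial_diff norm_mult mult.assoc[of "cmod (Gamma _)"]
    by (intro mult_left_mono product_remainder_bound[OF sq_weight_integrable measurable_fst_snd_unit_square(1) measurable_sq(2)
          fst_range sq_second_range x y Sx Sy]) (use A B AN B2 in auto)
  also have "(\<integral>p. cmod (sq_weight A B g p) * fst p ^ N \<partial>unit_square) = Gamma (Re A + 1/2 + real N) * Gamma (Re B + 1/2 + real 0) * ?D"
    using sq_weight_norm_moment[of N 0] by simp
  also have "(\<Sum>l<N. cmod (binom_coeff (1/2 - A) l) * (stieltjes_const (1/2 - B) (N - l) * Sy) * cmod x ^ l * cmod y ^ (N - l) *
               (\<integral>p. cmod (sq_weight A B g p) * fst p ^ l * sq_second p ^ (N - l) \<partial>unit_square)) =
      (\<Sum>l<N. cmod (binom_coeff (1/2 - A) l) * (stieltjes_const (1/2 - B) (N - l) * Sy) * cmod x ^ l * cmod y ^ (N - l) *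
               (Gamma (Re A + 1/2 + real l) * Gamma (Re B + 1/2 + real (N - l)) * ?D))"
    by (rule sum.cong[OF refl]) (simp add: sq_weight_norm_moment)
  also have "?G * (?cA * ?cB * ?cg) * (stieltjes_const (1/2 - A) N * Sx * (stieltjes_const (1/2 - B) 0 * Sy) * cmod x ^ N *
        (Gamma (Re A + 1/2 + real N) * Gamma (Re B + 1/2 + real 0) * ?D) +
        (\<Sum>l<N. cmod (binom_coeff (1/2 - A) l) * (stieltjes_const (1/2 - B) (N - l) * Sy) * cmod x ^ l * cmod y ^ (N - l) *
               (Gamma (Re A + 1/2 + real l) * Gamma (Re B + 1/2 + real (N - l)) * ?D))) =
     (?G * ?cg * ?D) * (?cA * (stieltjes_const (1/2 - A) N * Gamma (Re A + 1/2 + real N))) *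
         (?cB * (stieltjes_const (1/2 - B) 0 * Gamma (Re B + 1/2 + real 0))) * cmod x ^ N * (Sx * Sy) +
     (\<Sum>l<N. (?G * ?cg * ?D) * (?cA * (cmod (binom_coeff (1/2 - A) l) * Gamma (Re A + 1/2 + real l))) *
         (?cB * (stieltjes_const (1/2 - B) (N - l) * Gamma (Re B + 1/2 + real (N - l)))) * cmod x ^ l * cmod y ^ (N - l) * Sy)"
    unfolding ring_distribs(1) sum_distrib_left by (simp only: mult_ac)
  also have "\<dots> = ?K * (2 ^ N * rho 0 A * hat_a N A) * (2 ^ 0 * rho 0 B * hat_a 0 B) * cmod x ^ N * (Sx * Sy) +
     (\<Sum>l<N. ?K * (2 ^ l * rho l A * cmod (coeff_a l A)) * (2 ^ (N - l) * rho 0 B * hat_a (N - l) B) * cmod x ^ l * cmod y ^ (N - l) * Sy)"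
    unfolding kappa_fac_H using A B AN B2
    by (intro arg_cong2[where f = "(+)"] sum.cong refl) (simp_all only: stieltjes_const_hat_a binom_coeff_rho)
  also have "\<dots> = ?K * rho 0 A * rho 0 B * hat_a N A * hat_a 0 B * (2 * cmod x) ^ N * (Sx * Sy) +
     ?K * rho 0 B *
       (\<Sum>l<N. rho l A * cmod (coeff_a l A) * hat_a (N - l) B * (2 * cmod x) ^ l * (2 * cmod y) ^ (N - l)) * Sy"
    unfolding sum_distrib_left sum_distrib_right power_mult_distrib by (simp add: mult_ac)
  finally show ?thesis .
qed

text \<open>The same decomposition with the two binomials exchanged. The sum is re-indexed so that l
  still counts the powers of x; its missing term l = 0 is the first summand.\<close>

lemma appell_E_remainder_2:
  assumes x: "x \<in> slit_plane" and y: "y \<in> slit_plane"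
    and Sx: "\<And>s. s \<in> {0..1} \<Longrightarrow> 1 / cmod (1 - of_real s * x) \<le> Sx"
    and Sy: "\<And>s. s \<in> {0..1} \<Longrightarrow> 1 / cmod (1 - of_real s * y) \<le> Sy"
    and BN: "Re B < real N + 1/2" and A2: "Re A < 1/2"
  shows "cmod (Gamma (A + B + g + 2) * (appell_E A B g x y - appell_partial N A B (A + B + g) x y)) \<le>
     kappa (A + B + g) A B * fac_H N (A + B + g) * rho 0 A * rho 0 B * hat_a 0 A * hat_a N B * (2 * cmod y) ^ N * (Sx * Sy) +
     kappa (A + B + g) A B * fac_H N (A + B + g) * rho 0 A *
       (\<Sum>l=1..N. rho (N - l) B * hat_a l A * cmod (coeff_a (N - l) B) * (2 * cmod x) ^ l * (2 * cmod y) ^ (N - l)) * Sx"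
proof -
  let ?cA = "cmod (rGamma (A + 1/2))" and ?cB = "cmod (rGamma (B + 1/2))" and ?cg = "cmod (rGamma (g + 1))"
  let ?G = "cmod (Gamma (A + B + g + 2))" and ?D = "Gamma (Re g + 1) / Gamma (Re A + Re B + Re g + 2 + real N)"
  let ?K = "kappa (A + B + g) A B * fac_H N (A + B + g)"
  let ?w = "sq_weight A B g"
  have rev: "(\<Sum>n<N. \<Sum>l\<le>n. F l (n - l)) = (\<Sum>n<N. \<Sum>l\<le>n. F (n - l) l)" for F :: "nat \<Rightarrow> nat \<Rightarrow> complex"
  proof (rule sum.cong[OF refl])
    fix n
    show "(\<Sum>l\<le>n. F l (n - l)) = (\<Sum>l\<le>n. F (n - l) l)"
      by (rule sum.reindex_bij_witness[of _ "\<lambda>l. n - l" "\<lambda>l. n - l"]) auto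
  qed
  have "cmod (Gamma (A + B + g + 2) * (appell_E A B g x y - appell_partial N A B (A + B + g) x y)) =
    ?G * (?cA * ?cB * ?cg) *
     cmod ((\<integral>p. ?w p * ((1 - of_real (sq_second p) * y) powr (-(1/2 - B)) * (1 - of_real (fst p) * x) powr (-(1/2 - A))) \<partial>unit_square) -
      (\<Sum>n<N. \<Sum>l\<le>n. binom_coeff (1/2 - B) l * binom_coeff (1/2 - A) (n - l) * y ^ l * x ^ (n - l) *
          (\<integral>p. ?w p * of_real (sq_second p) ^ l * of_real (fst p) ^ (n - l) \<partial>unit_square)))"
    unfolding appell_E_partial_diff norm_mult
    unfolding rev[of "\<lambda>l k. binom_coeff (1/2 - B) l * binom_coeff (1/2 - A) k * y ^ l * x ^ k *
          (\<integral>p. ?w p * of_real (sq_second p) ^ l * of_real (fst p) ^ k \<partial>unit_square)"]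
    by (simp only: mult_ac)
  also have "\<dots> \<le> ?G * (?cA * ?cB * ?cg) * (stieltjes_const (1/2 - B) N * Sy * (stieltjes_const (1/2 - A) 0 * Sx) * cmod y ^ N *
        (\<integral>p. cmod (?w p) * sq_second p ^ N \<partial>unit_square)
           + (\<Sum>k<N. cmod (binom_coeff (1/2 - B) k) * (stieltjes_const (1/2 - A) (N - k) * Sx) * cmod y ^ k * cmod x ^ (N - k) *
               (\<integral>p. cmod (?w p) * sq_second p ^ k * fst p ^ (N - k) \<partial>unit_square)))"
    by (intro mult_left_mono product_remainder_bound[OF sq_weight_integrable measurable_sq(2) measurable_fst_snd_unit_square(1)
          sq_second_range fst_range y x Sy Sx]) (use A B BN A2 in auto)
  also have "(\<integral>p. cmod (?w p) * sq_second p ^ N \<partial>unit_square) = Gamma (Re A + 1/2 + real 0) * Gamma (Re B + 1/2 + real N) * ?D"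
    using sq_weight_norm_moment[of 0 N] by simp
  also have "(\<Sum>k<N. cmod (binom_coeff (1/2 - B) k) * (stieltjes_const (1/2 - A) (N - k) * Sx) * cmod y ^ k * cmod x ^ (N - k) *
               (\<integral>p. cmod (?w p) * sq_second p ^ k * fst p ^ (N - k) \<partial>unit_square)) =
      (\<Sum>l=1..N. cmod (binom_coeff (1/2 - B) (N - l)) * (stieltjes_const (1/2 - A) l * Sx) * cmod y ^ (N - l) * cmod x ^ l *
               (Gamma (Re A + 1/2 + real l) * Gamma (Re B + 1/2 + real (N - l)) * ?D))"
  proof (rule sum.reindex_bij_witness[of _ "\<lambda>l. N - l" "\<lambda>k. N - k"])
    fix k assume k: "k \<in> {..<N}"
    have "(\<integral>p. cmod (?w p) * sq_second p ^ k * fst p ^ (N - k) \<partial>unit_square) =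
        (\<integral>p. cmod (?w p) * fst p ^ (N - k) * sq_second p ^ k \<partial>unit_square)" by (simp only: mult_ac)
    also have "\<dots> = Gamma (Re A + 1/2 + real (N - k)) * Gamma (Re B + 1/2 + real k) * ?D"
      using k by (simp add: sq_weight_norm_moment)
    finally show "cmod (binom_coeff (1/2 - B) (N - (N - k))) * (stieltjes_const (1/2 - A) (N - k) * Sx) * cmod y ^ (N - (N - k)) * cmod x ^ (N - k) *
               (Gamma (Re A + 1/2 + real (N - k)) * Gamma (Re B + 1/2 + real (N - (N - k))) * ?D) =
          cmod (binom_coeff (1/2 - B) k) * (stieltjes_const (1/2 - A) (N - k) * Sx) * cmod y ^ k * cmod x ^ (N - k) *
               (\<integral>p. cmod (?w p) * sq_second p ^ k * fst p ^ (N - k) \<partial>unit_square)"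
      using k by simp
  qed auto
  also have "?G * (?cA * ?cB * ?cg) * (stieltjes_const (1/2 - B) N * Sy * (stieltjes_const (1/2 - A) 0 * Sx) * cmod y ^ N *
        (Gamma (Re A + 1/2 + real 0) * Gamma (Re B + 1/2 + real N) * ?D) +
        (\<Sum>l=1..N. cmod (binom_coeff (1/2 - B) (N - l)) * (stieltjes_const (1/2 - A) l * Sx) * cmod y ^ (N - l) * cmod x ^ l *
               (Gamma (Re A + 1/2 + real l) * Gamma (Re B + 1/2 + real (N - l)) * ?D))) =
     (?G * ?cg * ?D) * (?cB * (stieltjes_const (1/2 - B) N * Gamma (Re B + 1/2 + real N))) *
         (?cA * (stieltjes_const (1/2 - A) 0 * Gamma (Re A + 1/2 + real 0))) * cmod y ^ N * (Sx * Sy) +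
     (\<Sum>l=1..N. (?G * ?cg * ?D) * (?cB * (cmod (binom_coeff (1/2 - B) (N - l)) * Gamma (Re B + 1/2 + real (N - l)))) *
         (?cA * (stieltjes_const (1/2 - A) l * Gamma (Re A + 1/2 + real l))) * cmod x ^ l * cmod y ^ (N - l) * Sx)"
    unfolding ring_distribs(1) sum_distrib_left by (simp only: mult_ac)
  also have "\<dots> = ?K * (2 ^ N * rho 0 B * hat_a N B) * (2 ^ 0 * rho 0 A * hat_a 0 A) * cmod y ^ N * (Sx * Sy) +
     (\<Sum>l=1..N. ?K * (2 ^ (N - l) * rho (N - l) B * cmod (coeff_a (N - l) B)) * (2 ^ l * rho 0 A * hat_a l A) * cmod x ^ l * cmod y ^ (N - l) * Sx)"
    unfolding kappa_fac_H using A B BN A2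
    by (intro arg_cong2[where f = "(+)"] sum.cong refl) (simp_all only: stieltjes_const_hat_a binom_coeff_rho)
  also have "\<dots> = ?K * rho 0 A * rho 0 B * hat_a 0 A * hat_a N B * (2 * cmod y) ^ N * (Sx * Sy) +
     ?K * rho 0 A *
       (\<Sum>l=1..N. rho (N - l) B * hat_a l A * cmod (coeff_a (N - l) B) * (2 * cmod x) ^ l * (2 * cmod y) ^ (N - l)) * Sx"
    unfolding sum_distrib_left sum_distrib_right power_mult_distrib by (simp add: mult_ac)
  finally show ?thesis .
qed

text \<open>A weakening of the first bound to a symmetric form. When both real parts are below 1/2,
  every order of remainder is admissible for A, so each exact coefficient may be replaced by a total
  mass, and \<open>Sx \<ge> 1\<close> allows a common factor.\<close>

lemma appell_E_remainder_3:
  assumes x: "x \<in> slit_plane" and y: "y \<in> slit_plane"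
    and Sx: "\<And>s. s \<in> {0..1} \<Longrightarrow> 1 / cmod (1 - of_real s * x) \<le> Sx"
    and Sy: "\<And>s. s \<in> {0..1} \<Longrightarrow> 1 / cmod (1 - of_real s * y) \<le> Sy"
    and A2: "Re A < 1/2" and B2: "Re B < 1/2"
  shows "cmod (Gamma (A + B + g + 2) * (appell_E A B g x y - appell_partial N A B (A + B + g) x y)) \<le>
     kappa (A + B + g) A B * fac_H N (A + B + g) * rho 0 A * rho 0 B *
       (\<Sum>l\<le>N. hat_a l A * hat_a (N - l) B * (2 * cmod x) ^ l * (2 * cmod y) ^ (N - l)) * (Sx * Sy)"
proof -
  let ?K = "kappa (A + B + g) A B * fac_H N (A + B + g)"
  have S1: "Sx \<ge> 1" "Sy \<ge> 1" using Sx[of 0] Sy[of 0] by auto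
  have pos: "Re A + Re B + Re g + 2 > 0" using A B g by simp
  have K0: "?K \<ge> 0" "rho 0 A \<ge> 0" "rho 0 B \<ge> 0"
    unfolding kappa_def fac_H_def rho_def using A B g pos
    by (auto intro!: mult_nonneg_nonneg divide_nonneg_nonneg Gamma_real_nonneg)
  have h0: "hat_a n C \<ge> 0" for n C unfolding hat_a_def by simp
  \<comment> \<open>A Taylor coefficient is the full integral of the representing Stieltjes measure
    and therefore at most its total mass in modulus.\<close>
  have le: "rho l A * cmod (coeff_a l A) \<le> rho 0 A * hat_a l A" for l
  proof -
    have "cmod (binom_coeff (1/2 - A) l) \<le> stieltjes_const (1/2 - A) l"
    proof -
      let ?k = "beta_kernel (of_nat l + (1/2 - A)) (1 - (1/2 - A))"
      have "binom_coeff (1/2 - A) l = rGamma (1/2 - A) * rGamma (1 - (1/2 - A)) * Beta (of_nat l + (1/2 - A)) (1 - (1/2 - A))"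
      proof -
        have p: "pochhammer (1/2 - A) l * rGamma (1/2 - A + of_nat l) = rGamma (1/2 - A)" by (rule pochhammer_rGamma[symmetric])
        have g1: "rGamma (1/2 - A + of_nat l) * Gamma (1/2 - A + of_nat l) = 1" using A2 by (intro rGamma_mult_Gamma) auto
        have g2: "rGamma (1 - (1/2 - A)) * Gamma (1 - (1/2 - A)) = 1" using A by (intro rGamma_mult_Gamma) auto
        have g3: "rGamma (of_nat l + (1/2 - A) + (1 - (1/2 - A))) = 1 / fact l"
          using Gamma_fact[of l, where 'a = complex] by (simp add: rGamma_inverse_Gamma add.commute inverse_eq_divide)
        have "rGamma (1/2 - A) * rGamma (1 - (1/2 - A)) * Beta (of_nat l + (1/2 - A)) (1 - (1/2 - A)) =
           pochhammer (1/2 - A) l * (rGamma (1/2 - A + of_nat l) * Gamma (1/2 - A + of_nat l)) * (rGamma (1 - (1/2 - A)) * Gamma (1 - (1/2 - A))) *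
             rGamma (of_nat l + (1/2 - A) + (1 - (1/2 - A)))"
          unfolding Beta_altdef p[symmetric] add.commute[of "of_nat l"] by (simp only: mult_ac)
        thus ?thesis unfolding g1 g2 g3 binom_coeff_def by simp
      qed
      hence "cmod (binom_coeff (1/2 - A) l) = cmod (sin (of_real pi * (1/2 - A))) / pi * cmod (Beta (of_nat l + (1/2 - A)) (1 - (1/2 - A)))"
        unfolding rGamma_reflection_complex by (simp add: norm_mult norm_divide)
      also have "cmod (Beta (of_nat l + (1/2 - A)) (1 - (1/2 - A))) \<le> Gamma (real l + Re (1/2 - A)) * Gamma (1 - Re (1/2 - A)) / fact l"
      proof -
        have re: "Re (of_nat l + (1/2 - A)) > 0" "Re (1 - (1/2 - A)) > 0" using A A2 by auto
        have "cmod (integral\<^sup>L unit_lborel ?k) \<le> (\<integral>u. u powr (Re (of_nat l + (1/2 - A)) - 1) * (1 - u) powr (Re (1 - (1/2 - A)) - 1) \<partial>unit_lborel)"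
          by (rule norm_integral_le) (use real_beta_integrable[OF re] in \<open>auto simp: has_bochner_integral_iff norm_beta_kernel\<close>)
        also have "\<dots> = Beta (Re (of_nat l + (1/2 - A))) (Re (1 - (1/2 - A)))"
          using real_beta_integrable[OF re] by (simp only: has_bochner_integral_iff)
        also have "\<dots> = Gamma (real l + Re (1/2 - A)) * Gamma (1 - Re (1/2 - A)) / fact l"
          using Gamma_fact[of l, where 'a = real] by (simp add: Beta_def add_ac)
        finally show ?thesis unfolding beta_kernel_integral[OF re] .
      qed
      finally show ?thesis unfolding stieltjes_const_def by (simp add: mult_left_mono divide_right_mono)
    qed
    hence "cmod (rGamma (A + 1/2)) * (cmod (binom_coeff (1/2 - A) l) * Gamma (Re A + 1/2 + real l)) \<le>
       cmod (rGamma (A + 1/2)) * (stieltjes_const (1/2 - A) l * Gamma (Re A + 1/2 + real l))"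
      using A by (intro mult_left_mono mult_right_mono Gamma_real_nonneg) auto
    hence "2 ^ l * (rho l A * cmod (coeff_a l A)) \<le> 2 ^ l * (rho 0 A * hat_a l A)"
      using stieltjes_const_hat_a[of A l] binom_coeff_rho[of A l] A A2 by (simp add: mult_ac)
    thus ?thesis by simp
  qed
  have "cmod (Gamma (A + B + g + 2) * (appell_E A B g x y - appell_partial N A B (A + B + g) x y)) \<le>
     ?K * rho 0 A * rho 0 B * hat_a N A * hat_a 0 B * (2 * cmod x) ^ N * (Sx * Sy) +
     ?K * rho 0 B *
       (\<Sum>l<N. rho l A * cmod (coeff_a l A) * hat_a (N - l) B * (2 * cmod x) ^ l * (2 * cmod y) ^ (N - l)) * Sy"
    by (rule appell_E_remainder_1[OF x y Sx Sy]) (use A2 B2 in auto)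
  also have "\<dots> \<le> ?K * rho 0 A * rho 0 B * hat_a N A * hat_a 0 B * (2 * cmod x) ^ N * (Sx * Sy) +
     ?K * rho 0 B *
       (\<Sum>l<N. rho 0 A * hat_a l A * hat_a (N - l) B * (2 * cmod x) ^ l * (2 * cmod y) ^ (N - l)) * (Sx * Sy)"
  proof (rule add_left_mono, rule mult_mono)
    show "?K * rho 0 B * (\<Sum>l<N. rho l A * cmod (coeff_a l A) * hat_a (N - l) B * (2 * cmod x) ^ l * (2 * cmod y) ^ (N - l)) \<le>
       ?K * rho 0 B * (\<Sum>l<N. rho 0 A * hat_a l A * hat_a (N - l) B * (2 * cmod x) ^ l * (2 * cmod y) ^ (N - l))"
      by (intro mult_left_mono[OF sum_mono] mult_right_mono le h0) (use K0 in auto)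
    show "Sy \<le> Sx * Sy" using S1 mult_right_mono[of 1 Sx Sy] by simp
    show "0 \<le> ?K * rho 0 B * (\<Sum>l<N. rho 0 A * hat_a l A * hat_a (N - l) B * (2 * cmod x) ^ l * (2 * cmod y) ^ (N - l))"
      by (intro mult_nonneg_nonneg sum_nonneg h0 K0) auto
  qed (use S1 in simp)
  also have "\<dots> = ?K * rho 0 A * rho 0 B *
       ((\<Sum>l<N. hat_a l A * hat_a (N - l) B * (2 * cmod x) ^ l * (2 * cmod y) ^ (N - l)) + hat_a N A * hat_a 0 B * (2 * cmod x) ^ N) * (Sx * Sy)"
    by (simp add: ring_distribs sum_distrib_left mult_ac)
  also have "(\<Sum>l<N. hat_a l A * hat_a (N - l) B * (2 * cmod x) ^ l * (2 * cmod y) ^ (N - l)) + hat_a N A * hat_a 0 B * (2 * cmod x) ^ N =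
     (\<Sum>l\<le>N. hat_a l A * hat_a (N - l) B * (2 * cmod x) ^ l * (2 * cmod y) ^ (N - l))"
    unfolding lessThan_Suc_atMost[symmetric] by simp
  finally show ?thesis .
qed

end

section \<open>Connection formula\<close>

lemma reg_2F1_lower_c:
  assumes "z \<in> slit_plane"
  shows "reg_2F1 a b (c - 1) z = (c - 1) * reg_2F1 a b c z + z * deriv (reg_2F1 a b c) z"
  by (rule reg_2F1_eqI[OF is_reg_2F1_lower_c[OF is_reg_2F1_reg_2F1] assms])

text \<open>The recursion of the coefficients relates the functions with lower parameters c, c - 1
  and c - 2. When the upper parameters add up to 1, the coefficient of the middle function is a
  multiple of 1 - 2 x, so at x = 1/2 only two terms remain.\<close>

lemma reg_2F1_at_half_step:
  "reg_2F1 a (1 - a) (c - 2) (1/2) = (a + 1 - c) * (2 - a - c) * reg_2F1 a (1 - a) c (1/2)"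
proof -
  define e where "e n = pochhammer a n * pochhammer (1 - a) n * rGamma (c + of_nat n) / fact n" for n
  define y where "y = (1/2 :: complex)"
  have y: "cmod y < 1" by (simp add: y_def)
  have r1: "rGamma (c - 1 + of_nat n) = (c + of_nat n - 1) * rGamma (c + of_nat n)" for n
    using rGamma_plus1[of "c + of_nat n - 1"] by (simp add: algebra_simps)
  have r2: "rGamma (c - 2 + of_nat n) = (c + of_nat n - 2) * ((c + of_nat n - 1) * rGamma (c + of_nat n))" for n
    using rGamma_plus1[of "c + of_nat n - 2"] rGamma_plus1[of "c + of_nat n - 1"] by (simp add: algebra_simps)
  have s0: "(\<lambda>n. e n * y ^ n) sums reg_2F1 a (1 - a) c y"
    unfolding e_def by (rule reg_2F1_sums[OF y])
  have s2: "(\<lambda>n. (c + of_nat n - 2) * (c + of_nat n - 1) * e n * y ^ n) sums reg_2F1 a (1 - a) (c - 2) y"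
    using reg_2F1_sums[OF y, of a "1 - a" "c - 2"] unfolding r2 e_def by (simp add: mult_ac)
  have s1: "(\<lambda>n. (c + of_nat n - 1) * e n * y ^ n) sums reg_2F1 a (1 - a) (c - 1) y"
    using reg_2F1_sums[OF y, of a "1 - a" "c - 1"] unfolding r1 e_def by (simp add: mult_ac)
  have rec: "of_nat (Suc n) * (c + of_nat n) * e (Suc n) = (a + of_nat n) * (1 - a + of_nat n) * e n" for n
  proof -
    have "rGamma (c + of_nat n) = (c + of_nat n) * rGamma (c + of_nat (Suc n))"
      using rGamma_plus1[of "c + of_nat n"] by (simp add: add_ac)
    thus ?thesis unfolding e_def pochhammer_Suc fact_Suc by (simp add: divide_simps del: of_nat_Suc)
  qed
  define d where "d n = of_nat n * (c + of_nat n - 1) * e n * y ^ n" for n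
  have "(\<lambda>n. (c + of_nat n - 2) * (c + of_nat n - 1) * e n * y ^ n + (2 - c) * ((c + of_nat n - 1) * e n * y ^ n))
     sums (reg_2F1 a (1 - a) (c - 2) y + (2 - c) * reg_2F1 a (1 - a) (c - 1) y)"
    by (intro sums_add sums_mult s1 s2)
  moreover have "(c + of_nat n - 2) * (c + of_nat n - 1) * e n * y ^ n + (2 - c) * ((c + of_nat n - 1) * e n * y ^ n) = d n" for n
    unfolding d_def by (simp add: algebra_simps)
  ultimately have d1: "d sums (reg_2F1 a (1 - a) (c - 2) y + (2 - c) * reg_2F1 a (1 - a) (c - 1) y)"
    by (simp only:)
  have "(\<lambda>n. d (Suc n)) sums (reg_2F1 a (1 - a) (c - 2) y + (2 - c) * reg_2F1 a (1 - a) (c - 1) y)"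
    using d1 sums_Suc_iff[of d] by (simp add: d_def)
  moreover have "(\<lambda>n. y * ((c + of_nat n - 2) * (c + of_nat n - 1) * e n * y ^ n + 2 * (2 - c) * ((c + of_nat n - 1) * e n * y ^ n) +
        (a + 1 - c) * (2 - a - c) * (e n * y ^ n)))
     sums (y * (reg_2F1 a (1 - a) (c - 2) y + 2 * (2 - c) * reg_2F1 a (1 - a) (c - 1) y + (a + 1 - c) * (2 - a - c) * reg_2F1 a (1 - a) c y))"
    by (intro sums_add sums_mult s0 s1 s2)
  moreover have "y * ((c + of_nat n - 2) * (c + of_nat n - 1) * e n * y ^ n + 2 * (2 - c) * ((c + of_nat n - 1) * e n * y ^ n) +
        (a + 1 - c) * (2 - a - c) * (e n * y ^ n)) = d (Suc n)" for n
  proof -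
    have "d (Suc n) = (of_nat (Suc n) * (c + of_nat n) * e (Suc n)) * (y * y ^ n)"
      unfolding d_def by simp
    also have "\<dots> = ((a + of_nat n) * (1 - a + of_nat n) * e n) * (y * y ^ n)" unfolding rec ..
    finally have 1: "d (Suc n) = ((a + of_nat n) * (1 - a + of_nat n) * e n) * (y * y ^ n)" .
    show ?thesis unfolding 1 by (simp add: algebra_simps)
  qed
  ultimately have "y * (reg_2F1 a (1 - a) (c - 2) y + 2 * (2 - c) * reg_2F1 a (1 - a) (c - 1) y + (a + 1 - c) * (2 - a - c) * reg_2F1 a (1 - a) c y) =
     reg_2F1 a (1 - a) (c - 2) y + (2 - c) * reg_2F1 a (1 - a) (c - 1) y"
    using sums_unique2 by (simp only:) blast
  moreover have "P = K * R" if "1/2 * (P + 2 * L * Q + K * R) = P + L * Q" for P Q R K L :: complex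
    using that by (simp add: field_simps)
  ultimately show ?thesis unfolding y_def by (simp only: mult.assoc)
qed

lemma reg_2F1_at_half_steps:
  "reg_2F1 a (1 - a) (c - 2 * of_nat j) (1/2) =
     4 ^ j * pochhammer ((a + 1 - c) / 2) j * pochhammer ((2 - a - c) / 2) j * reg_2F1 a (1 - a) c (1/2)"
proof (induction j)
  case (Suc j)
  have "c - 2 * of_nat (Suc j) = (c - 2 * of_nat j) - 2" by (simp add: algebra_simps)
  hence "reg_2F1 a (1 - a) (c - 2 * of_nat (Suc j)) (1/2) =
     (a + 1 - (c - 2 * of_nat j)) * (2 - a - (c - 2 * of_nat j)) * reg_2F1 a (1 - a) (c - 2 * of_nat j) (1/2)"
    by (simp only: reg_2F1_at_half_step)
  also have "a + 1 - (c - 2 * of_nat j) = 2 * ((a + 1 - c) / 2 + of_nat j)" by simp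
  also have "2 - a - (c - 2 * of_nat j) = 2 * ((2 - a - c) / 2 + of_nat j)" by simp
  finally have "reg_2F1 a (1 - a) (c - 2 * of_nat (Suc j)) (1/2) =
     2 * ((a + 1 - c) / 2 + of_nat j) * (2 * ((2 - a - c) / 2 + of_nat j)) *
     (4 ^ j * pochhammer ((a + 1 - c) / 2) j * pochhammer ((2 - a - c) / 2) j * reg_2F1 a (1 - a) c (1/2))"
    unfolding Suc.IH .
  moreover have "2 * X * (2 * Y) * (4 ^ j * p * q * F) = 4 ^ Suc j * (p * X) * (q * Y) * F" for X Y p q F :: complex
    by simp
  ultimately show ?case unfolding pochhammer_Suc by (simp only:)
qed simp

text \<open>A Ferrers function of degree - a and order 1 - c, times
  \<open>(1 - t\<^sup>2) powr ((c - 1) / 2)\<close>. For a = 1/2 - B and c = g + B + 3/2 it is, up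
  to normalisation, what the integration over the second variable of the simplex leaves along a side
  of the triangle.\<close>

definition inner_k :: "complex \<Rightarrow> complex \<Rightarrow> complex \<Rightarrow> complex" where
  "inner_k a c t = (1 - t) powr (c - 1) * reg_2F1 a (1 - a) c ((1 - t) / 2)"

lemma ball_half_slit:
  assumes "cmod t < 1"
  shows "(1 - t) / 2 \<in> slit_plane" "1 - t \<notin> \<real>\<^sub>\<le>\<^sub>0" "1 - t \<noteq> 0"
proof -
  have "cmod (1 - t) < 2" using assms norm_triangle_ineq4[of 1 t] by simp
  thus "(1 - t) / 2 \<in> slit_plane" by (intro slit_plane_norm_less_1) (simp add: norm_divide)
  have "Re t < 1" using assms abs_Re_le_cmod[of t] by simp
  thus "1 - t \<notin> \<real>\<^sub>\<le>\<^sub>0" "1 - t \<noteq> 0" by (auto simp: complex_nonpos_Reals_iff)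
qed

text \<open>The power of 1 - t turns the lowering operator of \<open>reg_2F1_lower_c\<close> into
  plain differentiation, up to sign.\<close>

lemma inner_k_deriv:
  assumes t: "cmod t < 1"
  shows "(inner_k a c has_field_derivative - inner_k a (c - 1) t) (at t)"
proof -
  let ?F = "reg_2F1 a (1 - a) c"
  note tt = ball_half_slit[OF t]
  have dF: "(?F has_field_derivative deriv ?F ((1 - t) / 2)) (at ((1 - t) / 2))"
    by (rule holomorphic_derivI[OF reg_2F1_holomorphic open_slit_plane tt(1)])
  have dF': "((\<lambda>t. ?F ((1 - t) / 2)) has_field_derivative deriv ?F ((1 - t) / 2) * (-1/2)) (at t)"
    by (rule DERIV_chain2[where f = ?F and g = "\<lambda>t. (1 - t) / 2", OF dF]) (auto intro!: derivative_eq_intros)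
  have dp: "((\<lambda>t. (1 - t) powr (c - 1)) has_field_derivative (c - 1) * (1 - t) powr (c - 1 - 1) * (-1)) (at t)"
    by (rule DERIV_chain2[where f = "\<lambda>z. z powr (c - 1)" and g = "\<lambda>t. 1 - t", OF has_field_derivative_powr[OF tt(2)]])
       (auto intro!: derivative_eq_intros)
  have "(inner_k a c has_field_derivative
      ((c - 1) * (1 - t) powr (c - 1 - 1) * (-1)) * ?F ((1 - t) / 2) + (deriv ?F ((1 - t) / 2) * (-1/2)) * (1 - t) powr (c - 1)) (at t)"
    unfolding inner_k_def[abs_def] by (rule DERIV_mult[OF dp dF'])
  moreover have "((c - 1) * (1 - t) powr (c - 1 - 1) * (-1)) * ?F ((1 - t) / 2) + (deriv ?F ((1 - t) / 2) * (-1/2)) * (1 - t) powr (c - 1) =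
     - inner_k a (c - 1) t"
  proof -
    have p: "(1 - t) powr (c - 1) = (1 - t) powr (c - 1 - 1) * (1 - t)"
      using tt(3) powr_add[of "1 - t" "c - 1 - 1" 1] by simp
    have "e * P * (-1) * F + D * (-1/2) * (P * (1 - t)) = - (P * (e * F + (1 - t) / 2 * D))" for e P F D :: complex
      by (simp add: field_simps)
    thus ?thesis unfolding inner_k_def reg_2F1_lower_c[OF tt(1)] p by (simp only:)
  qed
  ultimately show ?thesis by simp
qed

lemma inner_k_higher_deriv:
  "cmod t < 1 \<Longrightarrow> (deriv ^^ n) (inner_k a c) t = (-1) ^ n * inner_k a (c - of_nat n) t"
proof (induction n arbitrary: t)
  case (Suc n)
  have "(deriv ^^ Suc n) (inner_k a c) t = deriv ((deriv ^^ n) (inner_k a c)) t" by simp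
  also have "\<dots> = deriv (\<lambda>t. (-1) ^ n * inner_k a (c - of_nat n) t) t"
  proof (rule deriv_cong_ev[OF _ refl])
    have "eventually (\<lambda>t. t \<in> ball 0 1) (nhds t)"
      using Suc.prems by (intro eventually_nhds_in_open) auto
    thus "\<forall>\<^sub>F t in nhds t. (deriv ^^ n) (inner_k a c) t = (-1) ^ n * inner_k a (c - of_nat n) t"
      by eventually_elim (use Suc.IH in simp)
  qed
  also have "\<dots> = (-1) ^ n * - inner_k a (c - of_nat n - 1) t"
    by (intro DERIV_imp_deriv DERIV_cmult inner_k_deriv Suc.prems)
  finally show ?case by (simp add: algebra_simps)
qed simp

text \<open>The derivatives at t = 0 are values at 1/2 with c lowered, and an even number of steps
  is what \<open>reg_2F1_at_half_steps\<close> evaluates. The powers of 4 cancel against those in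
  \<open>fact (2 * j)\<close>.\<close>

lemma inner_k_even_coeff:
  "(deriv ^^ (2 * j)) (inner_k a c) 0 / fact (2 * j) =
     pochhammer ((a + 1 - c) / 2) j * pochhammer ((2 - a - c) / 2) j / (pochhammer (1/2) j * fact j) * reg_2F1 a (1 - a) c (1/2)"
proof -
  have "(deriv ^^ (2 * j)) (inner_k a c) 0 = reg_2F1 a (1 - a) (c - 2 * of_nat j) (1/2)"
    by (subst inner_k_higher_deriv) (simp_all add: inner_k_def)
  moreover have "(fact (2 * j) :: complex) = 4 ^ j * (pochhammer (1/2) j * fact j)"
    using fact_double[of j, where 'a = complex] by (simp add: power_mult)
  ultimately show ?thesis unfolding reg_2F1_at_half_steps by simp
qed

lemma inner_k_sums:
  assumes "cmod t < 1"
  shows "(\<lambda>n. (deriv ^^ n) (inner_k a c) 0 / fact n * t ^ n) sums inner_k a c t"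
proof -
  have "inner_k a c holomorphic_on ball 0 1"
    by (subst holomorphic_on_open) (auto intro!: exI inner_k_deriv)
  from holomorphic_power_series[OF this, of t] show ?thesis using assms by simp
qed

section \<open>Moments of the symmetric beta kernel and the integral over the segment from - \<tau>
  to \<tau>\<close>

lemma unit_lborel_flip: "(\<integral>u. f (1 - u) \<partial>unit_lborel) = (\<integral>u. f u \<partial>unit_lborel)"
  for f :: "real \<Rightarrow> complex"
proof -
  have "(\<integral>u. f u \<partial>unit_lborel) = (\<integral>u. indicator {0<..<1} u *\<^sub>R f u \<partial>lborel)"
    by (simp add: unit_lborel_def integral_restrict_space)
  also have "\<dots> = (\<integral>u. indicator {0<..<1} (1 - u) *\<^sub>R f (1 - u) \<partial>lborel)"
    by (subst lborel_integral_real_affine[where c = "-1" and t = 1]) auto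
  also have "\<dots> = (\<integral>u. indicator {0<..<1} u *\<^sub>R f (1 - u) \<partial>lborel)"
    by (rule Bochner_Integration.integral_cong) (auto simp: indicator_def)
  finally show ?thesis by (simp add: unit_lborel_def integral_restrict_space)
qed

lemma beta_kernel_symmetric_integrable:
  assumes "Re A > -1/2"
  shows "integrable unit_lborel (\<lambda>u. beta_kernel (A + 1/2) (A + 1/2) u * of_real (2 * u - 1) ^ n)"
proof (rule Bochner_Integration.integrable_bound[OF beta_kernel_integrable[of "A + 1/2" "A + 1/2"]])
  show "AE u in unit_lborel. norm (beta_kernel (A + 1/2) (A + 1/2) u * of_real (2 * u - 1) ^ n) \<le> norm (beta_kernel (A + 1/2) (A + 1/2) u)"
  proof (rule AE_I2)
    fix u :: real assume "u \<in> space unit_lborel"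
    hence "\<bar>2 * u - 1\<bar> ^ n \<le> 1" by (intro power_le_one) auto
    hence "norm (complex_of_real (2 * u - 1) ^ n) \<le> 1" by (simp only: norm_power norm_of_real)
    thus "norm (beta_kernel (A + 1/2) (A + 1/2) u * of_real (2 * u - 1) ^ n) \<le> norm (beta_kernel (A + 1/2) (A + 1/2) u)"
      unfolding norm_mult by (intro mult_left_le) auto
  qed
qed (use assms in auto)

lemma beta_kernel_odd_moment:
  assumes "odd n"
  shows "(\<integral>u. beta_kernel (A + 1/2) (A + 1/2) u * of_real (2 * u - 1) ^ n \<partial>unit_lborel) = 0"
proof -
  let ?I = "\<integral>u. beta_kernel (A + 1/2) (A + 1/2) u * of_real (2 * u - 1) ^ n \<partial>unit_lborel"
  have "?I = (\<integral>u. beta_kernel (A + 1/2) (A + 1/2) (1 - u) * of_real (2 * (1 - u) - 1) ^ n \<partial>unit_lborel)"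
    by (rule unit_lborel_flip[symmetric])
  also have "\<dots> = (\<integral>u. - (beta_kernel (A + 1/2) (A + 1/2) u * of_real (2 * u - 1) ^ n) \<partial>unit_lborel)"
  proof (rule Bochner_Integration.integral_cong[OF refl])
    fix u :: real
    have 1: "complex_of_real (2 * (1 - u) - 1) = - of_real (2 * u - 1)" by simp
    have 2: "beta_kernel (A + 1/2) (A + 1/2) (1 - u) = beta_kernel (A + 1/2) (A + 1/2) u"
      by (simp add: beta_kernel_def mult_ac)
    show "beta_kernel (A + 1/2) (A + 1/2) (1 - u) * of_real (2 * (1 - u) - 1) ^ n = - (beta_kernel (A + 1/2) (A + 1/2) u * of_real (2 * u - 1) ^ n)"
      unfolding 1 2 power_minus_odd[OF assms] by simp
  qed
  finally show ?thesis by simp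
qed

text \<open>Because (2 u - 1)^2 = 1 - 4 u (1 - u), the next moment is a combination of the j-th
  moments for A and for A + 1; the induction therefore varies A. The duplication formula starts
  it.\<close>

lemma beta_kernel_even_moment:
  assumes "Re A > -1/2"
  shows "(\<integral>u. beta_kernel (A + 1/2) (A + 1/2) u * of_real (2 * u - 1) ^ (2 * j) \<partial>unit_lborel) =
           2 powr (- 2 * A) * of_real (sqrt pi) * Gamma (A + 1/2) * pochhammer (1/2) j * rGamma (A + 1 + of_nat j)"
  using assms
proof (induction j arbitrary: A)
  case 0
  have ni: "A + 1/2 \<notin> \<int>\<^sub>\<le>\<^sub>0" "A + 1/2 + 1/2 \<notin> \<int>\<^sub>\<le>\<^sub>0" using 0 by (auto elim!: nonpos_Ints_cases simp: complex_eq_iff)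
  have "Gamma (A + 1/2) * Gamma (A + 1/2 + 1/2) = exp ((1 - 2 * (A + 1/2)) * of_real (ln 2)) * of_real (sqrt pi) * Gamma (2 * (A + 1/2))"
    by (rule Gamma_legendre_duplication[OF ni])
  also have "exp ((1 - 2 * (A + 1/2)) * of_real (ln 2)) = 2 powr (- 2 * A)"
    unfolding powr_def using Ln_of_real[of 2] by (simp add: algebra_simps)
  finally have dup: "Gamma (A + 1/2) * Gamma (A + 1) = 2 powr (- 2 * A) * of_real (sqrt pi) * Gamma (2 * A + 1)"
    by (simp add: algebra_simps)
  have g: "rGamma (A + 1) * Gamma (A + 1) = 1" using 0 by (intro rGamma_mult_Gamma) auto
  have g2: "rGamma (2 * A + 1) * Gamma (2 * A + 1) = 1" using 0 by (intro rGamma_mult_Gamma) auto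
  have "(\<integral>u. beta_kernel (A + 1/2) (A + 1/2) u * of_real (2 * u - 1) ^ (2 * 0) \<partial>unit_lborel) = Beta (A + 1/2) (A + 1/2)"
    using 0 by (simp add: beta_kernel_integral)
  also have "\<dots> = Gamma (A + 1/2) * (rGamma (A + 1) * (Gamma (A + 1/2) * Gamma (A + 1))) * rGamma (2 * A + 1)"
    unfolding Beta_altdef using g by (simp add: mult_ac) 
  also have "\<dots> = 2 powr (- 2 * A) * of_real (sqrt pi) * Gamma (A + 1/2) * rGamma (A + 1) * (rGamma (2 * A + 1) * Gamma (2 * A + 1))"
    unfolding dup by (simp only: mult_ac)
  finally show ?case unfolding g2 by simp
next
  case (Suc j)
  let ?M = "\<lambda>A j. \<integral>u. beta_kernel (A + 1/2) (A + 1/2) u * of_real (2 * u - 1) ^ (2 * j) \<partial>unit_lborel"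
  have "?M A (Suc j) = (\<integral>u. beta_kernel (A + 1/2) (A + 1/2) u * of_real (2 * u - 1) ^ (2 * j) -
      4 * (beta_kernel (A + 1 + 1/2) (A + 1 + 1/2) u * of_real (2 * u - 1) ^ (2 * j)) \<partial>unit_lborel)"
  proof (rule Bochner_Integration.integral_cong[OF refl])
    fix u :: real assume "u \<in> space unit_lborel"
    hence u: "u \<in> {0<..<1}" by simp
    have k: "beta_kernel (A + 1 + 1/2) (A + 1 + 1/2) u = beta_kernel (A + 1/2) (A + 1/2) u * of_real u * of_real (1 - u)"
      using beta_kernel_mult_power(1)[OF u, of "A + 1/2" "A + 1/2" 1] beta_kernel_mult_power(2)[OF u, of "A + 1/2 + 1" "A + 1/2" 1]
      by (simp add: add_ac)
    have "complex_of_real (2 * u - 1) ^ (2 * Suc j) = of_real (2 * u - 1) ^ (2 * j) * of_real (2 * u - 1) ^ 2"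
      by (simp flip: power_add)
    also have "complex_of_real (2 * u - 1) ^ 2 = 1 - 4 * of_real u * of_real (1 - u)"
      by (simp add: power2_eq_square algebra_simps)
    finally show "beta_kernel (A + 1/2) (A + 1/2) u * of_real (2 * u - 1) ^ (2 * Suc j) =
      beta_kernel (A + 1/2) (A + 1/2) u * of_real (2 * u - 1) ^ (2 * j) -
      4 * (beta_kernel (A + 1 + 1/2) (A + 1 + 1/2) u * of_real (2 * u - 1) ^ (2 * j))"
      unfolding k by (simp only: ring_distribs mult_1_right mult_1_left mult_ac)
  qed
  also have "\<dots> = ?M A j - 4 * ?M (A + 1) j"
    using beta_kernel_symmetric_integrable[of A "2 * j"] beta_kernel_symmetric_integrable[of "A + 1" "2 * j"] Suc.prems
    by (subst Bochner_Integration.integral_diff) auto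
  also have "\<dots> = 2 powr (- 2 * A) * of_real (sqrt pi) * Gamma (A + 1/2) * pochhammer (1/2) j * rGamma (A + 1 + of_nat j) -
     4 * (2 powr (- 2 * (A + 1)) * of_real (sqrt pi) * Gamma (A + 1 + 1/2) * pochhammer (1/2) j * rGamma (A + 1 + 1 + of_nat j))"
    using Suc.prems by (subst (1 2) Suc.IH) auto
  also have "rGamma (A + 1 + of_nat j) = (A + 1 + of_nat j) * rGamma (A + 1 + of_nat (Suc j))"
    using rGamma_plus1[of "A + 1 + of_nat j"] by (simp add: add_ac)
  also have "A + 1 + 1 + of_nat j = A + 1 + of_nat (Suc j)" by simp
  also have "Gamma (A + 1 + 1/2) = (A + 1/2) * Gamma (A + 1/2)"
  proof -
    have "A + 1/2 \<notin> \<int>\<^sub>\<le>\<^sub>0" using Suc.prems by (auto elim!: nonpos_Ints_cases simp: complex_eq_iff)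
    from Gamma_plus1[OF this] show ?thesis by (simp add: add_ac)
  qed
  also have "2 powr (- 2 * (A + 1)) = 2 powr (- 2 * A) / (4 :: complex)"
    by (simp add: ring_distribs powr_diff)
  finally show ?case unfolding pochhammer_Suc by (simp add: algebra_simps)
qed

text \<open>The odd moments vanish by symmetry. In the even ones \<open>pochhammer (1/2) j\<close>
  cancels against the Taylor coefficient, and \<open>rGamma (A + 1 + of_nat j)\<close> completes a
  regularised hypergeometric series in \<tau>^2: this is how the Jacobi function comes in.\<close>

lemma inner_k_segment_integral:
  assumes A: "Re A > -1/2" and \<tau>: "cmod \<tau> < 1"
  shows "(\<integral>u. beta_kernel (A + 1/2) (A + 1/2) u * inner_k a c (of_real (2 * u - 1) * \<tau>) \<partial>unit_lborel) =
     2 powr (- 2 * A) * of_real (sqrt pi) * Gamma (A + 1/2) * reg_2F1 a (1 - a) c (1/2) *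
     reg_2F1 ((a + 1 - c) / 2) ((2 - a - c) / 2) (A + 1) (\<tau> ^ 2)"
proof -
  let ?c = "\<lambda>n. (deriv ^^ n) (inner_k a c) 0 / fact n"
  let ?b = "beta_kernel (A + 1/2) (A + 1/2)"
  let ?m = "\<lambda>n. \<integral>u. ?b u * of_real (2 * u - 1) ^ n \<partial>unit_lborel"
  let ?K = "2 powr (- 2 * A) * of_real (sqrt pi) * Gamma (A + 1/2) * reg_2F1 a (1 - a) c (1/2)"
  have "(\<lambda>n. \<integral>u. ?b u * (?c n * (of_real (2 * u - 1) * \<tau>) ^ n) \<partial>unit_lborel) sums
      (\<integral>u. ?b u * inner_k a c (of_real (2 * u - 1) * \<tau>) \<partial>unit_lborel)"
  proof (rule integral_sums_bounded[where C = "\<lambda>n. cmod (?c n) * cmod \<tau> ^ n"])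
    show "integrable unit_lborel ?b" using A by (intro beta_kernel_integrable) auto
    obtain r where r: "cmod \<tau> < r" "r < 1" using dense[OF \<tau>] by blast
    have r0: "r > 0" by (rule le_less_trans[OF norm_ge_zero r(1)])
    have "summable (\<lambda>n. ?c n * complex_of_real r ^ n)"
      by (rule sums_summable, rule inner_k_sums) (use r r0 in simp)
    hence "summable (\<lambda>n. norm (?c n * \<tau> ^ n))"
      by (rule powser_insidea) (use r r0 in simp)
    thus "summable (\<lambda>n. cmod (?c n) * cmod \<tau> ^ n)" by (simp only: norm_mult norm_power)
    show "(\<lambda>u. ?c n * (of_real (2 * u - 1) * \<tau>) ^ n) \<in> borel_measurable unit_lborel" for n by measurable
    fix u :: real assume "u \<in> space unit_lborel"
    hence u: "\<bar>2 * u - 1\<bar> \<le> 1" by auto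
    have le: "cmod (of_real (2 * u - 1) * \<tau>) \<le> cmod \<tau>"
      unfolding norm_mult norm_of_real using u by (intro mult_left_le_one_le) auto
    show "cmod (?c n * (of_real (2 * u - 1) * \<tau>) ^ n) \<le> cmod (?c n) * cmod \<tau> ^ n" for n
      unfolding norm_mult[of "?c n"] norm_power by (intro mult_left_mono power_mono le) auto
    show "(\<lambda>n. ?c n * (of_real (2 * u - 1) * \<tau>) ^ n) sums inner_k a c (of_real (2 * u - 1) * \<tau>)"
      by (rule inner_k_sums) (use le \<tau> in linarith)
  qed
  moreover have "(\<integral>u. ?b u * (?c n * (of_real (2 * u - 1) * \<tau>) ^ n) \<partial>unit_lborel) = ?c n * \<tau> ^ n * ?m n" for n
  proof -
    have "(\<integral>u. ?b u * (?c n * (of_real (2 * u - 1) * \<tau>) ^ n) \<partial>unit_lborel) = (\<integral>u. (?c n * \<tau> ^ n) * (?b u * of_real (2 * u - 1) ^ n) \<partial>unit_lborel)"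
      by (simp only: power_mult_distrib mult_ac)
    thus ?thesis by (simp only: integral_mult_right_zero)
  qed
  ultimately have s: "(\<lambda>n. ?c n * \<tau> ^ n * ?m n) sums (\<integral>u. ?b u * inner_k a c (of_real (2 * u - 1) * \<tau>) \<partial>unit_lborel)"
    by (simp only:)
  have "(\<lambda>j. ?c (2 * j) * \<tau> ^ (2 * j) * ?m (2 * j)) sums (\<integral>u. ?b u * inner_k a c (of_real (2 * u - 1) * \<tau>) \<partial>unit_lborel)"
  proof (subst sums_mono_reindex[where g = "\<lambda>j. 2 * j" and f = "\<lambda>n. ?c n * \<tau> ^ n * ?m n"])
    show "strict_mono (\<lambda>j::nat. 2 * j)" by (simp add: strict_mono_def)
    fix n :: nat assume "n \<notin> range (\<lambda>j. 2 * j)"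
    hence n: "odd n" by (auto elim!: evenE)
    show "?c n * \<tau> ^ n * ?m n = 0" unfolding beta_kernel_odd_moment[OF n] by simp
  qed (rule s)
  moreover have "?c (2 * j) * \<tau> ^ (2 * j) * ?m (2 * j) =
     ?K * (pochhammer ((a + 1 - c) / 2) j * pochhammer ((2 - a - c) / 2) j * rGamma (A + 1 + of_nat j) / fact j * (\<tau> ^ 2) ^ j)" for j
  proof -
    have "pochhammer (1/2 :: complex) j \<noteq> 0"
      by (subst pochhammer_eq_0_iff) (auto simp: complex_eq_iff)
    thus ?thesis unfolding inner_k_even_coeff beta_kernel_even_moment[OF A] by (simp add: power_mult)
  qed
  ultimately have 1: "(\<lambda>j. ?K * (pochhammer ((a + 1 - c) / 2) j * pochhammer ((2 - a - c) / 2) j * rGamma (A + 1 + of_nat j) / fact j * (\<tau> ^ 2) ^ j))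
     sums (\<integral>u. ?b u * inner_k a c (of_real (2 * u - 1) * \<tau>) \<partial>unit_lborel)" by (simp only:)
  have "cmod (\<tau> ^ 2) < 1" using \<tau> by (simp add: norm_power power_less_one_iff)
  from sums_mult[OF reg_2F1_sums[OF this, of "(a + 1 - c) / 2" "(2 - a - c) / 2" "A + 1"], of ?K]
  show ?thesis by (rule sums_unique2[OF 1])
qed

text \<open>A case of Bailey's summation. With u = 1 - b the factor 1 - u/2 is (1 + b) / 2, so
  Euler's integrand combines to b^g (1 - b^2)^(B - 1/2) up to a constant, and the substitution of
  b^2 makes it a beta integral.\<close>

lemma reg_2F1_at_half:
  assumes B: "Re B > -1/2" and g: "Re g > -1"
  shows "reg_2F1 (1/2 - B) (1/2 + B) (g + B + 3/2) (1/2) =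
     2 powr (- B - 1/2) * rGamma (g + 1) * Gamma ((g + 1) / 2) * rGamma (g / 2 + B + 1)"
proof -
  let ?h = "beta_kernel ((g + 1) / 2) (B + 1/2)"
  have hi: "(beta_kernel ((g + 1) / 2) (B + 1/2) has_integral Beta ((g + 1) / 2) (B + 1/2)) {0<..<1}"
   and ha: "beta_kernel ((g + 1) / 2) (B + 1/2) absolutely_integrable_on {0<..<1}"
  proof -
    have i: "integrable unit_lborel (beta_kernel ((g + 1) / 2) (B + 1/2))"
      using B g by (intro beta_kernel_integrable) auto
    hence s: "set_integrable lborel {0<..<1} (beta_kernel ((g + 1) / 2) (B + 1/2))"
      unfolding set_integrable_def unit_lborel_def by (simp add: integrable_restrict_space)
    have "(LINT x:{0<..<1}|lborel. beta_kernel ((g + 1) / 2) (B + 1/2) x) = Beta ((g + 1) / 2) (B + 1/2)"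
      using beta_kernel_integral[of "(g + 1) / 2" "B + 1/2"] B g
      by (simp add: unit_lborel_def integral_restrict_space set_lebesgue_integral_def)
    thus "(beta_kernel ((g + 1) / 2) (B + 1/2) has_integral Beta ((g + 1) / 2) (B + 1/2)) {0<..<1}"
      using set_borel_integral_eq_integral[OF s] by (metis integrable_integral)
    show "beta_kernel ((g + 1) / 2) (B + 1/2) absolutely_integrable_on {0<..<1}"
      using s unfolding set_integrable_def by (simp add: integrable_completion)
  qed
  let ?f = "\<lambda>b::real. of_real b powr g * of_real (1 - b ^ 2) powr (B - 1/2) :: complex"
  have img: "(\<lambda>b::real. b ^ 2) ` {0<..<1} = {0<..<1}"
  proof (intro equalityI subsetI)
    fix v :: real assume "v \<in> {0<..<1}"
    thus "v \<in> (\<lambda>b. b ^ 2) ` {0<..<1}" by (intro image_eqI[of _ _ "sqrt v"]) auto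
  qed (auto simp: power_less_one_iff)
  have "(\<lambda>b. \<bar>2 * b\<bar> *\<^sub>R ?h (b ^ 2)) absolutely_integrable_on {0<..<1} \<and>
      integral {0<..<1} (\<lambda>b. \<bar>2 * b\<bar> *\<^sub>R ?h (b ^ 2)) = Beta ((g + 1) / 2) (B + 1/2)"
  proof (subst has_absolute_integral_change_of_variables_real[where g = "\<lambda>b. b ^ 2" and h = "\<lambda>b. 2 * b"])
    show "inj_on (\<lambda>b::real. b ^ 2) {0<..<1}"
      by (rule inj_onI) (auto simp: power2_eq_iff)
    show "?h absolutely_integrable_on (\<lambda>b. b ^ 2) ` {0<..<1} \<and> integral ((\<lambda>b. b ^ 2) ` {0<..<1}) ?h = Beta ((g + 1) / 2) (B + 1/2)"
      unfolding img using hi ha by (auto intro: integral_unique)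
  qed (auto intro!: derivative_eq_intros)
  hence sub: "(\<integral>b. \<bar>2 * b\<bar> *\<^sub>R ?h (b ^ 2) \<partial>unit_lborel) = Beta ((g + 1) / 2) (B + 1/2)"
    using set_lebesgue_integral_eq_integral(2)[of "{0<..<1}" "\<lambda>b. \<bar>2 * b\<bar> *\<^sub>R ?h (b ^ 2)"]
    by (simp add: unit_lborel_def integral_restrict_space set_lebesgue_integral_def integral_completion)
  have "(\<integral>b. \<bar>2 * b\<bar> *\<^sub>R ?h (b ^ 2) \<partial>unit_lborel) = (\<integral>b. 2 * ?f b \<partial>unit_lborel)"
  proof (rule Bochner_Integration.integral_cong[OF refl])
    fix b :: real assume "b \<in> space unit_lborel"
    hence b: "0 < b" by simp
    have "complex_of_real (b ^ 2) powr ((g + 1) / 2 - 1) = of_real b powr (g - 1)"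
    proof -
      have "((g + 1) / 2 - 1) * complex_of_real (ln (b ^ 2)) = (g - 1) * of_real (ln b)"
        using b by (simp add: ln_realpow field_simps)
      moreover have "complex_of_real (b ^ 2) powr z = exp (z * of_real (ln (b ^ 2)))" "of_real b powr z = exp (z * of_real (ln b))" for z
        using b by (simp_all add: powr_def Ln_of_real flip: of_real_power)
      ultimately show ?thesis by (simp only:)
    qed
    moreover have "complex_of_real b * of_real b powr (g - 1) = of_real b powr g"
      using b powr_add[of "complex_of_real b" 1 "g - 1"] by simp
    ultimately show "\<bar>2 * b\<bar> *\<^sub>R ?h (b ^ 2) = 2 * ?f b"
      using b by (simp add: beta_kernel_def scaleR_conv_of_real mult.assoc[symmetric] del: of_real_diff of_real_power)
  qed
  hence f: "(\<integral>b. ?f b \<partial>unit_lborel) = Beta ((g + 1) / 2) (B + 1/2) / 2" using sub by simp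
  have "(1/2 :: complex) \<in> slit_plane" by (simp add: slit_plane_iff)
  hence "reg_2F1 (1/2 - B) (1/2 + B) (g + B + 3/2) (1/2) = euler_2F1 (1/2 - B) (1/2 + B) (g + B + 3/2) (1/2)"
    using B g by (intro reg_2F1_eqI is_reg_2F1_euler) auto
  also have "\<dots> = rGamma (B + 1/2) * rGamma (g + 1) *
      (\<integral>u. beta_kernel (B + 1/2) (g + 1) u * (1 - of_real u * (1/2)) powr (-(1/2 - B)) \<partial>unit_lborel)"
    unfolding euler_2F1_def by (simp add: add_ac)
  also have "(\<integral>u. beta_kernel (B + 1/2) (g + 1) u * (1 - of_real u * (1/2)) powr (-(1/2 - B)) \<partial>unit_lborel) =
      (\<integral>b. beta_kernel (B + 1/2) (g + 1) (1 - b) * (1 - of_real (1 - b) * (1/2)) powr (-(1/2 - B)) \<partial>unit_lborel)"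
    by (rule unit_lborel_flip[symmetric])
  also have "\<dots> = (\<integral>b. (1/2) powr (B - 1/2) * ?f b \<partial>unit_lborel)"
  proof (rule Bochner_Integration.integral_cong[OF refl])
    fix b :: real assume "b \<in> space unit_lborel"
    hence b: "0 < b" "b < 1" by auto
    have "(1 - of_real (1 - b) * (1/2)) = complex_of_real (1/2 * (1 + b))" by (simp add: field_simps)
    hence "of_real (1 - b) powr (B - 1/2) * (1 - of_real (1 - b) * (1/2)) powr (B - 1/2) =
       complex_of_real (1 - b) powr (B - 1/2) * (of_real (1/2) powr (B - 1/2) * of_real (1 + b) powr (B - 1/2))"
      using b by (simp only: of_real_mult) (subst powr_times_real, auto)
    also have "\<dots> = of_real (1/2) powr (B - 1/2) * (of_real (1 - b) * of_real (1 + b)) powr (B - 1/2)"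
      using b by (subst powr_times_real) auto
    also have "complex_of_real (1 - b) * of_real (1 + b) = of_real (1 - b ^ 2)"
      by (simp add: power2_eq_square algebra_simps)
    finally have "of_real (1 - b) powr (B - 1/2) * (1 - of_real (1 - b) * (1/2)) powr (B - 1/2) =
       (1/2) powr (B - 1/2) * complex_of_real (1 - b ^ 2) powr (B - 1/2)" by simp
    moreover have "beta_kernel (B + 1/2) (g + 1) (1 - b) = of_real b powr g * of_real (1 - b) powr (B - 1/2)"
      by (simp add: beta_kernel_def mult_ac)
    moreover have "-(1/2 - B) = B - 1/2" by simp
    ultimately show "beta_kernel (B + 1/2) (g + 1) (1 - b) * (1 - of_real (1 - b) * (1/2)) powr (-(1/2 - B)) = (1/2) powr (B - 1/2) * ?f b"
      by (simp only: mult_ac)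
  qed
  also have "\<dots> = (1/2) powr (B - 1/2) * (Beta ((g + 1) / 2) (B + 1/2) / 2)"
    by (simp only: integral_mult_right_zero f)
  also have "rGamma (B + 1/2) * rGamma (g + 1) * ((1/2) powr (B - 1/2) * (Beta ((g + 1) / 2) (B + 1/2) / 2)) =
     ((1/2) powr (B - 1/2) / 2) * rGamma (g + 1) * Gamma ((g + 1) / 2) * rGamma ((g + 1) / 2 + (B + 1/2)) * (rGamma (B + 1/2) * Gamma (B + 1/2))"
    unfolding Beta_altdef by (simp add: mult_ac)
  also have "rGamma (B + 1/2) * Gamma (B + 1/2) = 1" using B by (intro rGamma_mult_Gamma) auto
  also have "(g + 1) / 2 + (B + 1/2) = g / 2 + B + 1" by (simp add: field_simps)
  also have "(1/2) powr (B - 1/2) / 2 = 2 powr (- B - 1/2 :: complex)"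
  proof -
    have "(1/2 :: complex) powr (B - 1/2) = 2 powr (- (B - 1/2))"
    proof -
      have "Ln (1/2 :: complex) = - Ln 2" using Ln_inverse[of 2] by (simp add: inverse_eq_divide)
      thus ?thesis by (simp add: powr_def algebra_simps)
    qed
    moreover have "2 powr (- (B - 1/2)) = (2 powr (- B - 1/2) * 2 :: complex)"
      using powr_add[of "2::complex" "- B - 1/2" 1] by simp
    ultimately show ?thesis by simp
  qed
  finally show ?thesis by simp
qed

section \<open>Complex powers and integrals along segments\<close>

lemma continuous_on_powr_complex:
  fixes f :: "'a::topological_space \<Rightarrow> complex"
  assumes f: "continuous_on S f" and cut: "\<And>x. x \<in> S \<Longrightarrow> f x = 0 \<or> f x \<notin> \<real>\<^sub>\<le>\<^sub>0" and s: "Re s > 0"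
  shows "continuous_on S (\<lambda>x. f x powr s)"
  unfolding continuous_on_def
proof
  fix x assume x: "x \<in> S"
  have lim: "(f \<longlongrightarrow> f x) (at x within S)" using f x by (simp add: continuous_on_def)
  show "((\<lambda>x. f x powr s) \<longlongrightarrow> f x powr s) (at x within S)"
  proof (cases "f x = 0")
    case True
    \<comment> \<open>At a zero of the base no branch has to be followed: the argument is bounded by
      pi, so the modulus of the power is at most \<open>cmod (f y) powr Re s\<close> times a
      constant. This covers the vertices of the triangle.\<close>
    have lim0: "((\<lambda>y. cmod (f y) powr Re s * exp (pi * \<bar>Im s\<bar>)) \<longlongrightarrow> 0) (at x within S)"
    proof (rule tendsto_mult_left_zero)
      have "((\<lambda>y. cmod (f y)) \<longlongrightarrow> 0) (at x within S)"
        using tendsto_norm[OF lim] True by simp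
      thus "((\<lambda>y. cmod (f y) powr Re s) \<longlongrightarrow> 0) (at x within S)"
        using s by (intro tendsto_zero_powrI[where b = "Re s"]) auto
    qed
    have le: "cmod (f y powr s) \<le> cmod (f y) powr Re s * exp (pi * \<bar>Im s\<bar>)" for y
    proof -
      have "- Im s * Arg (f y) \<le> \<bar>Im s\<bar> * \<bar>Arg (f y)\<bar>"
        using abs_ge_self[of "- Im s * Arg (f y)"] by (simp add: abs_mult)
      also have "\<dots> \<le> \<bar>Im s\<bar> * pi" using Arg_bounded[of "f y"] by (intro mult_left_mono) auto
      finally have "exp (- Im s * Arg (f y)) \<le> exp (pi * \<bar>Im s\<bar>)" by (simp add: mult.commute)
      thus ?thesis unfolding norm_powr_complex by (intro mult_left_mono) auto
    qed
    have "((\<lambda>y. f y powr s) \<longlongrightarrow> 0) (at x within S)"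
      by (rule Lim_null_comparison[OF always_eventually[OF allI[OF le]] lim0])
    thus ?thesis using True by simp
  next
    case False
    hence "f x \<notin> \<real>\<^sub>\<le>\<^sub>0" using cut x by blast
    thus ?thesis by (intro tendsto_powr_complex lim tendsto_const)
  qed
qed

lemma Im_Ln_neg: "Im z < 0 \<Longrightarrow> -pi < Im (Ln z) \<and> Im (Ln z) < 0"
proof -
  assume z: "Im z < 0"
  hence nz: "z \<noteq> 0" by auto
  show ?thesis
    using z mpi_less_Im_Ln[OF nz] Im_Ln_le_pi[OF nz] Im_Ln_pos_le[OF nz] by linarith
qed

text \<open>In each case the imaginary parts of the two logarithms differ by less than pi, so the
  logarithm of the quotient is their difference, without a multiple of 2 pi i.\<close>

lemma powr_quotient:
  fixes a b s :: complex
  assumes "(Im a > 0 \<and> Im b > 0) \<or> (Im a < 0 \<and> Im b < 0) \<or> (Re a > 0 \<and> Re b > 0)"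
  shows "a powr s = b powr s * (a / b) powr s"
proof -
  have nz: "a \<noteq> 0" "b \<noteq> 0" using assms by auto
  have "\<bar>Im (Ln a) - Im (Ln b)\<bar> < pi"
    using assms
  proof (elim disjE conjE)
    assume "Im a > 0" "Im b > 0"
    thus ?thesis using Im_Ln_pos_lt[OF nz(1)] Im_Ln_pos_lt[OF nz(2)] by auto
  next
    assume "Im a < 0" "Im b < 0"
    thus ?thesis using Im_Ln_neg[of a] Im_Ln_neg[of b] by auto
  next
    assume "Re a > 0" "Re b > 0"
    thus ?thesis using Re_Ln_pos_lt[OF nz(1)] Re_Ln_pos_lt[OF nz(2)] by auto
  qed
  hence "- pi < Im (Ln a - Ln b)" "Im (Ln a - Ln b) \<le> pi" by (simp_all add: abs_less_iff)
  moreover have "exp (Ln a - Ln b) = a / b" using nz by (simp add: exp_diff)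
  ultimately have "Ln (a / b) = Ln a - Ln b" by (intro Ln_unique)
  moreover have "s * Ln a = s * Ln b + s * (Ln a - Ln b)" by (simp add: right_diff_distrib)
  ultimately have "exp (s * Ln a) = exp (s * Ln b) * exp (s * Ln (a / b))" by (simp only: exp_add)
  thus ?thesis using nz unfolding powr_def by simp
qed

lemma continuous_has_integral_unit_lborel:
  fixes f :: "real \<Rightarrow> complex"
  assumes "continuous_on {0..1} f"
  shows "(f has_integral (\<integral>u. f u \<partial>unit_lborel)) {0..1}"
proof -
  have s: "set_integrable lborel {0<..<1} f"
    by (rule set_integrable_subset[OF borel_integrable_atLeastAtMost'[OF assms]]) auto
  have "(f has_integral (LINT u:{0<..<1}|lborel. f u)) {0<..<1}"
    using set_borel_integral_eq_integral[OF s] by (metis integrable_integral)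
  moreover have "(LINT u:{0<..<1}|lborel. f u) = (\<integral>u. f u \<partial>unit_lborel)"
    by (simp add: unit_lborel_def integral_restrict_space set_lebesgue_integral_def)
  ultimately show ?thesis by (simp add: has_integral_Icc_iff_Ioo)
qed

text \<open>The integrand has to match h in the open interval only, where real factors can be pulled
  out of the powers.\<close>

lemma contour_integral_linepath_unit_lborel:
  assumes "continuous_on (closed_segment a b) f"
    and eq: "\<And>u. u \<in> {0<..<1} \<Longrightarrow> f (linepath a b u) = h u"
  shows "contour_integral (linepath a b) f = (b - a) * (\<integral>u. h u \<partial>unit_lborel)"
proof -
  have c: "continuous_on {0..1} (\<lambda>u. f (linepath a b u) * (b - a))"
  proof (intro continuous_on_mult continuous_on_const)
    have "linepath a b ` {0..1} = closed_segment a b" using path_image_linepath[of a b] by (simp add: path_image_def)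
    thus "continuous_on {0..1} (\<lambda>u. f (linepath a b u))"
      using assms(1) by (intro continuous_on_compose2[OF _ continuous_on_linepath, of "closed_segment a b" f]) auto
  qed
  have "contour_integral (linepath a b) f = (\<integral>u. f (linepath a b u) * (b - a) \<partial>unit_lborel)"
    using continuous_has_integral_unit_lborel[OF c]
    by (intro contour_integral_unique) (simp add: has_contour_integral_linepath)
  also have "\<dots> = (\<integral>u. h u * (b - a) \<partial>unit_lborel)"
    by (rule Bochner_Integration.integral_cong) (use eq in auto)
  finally show ?thesis by (simp add: mult.commute)
qed

context appell_params
begin

text \<open>By Fubini the integral over w is Euler's integral with argument (1 - u) y.\<close>

lemma appell_E_single:
  assumes x: "x \<in> slit_plane" and y: "y \<in> slit_plane"
  shows "appell_E A B g x y = rGamma (A + 1/2) * (\<integral>u. beta_kernel (A + 1/2) (g + B + 3/2) u * (1 - of_real u * x) powr (A - 1/2) *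
     reg_2F1 (1/2 - B) (1/2 + B) (g + B + 3/2) (of_real (1 - u) * y) \<partial>unit_lborel)"
proof -
  let ?f = "\<lambda>p. sq_weight A B g p * ((1 - of_real (fst p) * x) powr (-(1/2 - A)) *
           (1 - of_real (sq_second p) * y) powr (-(1/2 - B)))"
  have "\<exists>L\<ge>0. \<forall>u\<in>{0..1}. \<forall>w\<in>{x}. cmod (Ln (1 - of_real u * w)) \<le> L"
    by (rule slit_plane_Ln_bound) (simp_all add: x)
  then obtain Lx where Lx: "\<forall>u\<in>{0..1}. \<forall>w\<in>{x}. cmod (Ln (1 - of_real u * w)) \<le> Lx"
    by (elim exE conjE)
  have "\<exists>L\<ge>0. \<forall>u\<in>{0..1}. \<forall>w\<in>{y}. cmod (Ln (1 - of_real u * w)) \<le> L"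
    by (rule slit_plane_Ln_bound) (simp_all add: y)
  then obtain Ly where Ly: "\<forall>u\<in>{0..1}. \<forall>w\<in>{y}. cmod (Ln (1 - of_real u * w)) \<le> Ly"
    by (elim exE conjE)
  let ?C = "exp (cmod (1/2 - A) * Lx) * exp (cmod (1/2 - B) * Ly)"
  have int: "integrable unit_square ?f"
  proof (rule Bochner_Integration.integrable_bound)
    show "integrable unit_square (\<lambda>p. cmod (sq_weight A B g p) * ?C)" using sq_weight_integrable by simp
    show "AE p in unit_square. norm (?f p) \<le> norm (cmod (sq_weight A B g p) * ?C)"
    proof (rule AE_I2)
      fix p assume p: "p \<in> space unit_square"
      have 1: "cmod ((1 - of_real (fst p) * x) powr (-(1/2 - A))) \<le> exp (cmod (1/2 - A) * Lx)"
        using Lx fst_range[OF p] by (intro order_trans[OF norm_powr_le_exp]) (simp add: mult_left_mono norm_minus_commute)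
      have 2: "cmod ((1 - of_real (sq_second p) * y) powr (-(1/2 - B))) \<le> exp (cmod (1/2 - B) * Ly)"
        using Ly sq_second_range[OF p] by (intro order_trans[OF norm_powr_le_exp]) (simp add: mult_left_mono norm_minus_commute)
      have "cmod (?f p) \<le> cmod (sq_weight A B g p) * ?C"
        unfolding norm_mult by (intro mult_left_mono mult_mono 1 2) auto
      thus "norm (?f p) \<le> norm (cmod (sq_weight A B g p) * ?C)" by (simp add: abs_mult)
    qed
  qed measurable
  have fub: "integral\<^sup>L unit_square ?f = (\<integral>u. (\<integral>w. ?f (u, w) \<partial>unit_lborel) \<partial>unit_lborel)"
    by (rule unit_sq.integral_fst'[OF int, symmetric])
  have "appell_E A B g x y =
     rGamma (A + 1/2) * (\<integral>u. rGamma (B + 1/2) * rGamma (g + 1) * (\<integral>w. ?f (u, w) \<partial>unit_lborel) \<partial>unit_lborel)"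
    unfolding appell_E_def fub by (simp only: integral_mult_right_zero mult.assoc)
  also have "(\<integral>u. rGamma (B + 1/2) * rGamma (g + 1) * (\<integral>w. ?f (u, w) \<partial>unit_lborel) \<partial>unit_lborel) =
     (\<integral>u. beta_kernel (A + 1/2) (g + B + 3/2) u * (1 - of_real u * x) powr (A - 1/2) *
     reg_2F1 (1/2 - B) (1/2 + B) (g + B + 3/2) (of_real (1 - u) * y) \<partial>unit_lborel)"
  proof (rule Bochner_Integration.integral_cong[OF refl])
    fix u :: real assume u: "u \<in> space unit_lborel"
    let ?K = "beta_kernel (A + 1/2) (g + B + 3/2) u * (1 - of_real u * x) powr (A - 1/2)"
    have "(\<integral>w. ?f (u, w) \<partial>unit_lborel) = (\<integral>w. ?K * (beta_kernel (B + 1/2) (g + 1) w * (1 - of_real w * (of_real (1 - u) * y)) powr (-(1/2 - B))) \<partial>unit_lborel)"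
      unfolding sq_weight_def sq_second_def by (simp add: mult_ac)
    also have "\<dots> = ?K * (\<integral>w. beta_kernel (B + 1/2) (g + 1) w * (1 - of_real w * (of_real (1 - u) * y)) powr (-(1/2 - B)) \<partial>unit_lborel)"
      by (rule integral_mult_right_zero)
    finally have 1: "(\<integral>w. ?f (u, w) \<partial>unit_lborel) = ?K * (\<integral>w. beta_kernel (B + 1/2) (g + 1) w * (1 - of_real w * (of_real (1 - u) * y)) powr (-(1/2 - B)) \<partial>unit_lborel)" .
    have "of_real (1 - u) * y \<in> slit_plane" using u by (intro slit_plane_scaleR y) auto
    hence "reg_2F1 (1/2 - B) (1/2 + B) (g + B + 3/2) (of_real (1 - u) * y) = euler_2F1 (1/2 - B) (1/2 + B) (g + B + 3/2) (of_real (1 - u) * y)"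
      using B g by (intro reg_2F1_eqI is_reg_2F1_euler) auto
    also have "\<dots> = rGamma (B + 1/2) * rGamma (g + 1) * (\<integral>w. beta_kernel (B + 1/2) (g + 1) w * (1 - of_real w * (of_real (1 - u) * y)) powr (-(1/2 - B)) \<partial>unit_lborel)"
    proof -
      have e: "g + B + 3/2 - (B + 1/2) = g + 1" "1/2 + B = B + 1/2" by simp_all
      show ?thesis unfolding euler_2F1_def e ..
    qed
    finally show "rGamma (B + 1/2) * rGamma (g + 1) * (\<integral>w. ?f (u, w) \<partial>unit_lborel) = ?K *
       reg_2F1 (1/2 - B) (1/2 + B) (g + B + 3/2) (of_real (1 - u) * y)" unfolding 1 by (simp only: mult_ac)
  qed
  finally show ?thesis .
qed

text \<open>Cauchy's theorem on the triangle with vertices \<open>- \<tau>\<close>, \<open>\<tau>\<close>, \<open>1\<close>, for \<open>t \<mapsto> (\<tau> + t) powr s * (\<tau> - t) powr s\<close>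
  times \<^const>\<open>inner_k\<close>.\<close>

lemma appell_E_connection_base:
  assumes A2: "Re A > 1/2" and gB: "Re (g + B + 1/2) > 0"
    and \<tau>: "cmod \<tau> < 1" "Re \<tau> > 0" "Im \<tau> \<noteq> 0"
  defines "c \<equiv> g + B + 3/2" and "s \<equiv> A - 1/2"
  shows "(1 + \<tau>) powr c * (1 + \<tau>) powr s * appell_E A B g ((1 + \<tau>) / (2 * \<tau>)) ((1 + \<tau>) / 2) =
     (2 * \<tau>) powr s * (2 * \<tau>) * (2 powr (- 2 * A) * of_real (sqrt pi) * reg_2F1 (1/2 - B) (1/2 + B) c (1/2) *
         reg_2F1 (- g / 2 - B) (- g / 2) (A + 1) (\<tau> ^ 2)) +
     (1 - \<tau>) powr c * (\<tau> - 1) powr s * appell_E A B g ((\<tau> - 1) / (2 * \<tau>)) ((1 - \<tau>) / 2)"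
proof -
  let ?k = "inner_k (1/2 - B) c"
  let ?F = "reg_2F1 (1/2 - B) (1/2 + B) c"
  define \<Phi> where "\<Phi> t = (\<tau> + t) powr s * (\<tau> - t) powr s * ?k t" for t
  have k_eq: "?k t = (1 - t) powr (c - 1) * ?F ((1 - t) / 2)" for t
  proof -
    have "1 - (1/2 - B) = 1/2 + B" by simp
    thus ?thesis unfolding inner_k_def by (simp only:)
  qed
  have \<tau>0: "\<tau> \<noteq> 0" using \<tau> by auto
  have Re\<tau>: "Re \<tau> < 1" using \<tau>(1) abs_Re_le_cmod[of \<tau>] by simp
  let ?T = "convex hull {-\<tau>, \<tau>, 1}"
  \<comment> \<open>Since \<tau> is not real and lies in the right half of the unit disc, the bases
    \<tau> - t, \<tau> + t and 1 - t stay off the branch cut on the closed triangle, except for the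
    vertices where they vanish. The last two inequalities serve to separate interior points from the
    vertices.\<close>
  have T: "(t = \<tau> \<or> Im (\<tau> - t) \<noteq> 0) \<and> (t = - \<tau> \<or> Im (\<tau> + t) \<noteq> 0) \<and> (t = 1 \<or> Re (1 - t) > 0) \<and> (1 - t) / 2 \<in> slit_plane \<and>
      \<bar>Im t\<bar> \<le> \<bar>Im \<tau>\<bar> \<and> Re t \<le> 1"
    if tT: "t \<in> ?T" for t
  proof -
    obtain p q r where pqr: "0 \<le> p" "0 \<le> q" "0 \<le> r" "p + q + r = 1" and t: "t = p *\<^sub>R (-\<tau>) + q *\<^sub>R \<tau> + r *\<^sub>R 1"
      using tT unfolding convex_hull_3 by blast
    have Imt: "Im t = (q - p) * Im \<tau>" and Ret: "Re t = (q - p) * Re \<tau> + r"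
      unfolding t by (simp_all add: algebra_simps)
    have 1: "t = \<tau> \<or> Im (\<tau> - t) \<noteq> 0"
    proof (cases "q - p = 1")
      case True
      hence "q = 1" "p = 0" "r = 0" using pqr by auto
      thus ?thesis by (simp add: t)
    next
      case False
      have "Im (\<tau> - t) = (1 - (q - p)) * Im \<tau>" by (simp add: Imt algebra_simps)
      thus ?thesis using False \<tau>(3) by simp
    qed
    have 2: "t = - \<tau> \<or> Im (\<tau> + t) \<noteq> 0"
    proof (cases "p - q = 1")
      case True
      hence "p = 1" "q = 0" "r = 0" using pqr by auto
      thus ?thesis by (simp add: t)
    next
      case False
      have "Im (\<tau> + t) = (1 - (p - q)) * Im \<tau>" by (simp add: Imt algebra_simps)
      thus ?thesis using False \<tau>(3) by simp
    qed
    have q: "q * Re \<tau> \<le> q" using pqr(2) Re\<tau> by (simp add: mult_left_le)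
    have p: "p * Re \<tau> \<ge> 0" using pqr(1) \<tau>(2) by simp
    have 3: "t = 1 \<or> Re (1 - t) > 0"
    proof (cases "r = 1")
      case True
      hence "p = 0" "q = 0" using pqr by auto
      thus ?thesis using True by (simp add: t)
    next
      case False
      show ?thesis
      proof (cases "q = 0")
        case True
        thus ?thesis using p False pqr by (simp add: Ret algebra_simps)
      next
        case False
        hence "q * Re \<tau> < q" using pqr(2) Re\<tau> by simp
        thus ?thesis using p pqr by (simp add: Ret algebra_simps)
      qed
    qed
    have 4: "\<bar>Im t\<bar> \<le> \<bar>Im \<tau>\<bar>"
      unfolding Imt abs_mult using pqr by (intro mult_left_le_one_le) auto
    have 5: "Re t \<le> 1" using 3 by auto
    have 6: "(1 - t) / 2 \<in> slit_plane"
    proof -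
      have "p * Re \<tau> \<le> p * 1" using pqr(1) Re\<tau> by (intro mult_left_mono) auto
      moreover have "q * Re \<tau> \<ge> 0" using pqr(2) \<tau>(2) by simp
      moreover have "p * Re \<tau> < 1 \<or> p = 1" using \<open>p * Re \<tau> \<le> p * 1\<close> pqr by linarith
      moreover have "Re t = q * Re \<tau> - p * Re \<tau> + r" unfolding Ret by (simp add: algebra_simps)
      ultimately have "Re t > -1" using pqr Re\<tau> by (elim disjE) (linarith, simp)
      thus ?thesis by (auto simp: slit_plane_iff)
    qed
    show ?thesis using 1 2 3 4 5 6 by blast
  qed
  have cutI: "z \<notin> \<real>\<^sub>\<le>\<^sub>0" if "Im z \<noteq> 0" for z using that by (auto simp: complex_nonpos_Reals_iff)
  have cutR: "z \<notin> \<real>\<^sub>\<le>\<^sub>0" if "Re z > 0" for z using that by (auto simp: complex_nonpos_Reals_iff)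
  have cont: "continuous_on ?T \<Phi>"
    unfolding \<Phi>_def k_eq
  proof (intro continuous_on_mult continuous_on_powr_complex)
    show "continuous_on ?T (\<lambda>t. ?F ((1 - t) / 2))"
      by (rule continuous_on_compose2[OF holomorphic_on_imp_continuous_on[OF reg_2F1_holomorphic]])
         (use T in \<open>auto intro!: continuous_intros\<close>)
    show "\<tau> + t = 0 \<or> \<tau> + t \<notin> \<real>\<^sub>\<le>\<^sub>0" if "t \<in> ?T" for t
      using T[OF that] cutI[of "\<tau> + t"] by (metis add.right_inverse)
    show "\<tau> - t = 0 \<or> \<tau> - t \<notin> \<real>\<^sub>\<le>\<^sub>0" if "t \<in> ?T" for t
      using T[OF that] cutI[of "\<tau> - t"] by (metis diff_self)
    show "1 - t = 0 \<or> 1 - t \<notin> \<real>\<^sub>\<le>\<^sub>0" if "t \<in> ?T" for t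
      using T[OF that] cutR[of "1 - t"] by (metis diff_self)
    show "0 < Re s" "0 < Re s" "0 < Re (c - 1)" using A2 gB by (auto simp: s_def c_def)
  qed (auto intro!: continuous_intros)
  have hol: "\<Phi> holomorphic_on interior ?T"
  proof -
    \<comment> \<open>A small move along \<plusminus> i or along 1 does not leave the triangle, so
      the non-strict inequalities of T become strict.\<close>
    have sub: "t \<in> ?T \<and> t \<noteq> \<tau> \<and> t \<noteq> - \<tau> \<and> t \<noteq> 1" if t: "t \<in> interior ?T" for t
    proof -
      obtain e where e: "e > 0" "ball t e \<subseteq> ?T" using t mem_interior by blast
      have inT: "t + of_real d * v \<in> ?T" if "\<bar>d\<bar> < e" "cmod v = 1" for d v
        using e(2) that by (auto simp: subset_iff dist_norm norm_mult)
      define d where "d = e / 2"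
      have d: "d > 0" "\<bar>d\<bar> < e" "\<bar>- d\<bar> < e" using e(1) by (auto simp: d_def)
      have "\<bar>Im t + d\<bar> \<le> \<bar>Im \<tau>\<bar>" "\<bar>Im t - d\<bar> \<le> \<bar>Im \<tau>\<bar>"
        using T[OF inT[OF d(2), of "\<i>"]] T[OF inT[OF d(3), of "\<i>"]] by auto
      moreover have "Re t + d \<le> 1" using T[OF inT[OF d(2), of 1]] by auto
      ultimately have "\<bar>Im t\<bar> < \<bar>Im \<tau>\<bar>" "Re t < 1" using d(1) by linarith+
      thus ?thesis using t interior_subset by auto
    qed
    show ?thesis
      unfolding \<Phi>_def k_eq
    proof (intro holomorphic_on_mult holomorphic_on_powr holomorphic_on_const holomorphic_on_add holomorphic_on_diff holomorphic_on_ident)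
      have "(?F \<circ> (\<lambda>t. (1 - t) / 2)) holomorphic_on interior ?T"
        by (rule holomorphic_on_compose_gen[OF _ reg_2F1_holomorphic])
           (use T sub in \<open>auto intro!: holomorphic_intros\<close>)
      thus "(\<lambda>t. ?F ((1 - t) / 2)) holomorphic_on interior ?T" by (simp only: o_def)
      fix t assume t: "t \<in> interior ?T"
      show "\<tau> + t \<notin> \<real>\<^sub>\<le>\<^sub>0" "\<tau> - t \<notin> \<real>\<^sub>\<le>\<^sub>0"
        using sub[OF t] T[of t] cutI[of "\<tau> + t"] cutI[of "\<tau> - t"] by blast+
      show "1 - t \<notin> \<real>\<^sub>\<le>\<^sub>0" using sub[OF t] T[of t] cutR[of "1 - t"] by blast
    qed
  qed
  have seg: "closed_segment (-\<tau>) \<tau> \<subseteq> ?T" "closed_segment \<tau> 1 \<subseteq> ?T" "closed_segment (-\<tau>) 1 \<subseteq> ?T"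
    unfolding segment_convex_hull by (intro hull_mono; simp)+
  have segc: "continuous_on (closed_segment (-\<tau>) \<tau>) \<Phi>" "continuous_on (closed_segment \<tau> 1) \<Phi>" "continuous_on (closed_segment (-\<tau>) 1) \<Phi>"
    using cont seg continuous_on_subset by blast+
  have "contour_integral (linepath (-\<tau>) \<tau>) \<Phi> + contour_integral (linepath \<tau> 1) \<Phi> + contour_integral (linepath 1 (-\<tau>)) \<Phi> = 0"
    by (rule has_chain_integral_chain_integral3[OF Cauchy_theorem_triangle_interior[OF cont hol]])
  moreover have "contour_integral (linepath 1 (-\<tau>)) \<Phi> = - contour_integral (linepath (-\<tau>) 1) \<Phi>"
    using contour_integral_reverse_linepath[OF segc(3)] by simp
  ultimately have tri: "contour_integral (linepath (-\<tau>) 1) \<Phi> = contour_integral (linepath (-\<tau>) \<tau>) \<Phi> + contour_integral (linepath \<tau> 1) \<Phi>"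
    by (simp add: algebra_simps)
  have scale: "(of_real u * z) powr w = of_real u powr w * z powr w" if "u \<ge> 0" for u :: real and z w :: complex
    by (rule powr_times_real_left) (use that in auto)
  let ?R = "reg_2F1 (- g / 2 - B) (- g / 2) (A + 1) (\<tau> ^ 2)"
  \<comment> \<open>With t = (2 u - 1) \<tau> both bases are multiples of 2 \<tau>, with factors u
    and 1 - u: a symmetric beta kernel.\<close>
  have I1: "contour_integral (linepath (-\<tau>) \<tau>) \<Phi> = (2 * \<tau>) * ((2 * \<tau>) powr s * (2 * \<tau>) powr s *
     (2 powr (- 2 * A) * of_real (sqrt pi) * Gamma (A + 1/2) * ?F (1/2) * ?R))"
  proof -
    have "contour_integral (linepath (-\<tau>) \<tau>) \<Phi> = (\<tau> - (-\<tau>)) * (\<integral>u. (2 * \<tau>) powr s * (2 * \<tau>) powr s *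
        (beta_kernel (A + 1/2) (A + 1/2) u * ?k (of_real (2 * u - 1) * \<tau>)) \<partial>unit_lborel)"
    proof (rule contour_integral_linepath_unit_lborel[OF segc(1)])
      fix u :: real assume u: "u \<in> {0<..<1}"
      have l: "linepath (-\<tau>) \<tau> u = of_real (2 * u - 1) * \<tau>"
        by (simp add: linepath_def scaleR_conv_of_real algebra_simps)
      have p: "\<tau> + of_real (2 * u - 1) * \<tau> = of_real u * (2 * \<tau>)" "\<tau> - of_real (2 * u - 1) * \<tau> = of_real (1 - u) * (2 * \<tau>)"
        by (simp_all add: algebra_simps)
      have e: "A + 1/2 - 1 = s" by (simp add: s_def)
      have sc: "(of_real u * (2 * \<tau>)) powr s = of_real u powr s * (2 * \<tau>) powr s"
        "(of_real (1 - u) * (2 * \<tau>)) powr s = of_real (1 - u) powr s * (2 * \<tau>) powr s" using u by (intro scale; simp)+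
      show "\<Phi> (linepath (-\<tau>) \<tau> u) = (2 * \<tau>) powr s * (2 * \<tau>) powr s *
        (beta_kernel (A + 1/2) (A + 1/2) u * ?k (of_real (2 * u - 1) * \<tau>))"
        unfolding l \<Phi>_def p sc beta_kernel_def e by (simp only: mult_ac)
    qed
    also have "\<dots> = 2 * \<tau> * ((2 * \<tau>) powr s * (2 * \<tau>) powr s * (\<integral>u. beta_kernel (A + 1/2) (A + 1/2) u * ?k (of_real (2 * u - 1) * \<tau>) \<partial>unit_lborel))"
      by (simp only: integral_mult_right_zero) simp
    also have "(\<integral>u. beta_kernel (A + 1/2) (A + 1/2) u * ?k (of_real (2 * u - 1) * \<tau>) \<partial>unit_lborel) =
       2 powr (- 2 * A) * of_real (sqrt pi) * Gamma (A + 1/2) * ?F (1/2) * ?R"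
    proof -
      have e: "1 - (1/2 - B) = 1/2 + B" "(1/2 - B + 1 - c) / 2 = - g / 2 - B" "(2 - (1/2 - B) - c) / 2 = - g / 2"
        by (simp_all add: c_def field_simps)
      show ?thesis using inner_k_segment_integral[OF A \<tau>(1), of "1/2 - B" c] unfolding e .
    qed
    finally show ?thesis .
  qed
  have slit_Im: "z \<in> slit_plane" if "Im z \<noteq> 0" for z using that by (simp add: slit_plane_iff)
  have "Re \<tau> * Re \<tau> + Im \<tau> * Im \<tau> > 0" using \<tau>(3) by (simp add: sum_squares_gt_zero_iff)
  hence "4 * (Re \<tau> * Re \<tau>) + 4 * (Im \<tau> * Im \<tau>) \<noteq> 0" by linarith
  hence ImI: "Im (1 / (2 * \<tau>)) \<noteq> 0" using \<tau>(3) by (simp add: Im_divide power2_eq_square)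
  have kb: "beta_kernel (A + 1/2) (g + B + 3/2) u = of_real u powr s * of_real (1 - u) powr (c - 1)" for u
  proof -
    have e: "A + 1/2 - 1 = s" "g + B + 3/2 - 1 = c - 1" by (simp_all add: s_def c_def)
    show ?thesis unfolding beta_kernel_def e ..
  qed
  have Gr: "rGamma (A + 1/2) * Gamma (A + 1/2) = 1" using A by (intro rGamma_mult_Gamma) auto
  have Es: "Gamma (A + 1/2) * appell_E A B g x y = (\<integral>u. of_real u powr s * of_real (1 - u) powr (c - 1) * (1 - of_real u * x) powr s * ?F (of_real (1 - u) * y) \<partial>unit_lborel)"
    if "x \<in> slit_plane" "y \<in> slit_plane" for x y
  proof -
    have "Gamma (A + 1/2) * appell_E A B g x y = (rGamma (A + 1/2) * Gamma (A + 1/2)) * (\<integral>u. beta_kernel (A + 1/2) (g + B + 3/2) u * (1 - of_real u * x) powr (A - 1/2) *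
     reg_2F1 (1/2 - B) (1/2 + B) (g + B + 3/2) (of_real (1 - u) * y) \<partial>unit_lborel)"
      unfolding appell_E_single[OF that] by (simp only: mult_ac)
    thus ?thesis unfolding Gr kb unfolding s_def[symmetric] c_def[symmetric] by simp
  qed
  have pw: "z powr c = z * z powr (c - 1)" if "z \<noteq> 0" for z :: complex
    using powr_add[of z 1 "c - 1"] that by simp
  \<comment> \<open>On this side \<tau> - t = u (\<tau> - 1). The power of \<tau> - 1 that is pulled
    out here is the origin of the factor C(\<xi>, \<alpha>).\<close>
  have I2: "contour_integral (linepath \<tau> 1) \<Phi> =
     (1 - \<tau>) powr c * (2 * \<tau>) powr s * (\<tau> - 1) powr s * (Gamma (A + 1/2) * appell_E A B g ((\<tau> - 1) / (2 * \<tau>)) ((1 - \<tau>) / 2))"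
  proof -
    let ?x = "(\<tau> - 1) / (2 * \<tau>)" and ?y = "(1 - \<tau>) / 2"
    have "contour_integral (linepath \<tau> 1) \<Phi> = (1 - \<tau>) * (\<integral>u. ((1 - \<tau>) powr (c - 1) * (2 * \<tau>) powr s * (\<tau> - 1) powr s) *
        (of_real u powr s * of_real (1 - u) powr (c - 1) * (1 - of_real u * ?x) powr s * ?F (of_real (1 - u) * ?y)) \<partial>unit_lborel)"
    proof (rule contour_integral_linepath_unit_lborel[OF segc(2)])
      fix u :: real assume u: "u \<in> {0<..<1}"
      define t where "t = linepath \<tau> 1 u"
      have t: "t = of_real (1 - u) * \<tau> + of_real u" by (simp add: t_def linepath_def scaleR_conv_of_real)
      have p: "\<tau> - t = of_real u * (\<tau> - 1)" "1 - t = of_real (1 - u) * (1 - \<tau>)" "(1 - t) / 2 = of_real (1 - u) * ?y"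
        "(\<tau> + t) / (2 * \<tau>) = 1 - of_real u * ?x"
        unfolding t using \<tau>0 by (simp_all add: field_simps)
      have "Re t > 0" unfolding t using u \<tau>(2) by (simp add: add_pos_pos)
      hence "(\<tau> + t) powr s = (2 * \<tau>) powr s * ((\<tau> + t) / (2 * \<tau>)) powr s"
        using \<tau>(2) by (intro powr_quotient) simp
      moreover have "(\<tau> - t) powr s = of_real u powr s * (\<tau> - 1) powr s" "(1 - t) powr (c - 1) = of_real (1 - u) powr (c - 1) * (1 - \<tau>) powr (c - 1)"
        unfolding p using u by (intro scale; simp)+
      ultimately show "\<Phi> (linepath \<tau> 1 u) = ((1 - \<tau>) powr (c - 1) * (2 * \<tau>) powr s * (\<tau> - 1) powr s) *
        (of_real u powr s * of_real (1 - u) powr (c - 1) * (1 - of_real u * ?x) powr s * ?F (of_real (1 - u) * ?y))"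
        unfolding t_def[symmetric] \<Phi>_def k_eq p(3,4) by (simp only: mult_ac)
    qed
    also have "\<dots> = (1 - \<tau>) * (((1 - \<tau>) powr (c - 1) * (2 * \<tau>) powr s * (\<tau> - 1) powr s) * (Gamma (A + 1/2) * appell_E A B g ?x ?y))"
    proof -
      have "?x = 1/2 - 1 / (2 * \<tau>)" using \<tau>0 by (simp add: field_simps)
      hence "?x \<in> slit_plane" using ImI by (intro slit_Im) simp
      moreover have "?y \<in> slit_plane" using ball_half_slit[OF \<tau>(1)] by simp
      ultimately show ?thesis by (simp only: integral_mult_right_zero Es)
    qed
    also have "\<dots> = ((1 - \<tau>) * (1 - \<tau>) powr (c - 1)) * (2 * \<tau>) powr s * (\<tau> - 1) powr s * (Gamma (A + 1/2) * appell_E A B g ?x ?y)"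
      by (simp only: mult_ac)
    also have "(1 - \<tau>) * (1 - \<tau>) powr (c - 1) = (1 - \<tau>) powr c"
      using \<tau>(3) by (intro pw[symmetric]) auto
    finally show ?thesis .
  qed
  have I3: "contour_integral (linepath (-\<tau>) 1) \<Phi> =
     (1 + \<tau>) powr c * (2 * \<tau>) powr s * (1 + \<tau>) powr s * (Gamma (A + 1/2) * appell_E A B g ((1 + \<tau>) / (2 * \<tau>)) ((1 + \<tau>) / 2))"
  proof -
    let ?x = "(1 + \<tau>) / (2 * \<tau>)" and ?y = "(1 + \<tau>) / 2"
    have "contour_integral (linepath (-\<tau>) 1) \<Phi> = (1 - (-\<tau>)) * (\<integral>u. ((1 + \<tau>) powr (c - 1) * (2 * \<tau>) powr s * (1 + \<tau>) powr s) *
        (of_real u powr s * of_real (1 - u) powr (c - 1) * (1 - of_real u * ?x) powr s * ?F (of_real (1 - u) * ?y)) \<partial>unit_lborel)"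
    proof (rule contour_integral_linepath_unit_lborel[OF segc(3)])
      fix u :: real assume u: "u \<in> {0<..<1}"
      define t where "t = linepath (-\<tau>) 1 u"
      have t: "t = of_real u - of_real (1 - u) * \<tau>" by (simp add: t_def linepath_def scaleR_conv_of_real)
      have p: "\<tau> + t = of_real u * (1 + \<tau>)" "1 - t = of_real (1 - u) * (1 + \<tau>)" "(1 - t) / 2 = of_real (1 - u) * ?y"
        "(\<tau> - t) / (2 * \<tau>) = 1 - of_real u * ?x"
        unfolding t using \<tau>0 by (simp_all add: field_simps)
      \<comment> \<open>On this side Re (\<tau> - t) becomes negative near t = 1, but the imaginary
        part keeps the sign of Im \<tau>, so the power of the quotient still splits.\<close>
      have "Im (\<tau> - t) = (2 - u) * Im \<tau>" unfolding t by (simp add: algebra_simps)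
      hence "(\<tau> - t) powr s = (2 * \<tau>) powr s * ((\<tau> - t) / (2 * \<tau>)) powr s"
        using \<tau>(3) u by (intro powr_quotient) (auto simp: zero_less_mult_iff mult_less_0_iff)
      moreover have "(\<tau> + t) powr s = of_real u powr s * (1 + \<tau>) powr s" "(1 - t) powr (c - 1) = of_real (1 - u) powr (c - 1) * (1 + \<tau>) powr (c - 1)"
        unfolding p using u by (intro scale; simp)+
      ultimately show "\<Phi> (linepath (-\<tau>) 1 u) = ((1 + \<tau>) powr (c - 1) * (2 * \<tau>) powr s * (1 + \<tau>) powr s) *
        (of_real u powr s * of_real (1 - u) powr (c - 1) * (1 - of_real u * ?x) powr s * ?F (of_real (1 - u) * ?y))"
        unfolding t_def[symmetric] \<Phi>_def k_eq p(3,4) by (simp only: mult_ac)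
    qed
    also have "\<dots> = (1 + \<tau>) * (((1 + \<tau>) powr (c - 1) * (2 * \<tau>) powr s * (1 + \<tau>) powr s) * (Gamma (A + 1/2) * appell_E A B g ?x ?y))"
    proof -
      have "?x = 1/2 + 1 / (2 * \<tau>)" using \<tau>0 by (simp add: field_simps)
      hence "?x \<in> slit_plane" using ImI by (intro slit_Im) simp
      moreover have "?y \<in> slit_plane" using \<tau>(3) by (intro slit_Im) simp
      ultimately show ?thesis by (simp only: integral_mult_right_zero Es diff_minus_eq_add)
    qed
    also have "\<dots> = ((1 + \<tau>) * (1 + \<tau>) powr (c - 1)) * (2 * \<tau>) powr s * (1 + \<tau>) powr s * (Gamma (A + 1/2) * appell_E A B g ?x ?y)"
      by (simp only: mult_ac)
    also have "(1 + \<tau>) * (1 + \<tau>) powr (c - 1) = (1 + \<tau>) powr c"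
      using \<tau>(2) by (intro pw[symmetric]) (auto simp: complex_eq_iff)
    finally show ?thesis .
  qed
  \<comment> \<open>This factor is common to the integrals over all three sides.\<close>
  have nz: "(2 * \<tau>) powr s * Gamma (A + 1/2) \<noteq> 0" using \<tau>0 Gr by auto
  have "((2 * \<tau>) powr s * Gamma (A + 1/2)) * ((1 + \<tau>) powr c * (1 + \<tau>) powr s * appell_E A B g ((1 + \<tau>) / (2 * \<tau>)) ((1 + \<tau>) / 2)) =
     ((2 * \<tau>) powr s * Gamma (A + 1/2)) * ((2 * \<tau>) powr s * (2 * \<tau>) * (2 powr (- 2 * A) * of_real (sqrt pi) * ?F (1/2) * ?R) +
     (1 - \<tau>) powr c * (\<tau> - 1) powr s * appell_E A B g ((\<tau> - 1) / (2 * \<tau>)) ((1 - \<tau>) / 2))"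
    using tri unfolding I1 I2 I3 distrib_left by (simp only: mult_ac)
  thus ?thesis unfolding mult_left_cancel[OF nz] .
qed

end

section \<open>Analytic dependence of the hypergeometric function on its parameters\<close>

lemma reg_2F1_commute: "reg_2F1 a b c x = reg_2F1 b a c x"
  unfolding reg_2F1_def is_reg_2F1_def by (simp only: mult.commute[of "pochhammer a _"])

lemma hypergeometric_ratio_bound:
  fixes R X :: real
  assumes "0 \<le> R" "0 \<le> X" "X < 1"
  shows "\<exists>q n0. 0 < q \<and> q < 1 \<and> (\<forall>n\<ge>n0. R < real n \<and> (R + real n) * (R + real n) * X \<le> q * ((real n - R) * (real n + 1)))"
proof -
  define q where "q = (1 + X) / 2"
  have q: "0 < q" "q < 1" "X < q" using assms by (auto simp: q_def)
  \<comment> \<open>The claim follows by squaring (R + n) t \<le> n - R, which holds for large n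
    because t < 1; this is the reason to take q strictly between X and 1.\<close>
  define t where "t = sqrt (X / q)"
  have t: "0 \<le> t" "t < 1" using q assms by (auto simp: t_def real_sqrt_lt_1_iff)
  obtain n0 :: nat where n0: "real n0 > max R (R * (1 + t) / (1 - t))" using reals_Archimedean2 by blast
  have "R < real n \<and> (R + real n) * (R + real n) * X \<le> q * ((real n - R) * (real n + 1))" if n: "n \<ge> n0" for n
  proof
    have nn: "real n > R" "real n > R * (1 + t) / (1 - t)" using n n0 by auto
    thus "R < real n" by simp
    have "R * (1 + t) < real n * (1 - t)" using nn(2) t by (simp add: field_simps)
    hence "(R + real n) * t \<le> real n - R" by (simp add: algebra_simps)
    hence "((R + real n) * t) * ((R + real n) * t) \<le> (real n - R) * (real n - R)"
      using t assms nn(1) by (intro mult_mono) auto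
    also have "\<dots> \<le> (real n - R) * (real n + 1)" using nn assms by (intro mult_left_mono) auto
    finally have "q * (((R + real n) * t) * ((R + real n) * t)) \<le> q * ((real n - R) * (real n + 1))"
      using q by (intro mult_left_mono) auto
    moreover have "q * (((R + real n) * t) * ((R + real n) * t)) = (R + real n) * (R + real n) * (q * (t * t))" by simp
    moreover have "q * (t * t) = X" using q assms by (simp add: t_def)
    ultimately show "(R + real n) * (R + real n) * X \<le> q * ((real n - R) * (real n + 1))" by simp
  qed
  thus ?thesis using q by blast
qed

text \<open>A ratio test that is uniform on a disc, where R bounds all three parameters. Beyond n0
  one has n > R, so c + n cannot vanish and the recursion of the terms may be divided by it.\<close>

lemma reg_2F1_holomorphic_parameters:
  assumes Z: "open Z" and hol: "a holomorphic_on Z" "b holomorphic_on Z" "c holomorphic_on Z" and x: "cmod x < 1"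
  shows "(\<lambda>z. reg_2F1 (a z) (b z) (c z) x) holomorphic_on Z"
proof -
  define T where "T n z = pochhammer (a z) n * pochhammer (b z) n * rGamma (c z + of_nat n) / fact n * x ^ n" for n z
  have sums: "(\<lambda>n. T n z) sums reg_2F1 (a z) (b z) (c z) x" for z
    unfolding T_def by (rule reg_2F1_sums[OF x])
  have holT: "T n holomorphic_on Z" for n
    unfolding T_def[abs_def] pochhammer_prod by (intro holomorphic_intros hol) auto
  show ?thesis
  proof (rule holomorphic_uniform_sequence[OF Z])
    show "(\<lambda>z. \<Sum>k<n. T k z) holomorphic_on Z" for n by (intro holomorphic_on_sum holT)
    fix z assume "z \<in> Z"
    then obtain r where r: "r > 0" "cball z r \<subseteq> Z" using Z open_contains_cball by blast
    let ?K = "cball z r"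
    have cont: "continuous_on ?K h" if "h holomorphic_on Z" for h
      using that r(2) holomorphic_on_imp_continuous_on continuous_on_subset by blast
    obtain Ra where Ra: "\<forall>w\<in>?K. cmod (a w) \<le> Ra" using compact_norm_upper_bound[OF compact_cball cont[OF hol(1)]] by blast
    obtain Rb where Rb: "\<forall>w\<in>?K. cmod (b w) \<le> Rb" using compact_norm_upper_bound[OF compact_cball cont[OF hol(2)]] by blast
    obtain Rc where Rc: "\<forall>w\<in>?K. cmod (c w) \<le> Rc" using compact_norm_upper_bound[OF compact_cball cont[OF hol(3)]] by blast
    define R where "R = max 0 (max Ra (max Rb Rc))"
    have R: "cmod (a w) \<le> R" "cmod (b w) \<le> R" "cmod (c w) \<le> R" if "w \<in> ?K" for w
      using Ra Rb Rc that by (auto simp: R_def le_max_iff_disj)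
    have R0: "R \<ge> 0" by (simp add: R_def)
    obtain q n0 where q: "0 < q" "q < 1" and n0: "\<And>n. n \<ge> n0 \<Longrightarrow> R < real n"
        "\<And>n. n \<ge> n0 \<Longrightarrow> (R + real n) * (R + real n) * cmod x \<le> q * ((real n - R) * (real n + 1))"
      using hypergeometric_ratio_bound[OF R0 norm_ge_zero x] by blast
    obtain M where M: "M \<ge> 0" "\<forall>w\<in>?K. cmod (T n0 w) \<le> M" using compact_norm_upper_bound[OF compact_cball cont[OF holT[of n0]]] by blast
    have step: "cmod (T (Suc n) w) \<le> q * cmod (T n w)" if n: "n \<ge> n0" and w: "w \<in> ?K" for n w
    proof -
      have cn: "cmod (c w + of_nat n) \<ge> real n - R"
        using norm_diff_ineq[of "of_nat n :: complex" "c w"] R(3)[OF w] by (simp add: add.commute)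
      have pos: "real n - R > 0" using n0(1)[OF n] by simp
      have "rGamma (c w + of_nat n) = (c w + of_nat n) * rGamma (c w + of_nat (Suc n))"
        using rGamma_plus1[of "c w + of_nat n"] by (simp add: add_ac)
      hence "T (Suc n) w * ((c w + of_nat n) * of_nat (Suc n)) = T n w * ((a w + of_nat n) * (b w + of_nat n) * x)"
        unfolding T_def pochhammer_Suc fact_Suc power_Suc by (simp add: divide_simps del: of_nat_Suc)
      hence "cmod (T (Suc n) w) * (cmod (c w + of_nat n) * (real n + 1)) = cmod (T n w) * (cmod (a w + of_nat n) * cmod (b w + of_nat n) * cmod x)"
        unfolding norm_mult[symmetric] by (metis norm_mult norm_of_nat of_nat_Suc add.commute)
      also have "\<dots> \<le> cmod (T n w) * ((R + real n) * (R + real n) * cmod x)"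
      proof (intro mult_left_mono mult_right_mono mult_mono)
        show "cmod (a w + of_nat n) \<le> R + real n" "cmod (b w + of_nat n) \<le> R + real n"
          using R[OF w] by (auto intro!: norm_triangle_le)
      qed (use R0 in auto)
      also have "\<dots> \<le> cmod (T n w) * (q * ((real n - R) * (real n + 1)))"
        by (intro mult_left_mono n0(2) n) auto
      also have "\<dots> \<le> cmod (T n w) * (q * (cmod (c w + of_nat n) * (real n + 1)))"
        using cn q by (intro mult_left_mono mult_right_mono) auto
      finally have "cmod (T (Suc n) w) * (cmod (c w + of_nat n) * (real n + 1)) \<le> (q * cmod (T n w)) * (cmod (c w + of_nat n) * (real n + 1))"
        by (simp add: mult_ac)
      moreover have "cmod (c w + of_nat n) * (real n + 1) > 0" using cn pos by (intro mult_pos_pos) auto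
      ultimately show ?thesis by (simp only: mult_le_cancel_right_pos)
    qed
    have geo: "cmod (T (n0 + k) w) \<le> M * q ^ k" if "w \<in> ?K" for k w
    proof (induction k)
      case (Suc k)
      have "cmod (T (n0 + Suc k) w) \<le> q * cmod (T (n0 + k) w)" using step[of "n0 + k", OF _ that] by simp
      also have "\<dots> \<le> q * (M * q ^ k)" using q by (intro mult_left_mono Suc.IH) auto
      finally show ?case by (simp add: mult_ac)
    qed (use M that in auto)
    have "uniform_limit ?K (\<lambda>n z. \<Sum>k<n. T k z) (\<lambda>z. \<Sum>k. T k z) sequentially"
    proof (rule Weierstrass_m_test_ev)
      show "\<forall>\<^sub>F n in sequentially. \<forall>w\<in>?K. norm (T n w) \<le> M * q ^ (n - n0)"
        using eventually_ge_at_top[of n0]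
      proof eventually_elim
        case (elim n)
        thus ?case using geo[of _ "n - n0"] by simp
      qed
      have "summable (\<lambda>k. M * q ^ k)" using q by (intro summable_mult summable_geometric) auto
      thus "summable (\<lambda>n. M * q ^ (n - n0))" by (subst summable_iff_shift[of _ n0, symmetric]) simp
    qed
    moreover have "(\<Sum>k. T k z) = reg_2F1 (a z) (b z) (c z) x" for z using sums[of z] by (rule sums_unique[symmetric])
    ultimately show "\<exists>d>0. cball z d \<subseteq> Z \<and> uniform_limit (cball z d) (\<lambda>n z. \<Sum>k<n. T k z) (\<lambda>z. reg_2F1 (a z) (b z) (c z) x) sequentially"
      using r by auto
  qed
qed

section \<open>Sign symmetry and continuation in the parameters\<close>

definition jacobi_E :: "complex \<Rightarrow> complex \<Rightarrow> complex \<Rightarrow> complex \<Rightarrow> complex" where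
  "jacobi_E A B \<sigma> W = appell_E A B (\<sigma> - A - B) (1 / (1 - W)) (1 / (1 + W))"

lemma Im_inverse_ne: "Im W \<noteq> 0 \<Longrightarrow> Im (1 / W) \<noteq> 0"
proof -
  assume W: "Im W \<noteq> 0"
  hence "Re W * Re W + Im W * Im W > 0" by (simp add: sum_squares_gt_zero_iff)
  thus ?thesis using W by (simp add: Im_divide power2_eq_square)
qed

lemma Im_cayley_ne:
  assumes "Im \<tau> \<noteq> 0"
  shows "Im ((1 - \<tau>) / (1 + \<tau>)) \<noteq> 0" "Im ((1 + \<tau>) / (1 - \<tau>)) \<noteq> 0"
proof -
  have *: "Im (2 * w - 1) \<noteq> 0" if "Im w \<noteq> 0" for w using that by simp
  have "1 + \<tau> \<noteq> 0" "1 - \<tau> \<noteq> 0" using assms by (auto simp: add_eq_0_iff)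
  hence e: "(1 - \<tau>) / (1 + \<tau>) = 2 * (1 / (1 + \<tau>)) - 1" "(1 + \<tau>) / (1 - \<tau>) = 2 * (1 / (1 - \<tau>)) - 1"
    by (simp_all add: field_simps)
  show "Im ((1 - \<tau>) / (1 + \<tau>)) \<noteq> 0" "Im ((1 + \<tau>) / (1 - \<tau>)) \<noteq> 0"
    unfolding e using assms by (intro * Im_inverse_ne; simp)+
qed

lemma slit_plane_Im: "Im z \<noteq> 0 \<Longrightarrow> z \<in> slit_plane"
  by (simp add: slit_plane_iff)

lemma jacobi_E_xy_slit:
  assumes "Im W \<noteq> 0"
  shows "1 / (1 - W) \<in> slit_plane" "1 / (1 + W) \<in> slit_plane"
  using Im_inverse_ne[of "1 - W"] Im_inverse_ne[of "1 + W"] assms by (auto intro!: slit_plane_Im)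

lemma jacobi_E_holomorphic:
  assumes "open Z" "W holomorphic_on Z" "\<And>z. z \<in> Z \<Longrightarrow> Im (W z) \<noteq> 0"
    and par: "Re A > -1/2" "Re B > -1/2" "Re (\<sigma> + 1) > Re (A + B)"
  shows "(\<lambda>z. jacobi_E A B \<sigma> (W z)) holomorphic_on Z"
  unfolding jacobi_E_def
proof (rule appell_E_holomorphic[OF assms(1)])
  show "(\<lambda>z. 1 / (1 - W z)) holomorphic_on Z" "(\<lambda>z. 1 / (1 + W z)) holomorphic_on Z"
  proof -
    have "W z \<noteq> 1" "W z \<noteq> -1" if "z \<in> Z" for z using assms(3)[OF that] by auto
    hence "1 - W z \<noteq> 0" "1 + W z \<noteq> 0" if "z \<in> Z" for z using that by (auto simp: add_eq_0_iff)
    thus "(\<lambda>z. 1 / (1 - W z)) holomorphic_on Z" "(\<lambda>z. 1 / (1 + W z)) holomorphic_on Z"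
      by (intro holomorphic_intros assms(2); simp)+
  qed
  show "1 / (1 - W z) \<in> slit_plane" "1 / (1 + W z) \<in> slit_plane" if "z \<in> Z" for z
    using jacobi_E_xy_slit[OF assms(3)[OF that]] .
qed (use par in \<open>auto intro!: holomorphic_on_const\<close>)

text \<open>The third argument \<sigma> - A - B keeps A + B + g fixed, so in the double series A and
  B occur only through the even \<open>coeff_a\<close>. For |W| > 2 both 1 - W and 1 + W have
  modulus above 1 and the series applies; the half-plane containing W connects that region with
  W.\<close>

lemma jacobi_E_symmetric:
  assumes W: "Im W \<noteq> 0"
    and par: "Re A > -1/2" "Re B > -1/2" "Re (\<sigma> + 1) > Re (A + B)"
    and par': "Re A' > -1/2" "Re B' > -1/2" "Re (\<sigma> + 1) > Re (A' + B')"
    and AA: "A' = A \<or> A' = - A" and BB: "B' = B \<or> B' = - B"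
  shows "jacobi_E A' B' \<sigma> W = jacobi_E A B \<sigma> W"
proof -
  define v :: complex where "v = (if Im W > 0 then 1 else -1)"
  define H where "H = {z. Im (v * z) > 0}"
  have H: "open H" "connected H" "W \<in> H" "\<And>z. z \<in> H \<Longrightarrow> Im z \<noteq> 0"
  proof -
    have "H = {z. Im z > 0} \<or> H = {z. Im z < 0}" by (auto simp: H_def v_def)
    thus "open H" "connected H" by (auto simp: open_halfspace_Im_gt open_halfspace_Im_lt intro!: convex_connected convex_halfspace_Im_gt convex_halfspace_Im_lt)
    show "W \<in> H" using W by (auto simp: H_def v_def)
    show "Im z \<noteq> 0" if "z \<in> H" for z using that by (auto simp: H_def v_def split: if_splits)
  qed
  have big: "jacobi_E C D \<sigma> z = (\<Sum>n. \<Sum>l\<le>n. (-2) ^ n * coeff_a l C * coeff_a (n - l) D * (1 / (1 - z)) ^ l * (1 / (1 + z)) ^ (n - l) * rGamma (\<sigma> + 2 + of_nat n))"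
    if z: "cmod z > 2" and p: "Re C > -1/2" "Re D > -1/2" "Re (\<sigma> + 1) > Re (C + D)" for z C D
  proof -
    interpret appell_params C D "\<sigma> - C - D" by unfold_locales (use p in auto)
    have "cmod (1 - z) > 1" "cmod (1 + z) > 1"
      using z norm_triangle_ineq2[of z 1] norm_triangle_ineq2[of z "-1"] by (auto simp: norm_minus_commute add.commute)
    hence "cmod (1 / (1 - z)) < 1" "cmod (1 / (1 + z)) < 1" by (auto simp: norm_divide divide_simps)
    from appell_E_sums[OF this] show ?thesis unfolding jacobi_E_def by (simp add: sums_iff)
  qed
  have co: "coeff_a n A' = coeff_a n A" "coeff_a n B' = coeff_a n B" for n
    using AA BB by (auto simp: coeff_a_minus)
  show ?thesis
  proof (rule analytic_continuation_open[of "H - cball 0 2" H "jacobi_E A' B' \<sigma>" "jacobi_E A B \<sigma>"])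
    show "open (H - cball 0 2)" using H(1) by (intro open_Diff) auto
    have "3 * \<i> * v \<in> H - cball 0 2" by (auto simp: H_def v_def norm_mult)
    thus "H - cball 0 2 \<noteq> {}" by blast
    show "jacobi_E A' B' \<sigma> holomorphic_on H" "jacobi_E A B \<sigma> holomorphic_on H"
      using jacobi_E_holomorphic[of H "\<lambda>z. z", OF H(1) holomorphic_on_ident H(4)] par par' by blast+
    fix z assume "z \<in> H - cball 0 2"
    hence z: "cmod z > 2" by auto
    show "jacobi_E A' B' \<sigma> z = jacobi_E A B \<sigma> z"
      unfolding big[OF z par] big[OF z par'] co ..
  qed (use H in auto)
qed

text \<open>With \<open>\<tau> = tanh \<xi>\<close> and \<open>\<sigma> = 2 * \<nu> + \<alpha> + \<beta>\<close>, this is the normalised Jacobi function without the factor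
  \<open>cosh \<xi> powr (2 * \<nu>)\<close> that Pfaff's transformation produces, both for \<open>B = \<beta>\<close> and for \<open>B = - \<beta>\<close>.\<close>

definition jacobi_lhs :: "complex \<Rightarrow> complex \<Rightarrow> complex \<Rightarrow> complex \<Rightarrow> complex" where
  "jacobi_lhs \<alpha> B \<sigma> \<tau> = of_real pi * 2 powr (- \<sigma>) * rGamma ((\<sigma> - \<alpha> - B) / 2 + 1) * rGamma ((\<sigma> - \<alpha> - B) / 2 + B + 1) *
     reg_2F1 (- ((\<sigma> - \<alpha> - B) / 2) - B) (- ((\<sigma> - \<alpha> - B) / 2)) (\<alpha> + 1) (\<tau> ^ 2)"

text \<open>\<alpha> and A are separate because the prefactors and the left side always carry
  \<alpha>, while the integrals may be those of - \<alpha>.\<close>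

definition jacobi_connection :: "complex \<Rightarrow> complex \<Rightarrow> complex \<Rightarrow> complex \<Rightarrow> complex \<Rightarrow> bool" where
  "jacobi_connection \<alpha> A B \<sigma> \<tau> \<longleftrightarrow>
     \<tau> powr (\<alpha> - 1/2) * \<tau> * jacobi_lhs \<alpha> B \<sigma> \<tau> =
       (1 + \<tau>) powr (\<sigma> + 1) * jacobi_E A B \<sigma> ((1 - \<tau>) / (1 + \<tau>)) -
       (1 - \<tau>) powr (\<sigma> - \<alpha> + 3/2) * (\<tau> - 1) powr (\<alpha> - 1/2) * jacobi_E A B \<sigma> ((1 + \<tau>) / (1 - \<tau>))"

lemma duplication_rGamma:
  assumes "Re g > -1"
  shows "of_real (sqrt pi) * rGamma (g + 1) * Gamma ((g + 1) / 2) = of_real pi * 2 powr (- g) * rGamma (g / 2 + 1)"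
proof -
  have ni: "(g + 1) / 2 \<notin> \<int>\<^sub>\<le>\<^sub>0" "(g + 1) / 2 + 1/2 \<notin> \<int>\<^sub>\<le>\<^sub>0"
    using assms by (auto elim!: nonpos_Ints_cases simp: complex_eq_iff field_simps)
  have "Gamma ((g + 1) / 2) * Gamma ((g + 1) / 2 + 1/2) = exp ((1 - 2 * ((g + 1) / 2)) * of_real (ln 2)) * of_real (sqrt pi) * Gamma (2 * ((g + 1) / 2))"
    by (rule Gamma_legendre_duplication[OF ni])
  also have "exp ((1 - 2 * ((g + 1) / 2)) * of_real (ln 2)) = 2 powr (- g)"
    unfolding powr_def using Ln_of_real[of 2] by (simp add: field_simps)
  also have "(g + 1) / 2 + 1/2 = g / 2 + 1" by (simp add: field_simps)
  also have "2 * ((g + 1) / 2) = g + 1" by simp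
  finally have d: "Gamma ((g + 1) / 2) * Gamma (g / 2 + 1) = 2 powr (- g) * of_real (sqrt pi) * Gamma (g + 1)" .
  have 1: "rGamma (g / 2 + 1) * Gamma (g / 2 + 1) = 1" "rGamma (g + 1) * Gamma (g + 1) = 1"
    using assms by (auto intro!: rGamma_mult_Gamma)
  have "of_real (sqrt pi) * rGamma (g + 1) * Gamma ((g + 1) / 2) =
     of_real (sqrt pi) * rGamma (g + 1) * (Gamma ((g + 1) / 2) * Gamma (g / 2 + 1)) * rGamma (g / 2 + 1)"
    using 1(1) by (simp add: mult_ac)
  also have "\<dots> = (of_real (sqrt pi) * of_real (sqrt pi)) * 2 powr (- g) * rGamma (g / 2 + 1) * (rGamma (g + 1) * Gamma (g + 1))"
    unfolding d by (simp only: mult_ac)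
  also have "complex_of_real (sqrt pi) * of_real (sqrt pi) = of_real pi" by (simp flip: of_real_mult)
  finally show ?thesis unfolding 1 by simp
qed

lemma jacobi_connection_base:
  assumes A: "Re \<alpha> > 1/2" and B: "Re B > -1/2" and g: "Re (\<sigma> - \<alpha> - B) > -1" and g2: "Re (\<sigma> - \<alpha> + 1/2) > 0"
    and \<tau>: "cmod \<tau> < 1" "Re \<tau> > 0" "Im \<tau> \<noteq> 0"
  shows "jacobi_connection \<alpha> \<alpha> B \<sigma> \<tau>"
proof -
  define g where "g = \<sigma> - \<alpha> - B"
  interpret appell_params \<alpha> B g by unfold_locales (use assms in \<open>auto simp: g_def\<close>)
  have c: "g + B + 3/2 = \<sigma> - \<alpha> + 3/2" by (simp add: g_def)
  have t1: "1 + \<tau> \<noteq> 0" "1 - \<tau> \<noteq> 0" "\<tau> \<noteq> 0" using \<tau> by (auto simp: add_eq_0_iff)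
  have W: "1 / (1 - (1 - \<tau>) / (1 + \<tau>)) = (1 + \<tau>) / (2 * \<tau>)" "1 / (1 + (1 - \<tau>) / (1 + \<tau>)) = (1 + \<tau>) / 2"
    "1 / (1 - (1 + \<tau>) / (1 - \<tau>)) = (\<tau> - 1) / (2 * \<tau>)" "1 / (1 + (1 + \<tau>) / (1 - \<tau>)) = (1 - \<tau>) / 2"
  proof -
    have "1 - (1 - \<tau>) / (1 + \<tau>) = 2 * \<tau> / (1 + \<tau>)" "1 + (1 - \<tau>) / (1 + \<tau>) = 2 / (1 + \<tau>)"
      "1 - (1 + \<tau>) / (1 - \<tau>) = - (2 * \<tau>) / (1 - \<tau>)" "1 + (1 + \<tau>) / (1 - \<tau>) = 2 / (1 - \<tau>)"
      using t1 by (simp_all add: field_simps)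
    note e = this
    show "1 / (1 - (1 - \<tau>) / (1 + \<tau>)) = (1 + \<tau>) / (2 * \<tau>)" "1 / (1 + (1 - \<tau>) / (1 + \<tau>)) = (1 + \<tau>) / 2"
      "1 / (1 + (1 + \<tau>) / (1 - \<tau>)) = (1 - \<tau>) / 2"
      unfolding e by simp_all
    show "1 / (1 - (1 + \<tau>) / (1 - \<tau>)) = (\<tau> - 1) / (2 * \<tau>)"
      unfolding e using t1 by (simp add: divide_simps)
  qed
  have base: "(1 + \<tau>) powr (g + B + 3/2) * (1 + \<tau>) powr (\<alpha> - 1/2) * appell_E \<alpha> B g ((1 + \<tau>) / (2 * \<tau>)) ((1 + \<tau>) / 2) =
     (2 * \<tau>) powr (\<alpha> - 1/2) * (2 * \<tau>) * (2 powr (- 2 * \<alpha>) * of_real (sqrt pi) * reg_2F1 (1/2 - B) (1/2 + B) (g + B + 3/2) (1/2) *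
         reg_2F1 (- g / 2 - B) (- g / 2) (\<alpha> + 1) (\<tau> ^ 2)) +
     (1 - \<tau>) powr (g + B + 3/2) * (\<tau> - 1) powr (\<alpha> - 1/2) * appell_E \<alpha> B g ((\<tau> - 1) / (2 * \<tau>)) ((1 - \<tau>) / 2)"
    by (rule appell_E_connection_base) (use assms in \<open>auto simp: g_def\<close>)
  have e1: "(1 + \<tau>) powr (g + B + 3/2) * (1 + \<tau>) powr (\<alpha> - 1/2) = (1 + \<tau>) powr (\<sigma> + 1)"
  proof -
    have "\<sigma> + 1 = g + B + 3/2 + (\<alpha> - 1/2)" by (simp add: g_def)
    thus ?thesis by (simp only: powr_add)
  qed
  have e2: "(2 * \<tau>) powr (\<alpha> - 1/2) * (2 * \<tau>) * (2 powr (- 2 * \<alpha>) * of_real (sqrt pi) * reg_2F1 (1/2 - B) (1/2 + B) (g + B + 3/2) (1/2) *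
         reg_2F1 (- g / 2 - B) (- g / 2) (\<alpha> + 1) (\<tau> ^ 2)) = \<tau> powr (\<alpha> - 1/2) * \<tau> * jacobi_lhs \<alpha> B \<sigma> \<tau>"
  proof -
    have p: "(2 * \<tau>) powr (\<alpha> - 1/2) = 2 powr (\<alpha> - 1/2) * \<tau> powr (\<alpha> - 1/2)" by (rule powr_times_real_left) auto
    \<comment> \<open>The powers of 2 from (2 \<tau>)^(\<alpha> - 1/2) (2 \<tau>), from the segment
      integral, from the value at 1/2 and from the duplication formula.\<close>
    have q: "2 powr (\<alpha> - 1/2) * 2 * 2 powr (- 2 * \<alpha>) * 2 powr (- B - 1/2) * 2 powr (- g) = (2 powr (- \<sigma>) :: complex)"
    proof -
      have "2 powr (\<alpha> - 1/2) * 2 * 2 powr (- 2 * \<alpha>) * 2 powr (- B - 1/2) * 2 powr (- g) =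
         (2 powr (\<alpha> - 1/2) * 2 powr 1 * 2 powr (- 2 * \<alpha>) * 2 powr (- B - 1/2) * 2 powr (- g) :: complex)" by simp
      also have "\<dots> = 2 powr (\<alpha> - 1/2 + 1 + (- 2 * \<alpha>) + (- B - 1/2) + (- g))" by (simp only: powr_add)
      also have "\<alpha> - 1/2 + 1 + (- 2 * \<alpha>) + (- B - 1/2) + (- g) = - \<sigma>" by (simp add: g_def)
      finally show ?thesis .
    qed
    have "(2 * \<tau>) powr (\<alpha> - 1/2) * (2 * \<tau>) * (2 powr (- 2 * \<alpha>) * of_real (sqrt pi) * reg_2F1 (1/2 - B) (1/2 + B) (g + B + 3/2) (1/2) *
         reg_2F1 (- g / 2 - B) (- g / 2) (\<alpha> + 1) (\<tau> ^ 2)) =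
       (of_real (sqrt pi) * rGamma (g + 1) * Gamma ((g + 1) / 2)) * (\<tau> powr (\<alpha> - 1/2) * \<tau>) *
        (2 powr (\<alpha> - 1/2) * 2 * 2 powr (- 2 * \<alpha>) * 2 powr (- B - 1/2)) * rGamma (g / 2 + B + 1) *
         reg_2F1 (- g / 2 - B) (- g / 2) (\<alpha> + 1) (\<tau> ^ 2)"
      unfolding reg_2F1_at_half[OF appell_params.B[OF appell_params_axioms] appell_params.g[OF appell_params_axioms]] p by (simp only: mult_ac)
    also have "\<dots> = (\<tau> powr (\<alpha> - 1/2) * \<tau>) * (of_real pi * (2 powr (\<alpha> - 1/2) * 2 * 2 powr (- 2 * \<alpha>) * 2 powr (- B - 1/2) * 2 powr (- g)) *
        rGamma (g / 2 + 1) * rGamma (g / 2 + B + 1) * reg_2F1 (- g / 2 - B) (- g / 2) (\<alpha> + 1) (\<tau> ^ 2))"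
      unfolding duplication_rGamma[OF appell_params.g[OF appell_params_axioms]] by (simp only: mult_ac)
    finally show ?thesis unfolding q jacobi_lhs_def g_def[symmetric] by (simp only: minus_divide_left)
  qed
  show ?thesis
    using base unfolding e1 e2 unfolding jacobi_connection_def jacobi_E_def g_def[symmetric] W c eq_diff_eq by (rule sym)
qed

text \<open>One complex variable is enough: the parameters move along the line (\<alpha> + z,
  \<sigma> + k z) with B fixed. The number a is the sign of A, and the slope k is left open so that
  the condition on \<sigma> can be kept.\<close>

lemma jacobi_connection_holomorphic:
  fixes k a :: complex
  assumes Z: "open Z"
    and par: "\<And>z. z \<in> Z \<Longrightarrow> Re (a * (\<alpha> + z)) > -1/2" "Re B > -1/2" "\<And>z. z \<in> Z \<Longrightarrow> Re (\<sigma> + k * z + 1) > Re (a * (\<alpha> + z) + B)"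
    and \<tau>: "cmod \<tau> < 1" "Re \<tau> > 0" "Im \<tau> \<noteq> 0"
  shows "(\<lambda>z. \<tau> powr (\<alpha> + z - 1/2) * \<tau> * jacobi_lhs (\<alpha> + z) B (\<sigma> + k * z) \<tau> -
       ((1 + \<tau>) powr (\<sigma> + k * z + 1) * jacobi_E (a * (\<alpha> + z)) B (\<sigma> + k * z) ((1 - \<tau>) / (1 + \<tau>)) -
       (1 - \<tau>) powr (\<sigma> + k * z - (\<alpha> + z) + 3/2) * (\<tau> - 1) powr (\<alpha> + z - 1/2) * jacobi_E (a * (\<alpha> + z)) B (\<sigma> + k * z) ((1 + \<tau>) / (1 - \<tau>)))) holomorphic_on Z"
proof -
  have pw: "(\<lambda>z. w powr f z) holomorphic_on Z" if "f holomorphic_on Z" "w \<noteq> 0" for w f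
    unfolding powr_def using that by (auto intro!: holomorphic_intros)
  have t1: "1 + \<tau> \<noteq> 0" "1 - \<tau> \<noteq> 0" "\<tau> \<noteq> 0" "\<tau> - 1 \<noteq> 0" using \<tau> by (auto simp: add_eq_0_iff)
  note W = Im_cayley_ne[OF \<tau>(3)]
  have E: "(\<lambda>z. jacobi_E (a * (\<alpha> + z)) B (\<sigma> + k * z) w) holomorphic_on Z" if "Im w \<noteq> 0" for w
    unfolding jacobi_E_def
    by (rule appell_E_holomorphic[OF Z])
       (use par jacobi_E_xy_slit[OF that] in \<open>auto intro!: holomorphic_intros simp: algebra_simps\<close>)
  have F: "(\<lambda>z. jacobi_lhs (\<alpha> + z) B (\<sigma> + k * z) \<tau>) holomorphic_on Z"
    unfolding jacobi_lhs_def
  proof (intro holomorphic_on_mult holomorphic_on_const pw holomorphic_rGamma' reg_2F1_holomorphic_parameters[OF Z])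
    show "cmod (\<tau> ^ 2) < 1" using \<tau>(1) by (simp add: norm_power power_less_one_iff)
  qed (auto intro!: holomorphic_intros)
  show ?thesis
    by (intro holomorphic_on_diff holomorphic_on_mult holomorphic_on_const pw F E W t1) (auto intro!: holomorphic_intros)
qed

text \<open>Along (\<alpha> + z, \<sigma> + 2 z) the slack in the conditions on \<alpha> and on
  \<sigma> grows with Re z, so the stricter hypotheses of \<open>jacobi_connection_base\<close> hold
  once Re z > 2. The slack at z = 0 is d, which makes 0 an interior point of Z.\<close>

lemma jacobi_connection_plus:
  assumes A: "Re \<alpha> > -1/2" and B: "Re B > -1/2" and g: "Re (\<sigma> + 1) > Re (\<alpha> + B)"
    and \<tau>: "cmod \<tau> < 1" "Re \<tau> > 0" "Im \<tau> \<noteq> 0"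
  shows "jacobi_connection \<alpha> \<alpha> B \<sigma> \<tau>"
proof -
  define d where "d = min (Re \<alpha> + 1/2) (Re \<sigma> + 1 - Re \<alpha> - Re B)"
  have d: "d > 0" "d \<le> Re \<alpha> + 1/2" "d \<le> Re \<sigma> + 1 - Re \<alpha> - Re B" using assms by (auto simp: d_def)
  define Z where "Z = {z. Re z > - d}"
  have Z: "open Z" "connected Z" unfolding Z_def by (auto intro!: convex_connected convex_halfspace_Re_gt open_halfspace_Re_gt)
  define f where "f = (\<lambda>z. \<tau> powr (\<alpha> + z - 1/2) * \<tau> * jacobi_lhs (\<alpha> + z) B (\<sigma> + 2 * z) \<tau> -
       ((1 + \<tau>) powr (\<sigma> + 2 * z + 1) * jacobi_E (1 * (\<alpha> + z)) B (\<sigma> + 2 * z) ((1 - \<tau>) / (1 + \<tau>)) -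
       (1 - \<tau>) powr (\<sigma> + 2 * z - (\<alpha> + z) + 3/2) * (\<tau> - 1) powr (\<alpha> + z - 1/2) * jacobi_E (1 * (\<alpha> + z)) B (\<sigma> + 2 * z) ((1 + \<tau>) / (1 - \<tau>))))"
  have "f 0 = 0"
  proof (rule analytic_continuation_open[of "{z. Re z > 2}" Z f "\<lambda>_. 0"])
    show "{z. Re z > 2} \<noteq> ({} :: complex set)" by (auto intro!: exI[of _ 3])
    show "{z. Re z > 2} \<subseteq> Z" using d by (auto simp: Z_def)
    show "f holomorphic_on Z" unfolding f_def
      by (rule jacobi_connection_holomorphic[OF Z(1) _ B _ \<tau>]) (use d in \<open>auto simp: Z_def\<close>)
    fix z :: complex assume z: "z \<in> {z. Re z > 2}"
    have "jacobi_connection (\<alpha> + z) (\<alpha> + z) B (\<sigma> + 2 * z) \<tau>"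
      by (rule jacobi_connection_base[OF _ B _ _ \<tau>]) (use assms z in auto)
    thus "f z = 0" unfolding jacobi_connection_def f_def by simp
  qed (use Z d in \<open>auto simp: Z_def open_halfspace_Re_gt\<close>)
  thus ?thesis unfolding jacobi_connection_def f_def by simp
qed

text \<open>As z moves to the right, Re (\<alpha> + z) reaches 1/2 at Re z = m. Shortly before, both
  signs are admissible, and \<open>jacobi_connection_plus\<close> combined with the sign symmetry
  gives the relation; it is continued from there back to z = 0.\<close>

lemma jacobi_connection_minus:
  assumes A: "Re \<alpha> < 1/2" and B: "Re B > -1/2" and g: "Re (\<sigma> + 1) > Re (- \<alpha> + B)"
    and \<tau>: "cmod \<tau> < 1" "Re \<tau> > 0" "Im \<tau> \<noteq> 0"
  shows "jacobi_connection \<alpha> (- \<alpha>) B \<sigma> \<tau>"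
proof -
  define m where "m = 1/2 - Re \<alpha>"
  have m: "m > 0" using A by (simp add: m_def)
  \<comment> \<open>The slope K makes the condition for A = \<alpha> hold on U, where Re z > m / 2,
    however badly it fails at z = 0. For A = - \<alpha> the slack grows at rate K + 1, whence
    d.\<close>
  define K where "K = 2 + (1 + \<bar>1 + Re \<sigma> - Re \<alpha> - Re B\<bar>) * 2 / m"
  have K: "K \<ge> 2" "(K - 2) * (m / 2) = 1 + \<bar>1 + Re \<sigma> - Re \<alpha> - Re B\<bar>" using m by (auto simp: K_def)
  define d where "d = (Re \<sigma> + 1 + Re \<alpha> - Re B) / (K + 1)"
  have d: "d > 0" "(K + 1) * d = Re \<sigma> + 1 + Re \<alpha> - Re B" using g K by (auto simp: d_def)
  define Z where "Z = {z. Re z > - d} \<inter> {z. Re z < m}"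
  \<comment> \<open>Re (\<alpha> + z) lies between - 1/2 and 1/2 exactly when m - 1 < Re z <
    m.\<close>
  define U where "U = {z. Re z > max (m / 2) (m - 1)} \<inter> {z. Re z < m}"
  have Z: "open Z" "connected Z" unfolding Z_def
    by (auto intro!: open_Int convex_connected convex_Int convex_halfspace_Re_gt convex_halfspace_Re_lt open_halfspace_Re_gt open_halfspace_Re_lt)
  have U: "open U" unfolding U_def by (intro open_Int open_halfspace_Re_gt open_halfspace_Re_lt)
  define f where "f = (\<lambda>z. \<tau> powr (\<alpha> + z - 1/2) * \<tau> * jacobi_lhs (\<alpha> + z) B (\<sigma> + of_real K * z) \<tau> -
       ((1 + \<tau>) powr (\<sigma> + of_real K * z + 1) * jacobi_E ((-1) * (\<alpha> + z)) B (\<sigma> + of_real K * z) ((1 - \<tau>) / (1 + \<tau>)) -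
       (1 - \<tau>) powr (\<sigma> + of_real K * z - (\<alpha> + z) + 3/2) * (\<tau> - 1) powr (\<alpha> + z - 1/2) * jacobi_E ((-1) * (\<alpha> + z)) B (\<sigma> + of_real K * z) ((1 + \<tau>) / (1 - \<tau>))))"
  have parZ: "Re ((-1) * (\<alpha> + z)) > -1/2" "Re (\<sigma> + of_real K * z + 1) > Re ((-1) * (\<alpha> + z) + B)" if "z \<in> Z" for z
  proof -
    show "Re ((-1) * (\<alpha> + z)) > -1/2" using that by (auto simp: Z_def m_def)
    have "(K + 1) * Re z > (K + 1) * (- d)" using that K by (intro mult_strict_left_mono) (auto simp: Z_def)
    thus "Re (\<sigma> + of_real K * z + 1) > Re ((-1) * (\<alpha> + z) + B)" using d(2) by (simp add: algebra_simps)
  qed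
  note W = Im_cayley_ne[OF \<tau>(3)]
  have UZ: "U \<subseteq> Z" using d m by (auto simp: Z_def U_def)
  have "f 0 = 0"
  proof (rule analytic_continuation_open[of U Z f "\<lambda>_. 0"])
    have "complex_of_real ((max (m / 2) (m - 1) + m) / 2) \<in> U" using m by (auto simp: U_def max_def)
    thus "U \<noteq> {}" by blast
    show "f holomorphic_on Z" unfolding f_def
      by (rule jacobi_connection_holomorphic[OF Z(1) parZ(1) B parZ(2) \<tau>])
    fix z assume z: "z \<in> U"
    hence zZ: "z \<in> Z" using UZ by blast
    have 1: "Re (\<alpha> + z) > -1/2" using z by (auto simp: U_def m_def)
    have 2: "Re (\<sigma> + of_real K * z + 1) > Re (\<alpha> + z + B)"
    proof -
      have "(K - 2) * (m / 2) \<le> (K - 2) * Re z" using z K by (intro mult_left_mono) (auto simp: U_def)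
      moreover have "(K - 1) * Re z = (K - 2) * Re z + Re z" by (simp add: algebra_simps)
      moreover have "Re z > 0" using z m by (auto simp: U_def)
      ultimately have "(K - 1) * Re z > - (1 + Re \<sigma> - Re \<alpha> - Re B)" unfolding K(2) by linarith
      moreover have "Re (\<sigma> + of_real K * z + 1) - Re (\<alpha> + z + B) = (1 + Re \<sigma> - Re \<alpha> - Re B) + (K - 1) * Re z"
        by (simp add: algebra_simps)
      ultimately show ?thesis by linarith
    qed
    have "jacobi_connection (\<alpha> + z) (\<alpha> + z) B (\<sigma> + of_real K * z) \<tau>"
      by (rule jacobi_connection_plus[OF 1 B 2 \<tau>])
    moreover have "jacobi_E ((-1) * (\<alpha> + z)) B (\<sigma> + of_real K * z) w = jacobi_E (\<alpha> + z) B (\<sigma> + of_real K * z) w" if "Im w \<noteq> 0" for w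
      by (rule jacobi_E_symmetric[OF that 1 B 2 parZ(1)[OF zZ] B parZ(2)[OF zZ]]) auto
    ultimately show "f z = 0" unfolding jacobi_connection_def f_def using W by (simp only:) simp
  qed (use Z U UZ d m in \<open>auto simp: Z_def\<close>)
  thus ?thesis unfolding jacobi_connection_def f_def by simp
qed

section \<open>Pfaff's transformation and the passage to the variable \<xi>\<close>

lemma reg_2F1_pfaff:
  assumes z: "cmod z < 1/2"
  shows "reg_2F1 a b c z = (1 - z) powr (-a) * reg_2F1 a (c - b) c (z / (z - 1))"
proof -
  have z1: "cmod z < 1" "Re (1 - z) > 0" "z \<noteq> 1" using z abs_Re_le_cmod[of z] by auto
  have w: "cmod (z / (z - 1)) < 1"
  proof -
    have "1 / 2 < cmod (z - 1)" using norm_triangle_ineq3[of z 1] z by simp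
    thus ?thesis using z by (simp add: norm_divide divide_simps)
  qed
  \<comment> \<open>In Euler's integral the reflection u \<mapsto> 1 - u exchanges b with c - b and
    replaces z by z / (z - 1).\<close>
  have euler: "reg_2F1 a b c z = (1 - z) powr (-a) * reg_2F1 a (c - b) c (z / (z - 1))" if b: "Re b > 0" and cb: "Re c > Re b" for b c
  proof -
    have "reg_2F1 a b c z = euler_2F1 a b c z"
      by (rule reg_2F1_eqI[OF is_reg_2F1_euler[OF b cb] slit_plane_norm_less_1[OF z1(1)]])
    also have "\<dots> = rGamma b * rGamma (c - b) * (\<integral>u. beta_kernel b (c - b) (1 - u) * (1 - of_real (1 - u) * z) powr (-a) \<partial>unit_lborel)"
      unfolding euler_2F1_def by (subst unit_lborel_flip[symmetric]) (rule refl)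
    also have "(\<integral>u. beta_kernel b (c - b) (1 - u) * (1 - of_real (1 - u) * z) powr (-a) \<partial>unit_lborel) =
       (\<integral>u. (1 - z) powr (-a) * (beta_kernel (c - b) b u * (1 - of_real u * (z / (z - 1))) powr (-a)) \<partial>unit_lborel)"
    proof (rule Bochner_Integration.integral_cong[OF refl])
      fix u :: real assume "u \<in> space unit_lborel"
      hence u: "0 < u" "u < 1" by auto
      have "Re (1 - of_real (1 - u) * z) = u + (1 - u) * Re (1 - z)" by (simp add: algebra_simps)
      moreover have "(1 - u) * Re (1 - z) > 0" using u z1(2) by (intro mult_pos_pos) simp_all
      ultimately have "Re (1 - of_real (1 - u) * z) > 0" using u by linarith
      hence "(1 - of_real (1 - u) * z) powr (-a) = (1 - z) powr (-a) * ((1 - of_real (1 - u) * z) / (1 - z)) powr (-a)"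
        using z1(2) by (intro powr_quotient) simp
      also have "(1 - of_real (1 - u) * z) / (1 - z) = 1 - of_real u * (z / (z - 1))"
        using z1(3) by (simp add: divide_simps) (simp add: algebra_simps)
      finally have p: "(1 - of_real (1 - u) * z) powr (-a) = (1 - z) powr (-a) * (1 - of_real u * (z / (z - 1))) powr (-a)" .
      have k: "beta_kernel b (c - b) (1 - u) = beta_kernel (c - b) b u" by (simp add: beta_kernel_def mult.commute)
      show "beta_kernel b (c - b) (1 - u) * (1 - of_real (1 - u) * z) powr (-a) =
         (1 - z) powr (-a) * (beta_kernel (c - b) b u * (1 - of_real u * (z / (z - 1))) powr (-a))"
        unfolding p k by (simp only: mult_ac)
    qed
    also have "rGamma b * rGamma (c - b) * (\<integral>u. (1 - z) powr (-a) * (beta_kernel (c - b) b u * (1 - of_real u * (z / (z - 1))) powr (-a)) \<partial>unit_lborel) =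
       (1 - z) powr (-a) * (rGamma (c - b) * rGamma (c - (c - b)) * (\<integral>u. beta_kernel (c - b) (c - (c - b)) u * (1 - of_real u * (z / (z - 1))) powr (-a) \<partial>unit_lborel))"
      unfolding integral_mult_right_zero by (simp add: mult_ac)
    also have "\<dots> = (1 - z) powr (-a) * reg_2F1 a (c - b) c (z / (z - 1))"
      unfolding euler_2F1_def[symmetric] using b cb
      by (subst reg_2F1_eqI[OF is_reg_2F1_euler slit_plane_norm_less_1[OF w]]) auto
    finally show ?thesis .
  qed
  have hol: "(\<lambda>s. reg_2F1 (f s) (h s) (k s) v) holomorphic_on UNIV"
    if "f holomorphic_on UNIV" "h holomorphic_on UNIV" "k holomorphic_on UNIV" "cmod v < 1" for f h k v
    by (rule reg_2F1_holomorphic_parameters[OF open_UNIV that])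
  \<comment> \<open>For |z| < 1/2 both z and z / (z - 1) lie in the unit disc, where the regularised
    series is entire in the parameters. So the restrictions of Euler's integral are removed first in
    c, then in b.\<close>
  have ext_c: "reg_2F1 a b c z = (1 - z) powr (-a) * reg_2F1 a (c - b) c (z / (z - 1))" if b: "Re b > 0" for b c
  proof (rule analytic_continuation_open[of "{c. Re c > Re b}" UNIV "\<lambda>c. reg_2F1 a b c z" "\<lambda>c. (1 - z) powr (-a) * reg_2F1 a (c - b) c (z / (z - 1))"])
    show "{c. Re c > Re b} \<noteq> {}" by (auto intro!: exI[of _ "b + 1"])
    show "(\<lambda>c. reg_2F1 a b c z) holomorphic_on UNIV"
      by (intro hol holomorphic_on_const holomorphic_on_ident z1)
    show "(\<lambda>c. (1 - z) powr (-a) * reg_2F1 a (c - b) c (z / (z - 1))) holomorphic_on UNIV"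
      by (intro holomorphic_on_mult hol holomorphic_on_const holomorphic_on_diff holomorphic_on_ident w)
  qed (use euler b in \<open>auto simp: open_halfspace_Re_gt\<close>)
  show ?thesis
  proof (rule analytic_continuation_open[of "{b. Re b > 0}" UNIV "\<lambda>b. reg_2F1 a b c z" "\<lambda>b. (1 - z) powr (-a) * reg_2F1 a (c - b) c (z / (z - 1))"])
    show "{b. Re b > 0} \<noteq> {}" by (auto intro!: exI[of _ 1])
    show "(\<lambda>b. reg_2F1 a b c z) holomorphic_on UNIV"
      by (intro hol holomorphic_on_const holomorphic_on_ident z1)
    show "(\<lambda>b. (1 - z) powr (-a) * reg_2F1 a (c - b) c (z / (z - 1))) holomorphic_on UNIV"
      by (intro holomorphic_on_mult hol holomorphic_on_const holomorphic_on_diff holomorphic_on_ident w)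
  qed (use ext_c in \<open>auto simp: open_halfspace_Re_gt\<close>)
qed

lemma strip_D_Im_exp:
  assumes "\<xi> \<in> strip_D" "Im \<xi> \<noteq> 0"
  shows "Im (exp (2 * \<xi>)) \<noteq> 0" "Im (exp (- 2 * \<xi>)) \<noteq> 0" "sin (2 * Im \<xi>) \<noteq> 0"
proof -
  have "-pi < 2 * Im \<xi>" "2 * Im \<xi> < pi" "2 * Im \<xi> \<noteq> 0" using assms by (auto simp: strip_D_def)
  thus s: "sin (2 * Im \<xi>) \<noteq> 0" using sin_eq_0_pi by blast
  show "Im (exp (2 * \<xi>)) \<noteq> 0" "Im (exp (- 2 * \<xi>)) \<noteq> 0" using s by (auto simp: Im_exp)
qed

text \<open>The Cayley transform of tanh \<xi> is exp (- 2 \<xi>), which identifies the arguments in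
  \<open>jacobi_connection\<close>. Re \<tau> > 0 expresses |1 - \<tau>| < |1 + \<tau>|, and the
  sign of Im \<tau> later decides the branch in C(\<xi>, \<alpha>).\<close>

lemma strip_D_tanh:
  assumes \<xi>: "\<xi> \<in> strip_D"
  defines "\<tau> \<equiv> sinh \<xi> / cosh \<xi>"
  shows "Yp \<xi> = 1 + \<tau>" "Ym \<xi> = 1 - \<tau>" "Xp \<xi> = (1 + \<tau>) / \<tau>" "Xm \<xi> = (1 - \<tau>) / \<tau>"
    "(1 - \<tau>) / (1 + \<tau>) = exp (- 2 * \<xi>)" "(1 + \<tau>) / (1 - \<tau>) = exp (2 * \<xi>)" "Re \<tau> > 0"
    "Im \<xi> \<noteq> 0 \<Longrightarrow> Im \<tau> * Im \<xi> > 0"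
proof -
  note nz = strip_D_nz[OF \<xi>]
  have e: "exp \<xi> = cosh \<xi> + sinh \<xi>" "exp (- \<xi>) = cosh \<xi> - sinh \<xi>"
    by (simp_all add: cosh_field_def sinh_field_def field_simps)
  show Y: "Yp \<xi> = 1 + \<tau>" "Ym \<xi> = 1 - \<tau>" unfolding Yp_def Ym_def \<tau>_def e using nz by (simp_all add: field_simps)
  show "Xp \<xi> = (1 + \<tau>) / \<tau>" "Xm \<xi> = (1 - \<tau>) / \<tau>"
    unfolding Xp_def Xm_def \<tau>_def e using nz by (simp_all add: field_simps)
  have Y2: "1 + \<tau> = exp \<xi> / cosh \<xi>" "1 - \<tau> = exp (- \<xi>) / cosh \<xi>" using Y by (simp_all add: Yp_def Ym_def)
  have e2: "exp (- 2 * \<xi>) = exp (- \<xi>) / exp \<xi>" "exp (2 * \<xi>) = exp \<xi> / exp (- \<xi>)"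
    by (simp_all flip: exp_diff)
  show W: "(1 - \<tau>) / (1 + \<tau>) = exp (- 2 * \<xi>)" "(1 + \<tau>) / (1 - \<tau>) = exp (2 * \<xi>)"
    unfolding Y2 e2 using nz by simp_all
  have "cmod (1 - \<tau>) < cmod (1 + \<tau>)"
    unfolding Y2 norm_divide using \<xi> nz by (intro divide_strict_right_mono) (auto simp: strip_D_def)
  hence "(cmod (1 - \<tau>))\<^sup>2 < (cmod (1 + \<tau>))\<^sup>2" by (intro power_strict_mono) auto
  thus "Re \<tau> > 0" unfolding cmod_power2 by (simp add: power2_eq_square algebra_simps)
  show "Im \<tau> * Im \<xi> > 0" if "Im \<xi> \<noteq> 0"
  proof -
    have t: "1 + \<tau> \<noteq> 0" unfolding Y2 using nz by simp
    have "Im (exp (- 2 * \<xi>)) * (cmod (1 + \<tau>))\<^sup>2 = Im ((1 - \<tau>) * cnj (1 + \<tau>))"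
    proof -
      have "(1 - \<tau>) * cnj (1 + \<tau>) = exp (- 2 * \<xi>) * ((1 + \<tau>) * cnj (1 + \<tau>))"
        unfolding W(1)[symmetric] using t by simp
      also have "(1 + \<tau>) * cnj (1 + \<tau>) = of_real ((cmod (1 + \<tau>))\<^sup>2)" by (rule complex_norm_square[symmetric])
      finally show ?thesis by simp
    qed
    also have "\<dots> = - 2 * Im \<tau>" by (simp add: algebra_simps)
    finally have i: "2 * Im \<tau> = exp (- 2 * Re \<xi>) * sin (2 * Im \<xi>) * (cmod (1 + \<tau>))\<^sup>2" by (simp add: Im_exp)
    have "sin (2 * Im \<xi>) * Im \<xi> > 0"
    proof (cases "Im \<xi> > 0")
      case True
      hence "sin (2 * Im \<xi>) > 0" using \<xi> by (intro sin_gt_zero) (auto simp: strip_D_def)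
      thus ?thesis using True by simp
    next
      case False
      hence "sin (2 * (- Im \<xi>)) > 0" using \<xi> that by (intro sin_gt_zero) (auto simp: strip_D_def)
      hence "sin (2 * Im \<xi>) < 0" by simp
      thus ?thesis using False that by (intro mult_neg_neg) auto
    qed
    moreover have "(cmod (1 + \<tau>))\<^sup>2 > 0" using t by simp
    ultimately have "exp (- 2 * Re \<xi>) * (cmod (1 + \<tau>))\<^sup>2 * (sin (2 * Im \<xi>) * Im \<xi>) > 0"
      by (intro mult_pos_pos[OF mult_pos_pos] exp_gt_zero)
    also have "exp (- 2 * Re \<xi>) * (cmod (1 + \<tau>))\<^sup>2 * (sin (2 * Im \<xi>) * Im \<xi>) = 2 * Im \<tau> * Im \<xi>"
      unfolding i by (simp only: mult_ac)
    finally show ?thesis by simp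
  qed
qed

definition jacobi_rhs :: "complex \<Rightarrow> complex \<Rightarrow> complex \<Rightarrow> complex \<Rightarrow> complex \<Rightarrow> complex \<Rightarrow> complex" where
  "jacobi_rhs \<nu> \<alpha> \<beta> A B \<xi> =
     Xp \<xi> powr (\<alpha> + 1/2) * Yp \<xi> powr (\<beta> + 1/2) * exp (2 * \<nu> * \<xi>) * jacobi_E A B (2 * \<nu> + \<alpha> + \<beta>) (exp (- 2 * \<xi>)) -
     conn_C \<xi> \<alpha> * Xm \<xi> powr (\<alpha> + 1/2) * Ym \<xi> powr (\<beta> + 1/2) * exp (- 2 * \<nu> * \<xi>) * jacobi_E A B (2 * \<nu> + \<alpha> + \<beta>) (exp (2 * \<xi>))"

text \<open>The smallness conditions have one purpose each: |tanh \<xi>| < 1 for the triangle, |sinh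
  \<xi>|^2 < 1/2 for Pfaff's transformation, and Re (cosh \<xi>) > 0 for splitting the logarithms of
  1 \<plusminus> \<tau> and of cosh^2 \<xi>.\<close>

lemma reg_2F1_eq_jacobi_rhs_near_0:
  assumes \<xi>: "\<xi> \<in> strip_D" "Im \<xi> \<noteq> 0"
    and small: "cmod (sinh \<xi> / cosh \<xi>) < 1" "cmod (sinh \<xi> ^ 2) < 1/2" "Re (cosh \<xi>) > 0"
    and A: "A = \<alpha> \<or> A = - \<alpha>" and B: "B = \<beta> \<or> B = - \<beta>"
    and par: "Re A > -1/2" "Re B > -1/2" "Re (2 * \<nu> + \<alpha> + \<beta> + 1) > Re (A + B)"
  shows "of_real pi * 2 powr (- (2 * \<nu> + \<alpha> + \<beta>)) * rGamma (\<nu> + 1) * rGamma (\<nu> + \<beta> + 1) *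
      reg_2F1 (- \<nu>) (\<nu> + \<alpha> + \<beta> + 1) (\<alpha> + 1) (- (sinh \<xi> ^ 2)) = jacobi_rhs \<nu> \<alpha> \<beta> A B \<xi>"
proof -
  define \<tau> where "\<tau> = sinh \<xi> / cosh \<xi>"
  define \<sigma> where "\<sigma> = 2 * \<nu> + \<alpha> + \<beta>"
  note nz = strip_D_nz[OF \<xi>(1)]
  note t = strip_D_tanh[OF \<xi>(1), folded \<tau>_def]
  have \<tau>: "cmod \<tau> < 1" "Re \<tau> > 0" "Im \<tau> \<noteq> 0" "\<tau> \<noteq> 0" using small t(7) t(8)[OF \<xi>(2)] by (auto simp: \<tau>_def)
  have conn: "jacobi_connection \<alpha> A B \<sigma> \<tau>"
  proof (cases "A = \<alpha>")
    case True
    show ?thesis unfolding True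
      by (rule jacobi_connection_plus[OF _ par(2) _ \<tau>(1-3)]) (use par True in \<open>auto simp: \<sigma>_def\<close>)
  next
    case False
    hence A': "A = - \<alpha>" using A by blast
    show ?thesis unfolding A'
      by (rule jacobi_connection_minus[OF _ par(2) _ \<tau>(1-3)]) (use par A' in \<open>auto simp: \<sigma>_def\<close>)
  qed
  have Re1: "Re (1 + \<tau>) > 0" "Re (1 - \<tau>) > 0" using \<tau> abs_Re_le_cmod[of \<tau>] by auto
  have n1: "1 + \<tau> \<noteq> 0" "1 - \<tau> \<noteq> 0" using Re1 by (metis less_irrefl zero_complex.sel(1))+
  have X: "Xp \<xi> powr p = (1 + \<tau>) powr p / \<tau> powr p" "Xm \<xi> powr p = (1 - \<tau>) powr p / \<tau> powr p" for p
    unfolding t(3,4) using powr_quotient[of "1 + \<tau>" \<tau> p] powr_quotient[of "1 - \<tau>" \<tau> p] Re1 \<tau> by auto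
  have Y: "(1 + \<tau>) powr p = exp (p * \<xi>) / cosh \<xi> powr p" "(1 - \<tau>) powr p = exp (- (p * \<xi>)) / cosh \<xi> powr p" for p
  proof -
    have im: "\<bar>Im (Ln (cosh \<xi>))\<bar> < pi / 2" using Re_Ln_pos_lt[OF nz(2)] small(3) by simp
    have "\<bar>Im \<xi>\<bar> < pi / 2" using \<xi>(1) by (simp add: strip_D_def)
    hence b: "- pi < Im (\<xi> - Ln (cosh \<xi>))" "Im (\<xi> - Ln (cosh \<xi>)) \<le> pi" "- pi < Im (- \<xi> - Ln (cosh \<xi>))" "Im (- \<xi> - Ln (cosh \<xi>)) \<le> pi"
      using im by (auto simp: abs_less_iff)
    have "exp (\<xi> - Ln (cosh \<xi>)) = 1 + \<tau>" "exp (- \<xi> - Ln (cosh \<xi>)) = 1 - \<tau>"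
      unfolding exp_diff exp_Ln[OF nz(2)] using t(1,2) by (simp_all add: Yp_def Ym_def)
    hence l: "Ln (1 + \<tau>) = \<xi> - Ln (cosh \<xi>)" "Ln (1 - \<tau>) = - \<xi> - Ln (cosh \<xi>)"
      using b by (auto intro!: Ln_unique)
    show "(1 + \<tau>) powr p = exp (p * \<xi>) / cosh \<xi> powr p" "(1 - \<tau>) powr p = exp (- (p * \<xi>)) / cosh \<xi> powr p"
      using nz n1 unfolding powr_def l by (simp_all add: ring_distribs exp_diff)
  qed
  \<comment> \<open>1 - \<tau> lies in the right half-plane. The logarithm of \<tau> - 1 differs
    from that of 1 - \<tau> by + pi i or - pi i according to the sign of Im \<tau>, and the exponent
    \<alpha> - 1/2 turns this into the two non-real forms of \<open>conn_C\<close>.\<close>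
  have CC: "conn_C \<xi> \<alpha> * (1 - \<tau>) powr (\<alpha> - 1/2) = (\<tau> - 1) powr (\<alpha> - 1/2)"
  proof -
    have n: "1 - \<tau> \<noteq> 0" "\<tau> - 1 \<noteq> 0" using n1 by auto
    have m: "\<bar>Im (Ln (1 - \<tau>))\<bar> < pi / 2" using Re_Ln_pos_lt[OF n(1)] Re1 by simp
    show ?thesis
    proof (cases "Im \<xi> > 0")
      case True
      hence "Im \<tau> > 0" using t(8)[OF \<xi>(2)] by (simp add: zero_less_mult_iff)
      hence "Im (Ln (1 - \<tau>)) < 0" using Im_Ln_neg[of "1 - \<tau>"] by simp
      hence "Ln (\<tau> - 1) = Ln (1 - \<tau>) + of_real pi * \<i>"
        using m n by (intro Ln_unique) (auto simp: exp_add abs_less_iff)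
      hence "(\<tau> - 1) powr (\<alpha> - 1/2) = (1 - \<tau>) powr (\<alpha> - 1/2) * exp ((\<alpha> - 1/2) * (of_real pi * \<i>))"
        using n by (simp only: powr_def if_False distrib_left exp_add)
      also have "(\<alpha> - 1/2) * (of_real pi * \<i>) = of_real pi * \<i> * \<alpha> - of_real pi / 2 * \<i>" by (simp add: algebra_simps)
      also have "exp (of_real pi * \<i> * \<alpha> - of_real pi / 2 * \<i>) = - \<i> * exp (of_real pi * \<i> * \<alpha>)"
      proof -
        have "exp (complex_of_real pi / 2 * \<i>) = \<i>" using exp_eq_polar[of "complex_of_real pi / 2 * \<i>"] by (simp add: cis_pi_half)
        thus ?thesis unfolding exp_diff by (simp add: field_simps)
      qed
      finally show ?thesis using True unfolding conn_C_def by simp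
    next
      case False
      hence neg: "Im \<xi> < 0" using \<xi>(2) by simp
      hence "Im \<tau> < 0" using t(8)[OF \<xi>(2)] by (simp add: zero_less_mult_iff)
      hence "Im (1 - \<tau>) > 0" by simp
      hence "Im (Ln (1 - \<tau>)) > 0" using Im_Ln_pos_lt[OF n(1)] by simp
      hence "Ln (\<tau> - 1) = Ln (1 - \<tau>) - of_real pi * \<i>"
        using m n by (intro Ln_unique) (auto simp: exp_diff abs_less_iff)
      hence "(\<tau> - 1) powr (\<alpha> - 1/2) = (1 - \<tau>) powr (\<alpha> - 1/2) * exp ((\<alpha> - 1/2) * (- (of_real pi * \<i>)))"
        using n by (simp only: powr_def if_False diff_conv_add_uminus[of "Ln (1 - \<tau>)"] distrib_left exp_add)
      also have "(\<alpha> - 1/2) * (- (of_real pi * \<i>)) = - (of_real pi * \<i> * \<alpha>) + of_real pi / 2 * \<i>" by (simp add: algebra_simps)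
      also have "exp (- (of_real pi * \<i> * \<alpha>) + of_real pi / 2 * \<i>) = \<i> * exp (- (of_real pi * \<i> * \<alpha>))"
      proof -
        have "exp (complex_of_real pi / 2 * \<i>) = \<i>" using exp_eq_polar[of "complex_of_real pi / 2 * \<i>"] by (simp add: cis_pi_half)
        thus ?thesis unfolding exp_add by simp
      qed
      finally show ?thesis using neg unfolding conn_C_def by simp
    qed
  qed
  define E1 E2 where "E1 = jacobi_E A B \<sigma> (exp (- 2 * \<xi>))" and "E2 = jacobi_E A B \<sigma> (exp (2 * \<xi>))"
  have conn': "\<tau> powr (\<alpha> - 1/2) * \<tau> * jacobi_lhs \<alpha> B \<sigma> \<tau> =
     (1 + \<tau>) powr (\<sigma> + 1) * E1 - (1 - \<tau>) powr (\<sigma> - \<alpha> + 3/2) * (\<tau> - 1) powr (\<alpha> - 1/2) * E2"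
    using conn unfolding jacobi_connection_def t(5,6) E1_def E2_def .
  have pa: "z powr (\<alpha> + 1/2) * z powr (\<beta> + 1/2) = z powr (\<sigma> + 1) / z powr (2 * \<nu>)" if "z \<noteq> 0" for z :: complex
  proof -
    have "\<sigma> + 1 = \<alpha> + 1/2 + (\<beta> + 1/2) + 2 * \<nu>" by (simp add: \<sigma>_def)
    hence "z powr (\<sigma> + 1) = z powr (\<alpha> + 1/2) * z powr (\<beta> + 1/2) * z powr (2 * \<nu>)" by (simp only: powr_add)
    thus ?thesis using that by simp
  qed
  have c0: "cosh \<xi> powr p \<noteq> 0" "\<tau> powr p \<noteq> 0" "(1 + \<tau>) powr p \<noteq> 0" "(1 - \<tau>) powr p \<noteq> 0" for p
    using nz \<tau> n1 by auto
  have T1: "Xp \<xi> powr (\<alpha> + 1/2) * Yp \<xi> powr (\<beta> + 1/2) * exp (2 * \<nu> * \<xi>) = cosh \<xi> powr (2 * \<nu>) / \<tau> powr (\<alpha> + 1/2) * (1 + \<tau>) powr (\<sigma> + 1)"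
  proof -
    have "Xp \<xi> powr (\<alpha> + 1/2) * Yp \<xi> powr (\<beta> + 1/2) * exp (2 * \<nu> * \<xi>) =
       ((1 + \<tau>) powr (\<alpha> + 1/2) * (1 + \<tau>) powr (\<beta> + 1/2)) * exp (2 * \<nu> * \<xi>) / \<tau> powr (\<alpha> + 1/2)"
      unfolding X t(1) by simp
    also have "\<dots> = (1 + \<tau>) powr (\<sigma> + 1) * (exp (2 * \<nu> * \<xi>) / (1 + \<tau>) powr (2 * \<nu>)) / \<tau> powr (\<alpha> + 1/2)"
      unfolding pa[OF n1(1)] by simp
    also have "exp (2 * \<nu> * \<xi>) / (1 + \<tau>) powr (2 * \<nu>) = cosh \<xi> powr (2 * \<nu>)"
      unfolding Y by simp
    finally show ?thesis by simp
  qed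
  have T2: "conn_C \<xi> \<alpha> * Xm \<xi> powr (\<alpha> + 1/2) * Ym \<xi> powr (\<beta> + 1/2) * exp (- 2 * \<nu> * \<xi>) =
     cosh \<xi> powr (2 * \<nu>) / \<tau> powr (\<alpha> + 1/2) * ((1 - \<tau>) powr (\<sigma> - \<alpha> + 3/2) * (\<tau> - 1) powr (\<alpha> - 1/2))"
  proof -
    have "conn_C \<xi> \<alpha> * Xm \<xi> powr (\<alpha> + 1/2) * Ym \<xi> powr (\<beta> + 1/2) * exp (- 2 * \<nu> * \<xi>) =
       conn_C \<xi> \<alpha> * ((1 - \<tau>) powr (\<alpha> + 1/2) * (1 - \<tau>) powr (\<beta> + 1/2)) * exp (- 2 * \<nu> * \<xi>) / \<tau> powr (\<alpha> + 1/2)"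
      unfolding X t(2) by simp
    also have "\<dots> = conn_C \<xi> \<alpha> * (1 - \<tau>) powr (\<sigma> + 1) * (exp (- 2 * \<nu> * \<xi>) / (1 - \<tau>) powr (2 * \<nu>)) / \<tau> powr (\<alpha> + 1/2)"
      unfolding pa[OF n1(2)] by simp
    also have "exp (- 2 * \<nu> * \<xi>) / (1 - \<tau>) powr (2 * \<nu>) = cosh \<xi> powr (2 * \<nu>)"
      unfolding Y by simp
    also have "(1 - \<tau>) powr (\<sigma> + 1) = (1 - \<tau>) powr (\<sigma> - \<alpha> + 3/2) * (1 - \<tau>) powr (\<alpha> - 1/2)"
    proof -
      have "\<sigma> + 1 = \<sigma> - \<alpha> + 3/2 + (\<alpha> - 1/2)" by simp
      thus ?thesis by (simp only: powr_add)
    qed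
    also have "conn_C \<xi> \<alpha> * ((1 - \<tau>) powr (\<sigma> - \<alpha> + 3/2) * (1 - \<tau>) powr (\<alpha> - 1/2)) * cosh \<xi> powr (2 * \<nu>) / \<tau> powr (\<alpha> + 1/2) =
       cosh \<xi> powr (2 * \<nu>) / \<tau> powr (\<alpha> + 1/2) * ((1 - \<tau>) powr (\<sigma> - \<alpha> + 3/2) * (conn_C \<xi> \<alpha> * (1 - \<tau>) powr (\<alpha> - 1/2)))"
      by simp
    finally show ?thesis unfolding CC .
  qed
  have "jacobi_rhs \<nu> \<alpha> \<beta> A B \<xi> = cosh \<xi> powr (2 * \<nu>) / \<tau> powr (\<alpha> + 1/2) * (\<tau> powr (\<alpha> - 1/2) * \<tau> * jacobi_lhs \<alpha> B \<sigma> \<tau>)"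
    unfolding conn' jacobi_rhs_def T1 T2 \<sigma>_def[symmetric] E1_def[symmetric] E2_def[symmetric] by (simp only: right_diff_distrib mult.assoc)
  also have "\<tau> powr (\<alpha> - 1/2) * \<tau> = \<tau> powr (\<alpha> + 1/2)"
  proof -
    have "\<alpha> + 1/2 = \<alpha> - 1/2 + 1" by simp
    hence "\<tau> powr (\<alpha> + 1/2) = \<tau> powr (\<alpha> - 1/2) * \<tau> powr 1" by (simp only: powr_add)
    thus ?thesis using \<tau>(4) by simp
  qed
  also have "cosh \<xi> powr (2 * \<nu>) / \<tau> powr (\<alpha> + 1/2) * (\<tau> powr (\<alpha> + 1/2) * jacobi_lhs \<alpha> B \<sigma> \<tau>) = cosh \<xi> powr (2 * \<nu>) * jacobi_lhs \<alpha> B \<sigma> \<tau>"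
    using c0 by simp
  \<comment> \<open>Changing B from \<beta> to - \<beta> exchanges the two upper parameters and the
    two reciprocal Gamma factors, nothing else.\<close>
  also have "jacobi_lhs \<alpha> B \<sigma> \<tau> = of_real pi * 2 powr (- \<sigma>) * rGamma (\<nu> + 1) * rGamma (\<nu> + \<beta> + 1) * reg_2F1 (- \<nu>) (- \<nu> - \<beta>) (\<alpha> + 1) (\<tau> ^ 2)"
    using B
  proof
    assume B: "B = \<beta>"
    have "(\<sigma> - \<alpha> - B) / 2 = \<nu>" by (simp add: \<sigma>_def B)
    thus ?thesis unfolding jacobi_lhs_def B by (simp add: reg_2F1_commute)
  next
    assume B: "B = - \<beta>"
    have "(\<sigma> - \<alpha> - B) / 2 = \<nu> + \<beta>" by (simp add: \<sigma>_def B field_simps)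
    hence 1: "(\<sigma> - \<alpha> - - \<beta>) / 2 = \<nu> + \<beta>" by (simp only: B)
    have 2: "- \<nu> - \<beta> - - \<beta> = - \<nu>" "\<nu> + \<beta> + - \<beta> + 1 = \<nu> + 1" "- (\<nu> + \<beta>) = - \<nu> - \<beta>" by simp_all
    show ?thesis unfolding jacobi_lhs_def B 1 2 by (simp only: mult_ac)
  qed
  also have "cosh \<xi> powr (2 * \<nu>) * (of_real pi * 2 powr (- \<sigma>) * rGamma (\<nu> + 1) * rGamma (\<nu> + \<beta> + 1) * reg_2F1 (- \<nu>) (- \<nu> - \<beta>) (\<alpha> + 1) (\<tau> ^ 2)) =
     of_real pi * 2 powr (- \<sigma>) * rGamma (\<nu> + 1) * rGamma (\<nu> + \<beta> + 1) * (cosh \<xi> powr (2 * \<nu>) * reg_2F1 (- \<nu>) (- \<nu> - \<beta>) (\<alpha> + 1) (\<tau> ^ 2))"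
    by (simp only: mult_ac)
  \<comment> \<open>Pfaff's transformation at - sinh^2 \<xi>: the new argument is \<tau>^2, and the
    power is one of 1 + sinh^2 \<xi> = cosh^2 \<xi>.\<close>
  also have "cosh \<xi> powr (2 * \<nu>) * reg_2F1 (- \<nu>) (- \<nu> - \<beta>) (\<alpha> + 1) (\<tau> ^ 2) = reg_2F1 (- \<nu>) (\<nu> + \<alpha> + \<beta> + 1) (\<alpha> + 1) (- (sinh \<xi> ^ 2))"
  proof -
    have cs: "cosh \<xi> ^ 2 = 1 + sinh \<xi> ^ 2" by (simp add: cosh_square_eq)
    have d: "- (sinh \<xi> ^ 2) / (- (sinh \<xi> ^ 2) - 1) = \<tau> ^ 2"
    proof -
      have "- (sinh \<xi> ^ 2) - 1 = - (cosh \<xi> ^ 2)" by (simp add: cs)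
      thus ?thesis by (simp add: \<tau>_def power_divide)
    qed
    have im: "\<bar>Im (Ln (cosh \<xi>))\<bar> < pi / 2" using Re_Ln_pos_lt[OF nz(2)] small(3) by simp
    have "Ln (cosh \<xi> ^ 2) = 2 * Ln (cosh \<xi>)"
      using im nz by (intro Ln_unique) (auto simp: exp_double abs_less_iff)
    hence "(cosh \<xi> ^ 2) powr \<nu> = cosh \<xi> powr (2 * \<nu>)" using nz by (simp add: powr_def mult_ac)
    moreover have "\<alpha> + 1 - (\<nu> + \<alpha> + \<beta> + 1) = - \<nu> - \<beta>" by simp
    moreover have "reg_2F1 (- \<nu>) (\<nu> + \<alpha> + \<beta> + 1) (\<alpha> + 1) (- (sinh \<xi> ^ 2)) =
       (1 - (- (sinh \<xi> ^ 2))) powr (- (- \<nu>)) * reg_2F1 (- \<nu>) (\<alpha> + 1 - (\<nu> + \<alpha> + \<beta> + 1)) (\<alpha> + 1) (- (sinh \<xi> ^ 2) / (- (sinh \<xi> ^ 2) - 1))"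
      by (rule reg_2F1_pfaff) (use small(2) in simp)
    ultimately show ?thesis unfolding d by (simp add: cs)
  qed
  finally show ?thesis unfolding \<sigma>_def by simp
qed

text \<open>The sign v treats the two halves of the strip alike. On the half H that contains \<xi>
  the factor \<open>conn_C\<close> is constant, and 0 lies on the boundary of H, so the points of H
  near 0 form a non-empty open set from which to continue.\<close>

lemma reg_2F1_eq_jacobi_rhs:
  assumes \<xi>: "\<xi> \<in> strip_D" "Im \<xi> \<noteq> 0"
    and A: "A = \<alpha> \<or> A = - \<alpha>" and B: "B = \<beta> \<or> B = - \<beta>"
    and par: "Re A > -1/2" "Re B > -1/2" "Re (2 * \<nu> + \<alpha> + \<beta> + 1) > Re (A + B)"
  shows "of_real pi * 2 powr (- (2 * \<nu> + \<alpha> + \<beta>)) * rGamma (\<nu> + 1) * rGamma (\<nu> + \<beta> + 1) *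
      reg_2F1 (- \<nu>) (\<nu> + \<alpha> + \<beta> + 1) (\<alpha> + 1) (- (sinh \<xi> ^ 2)) = jacobi_rhs \<nu> \<alpha> \<beta> A B \<xi>"
proof -
  define v :: real where "v = (if Im \<xi> > 0 then 1 else -1)"
  define H where "H = {z. Re z > 0} \<inter> {z. v * Im z > 0} \<inter> {z. v * Im z < pi / 2}"
  have Halt: "H = {z. Re z > 0} \<inter> {z. Im z > 0} \<inter> {z. Im z < pi / 2} \<or> H = {z. Re z > 0} \<inter> {z. Im z < 0} \<inter> {z. Im z > - pi / 2}"
    by (auto simp: H_def v_def)
  have H: "open H" "connected H"
    using Halt by (elim disjE; hypsubst?; simp only:; intro open_Int convex_connected convex_Int open_halfspace_Re_gt open_halfspace_Im_gt open_halfspace_Im_lt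
        convex_halfspace_Re_gt convex_halfspace_Im_gt convex_halfspace_Im_lt)+
  have \<xi>H: "\<xi> \<in> H" using \<xi> by (auto simp: H_def v_def strip_D_def)
  have HD: "z \<in> strip_D" "Im z \<noteq> 0" if "z \<in> H" for z using that by (auto simp: H_def v_def strip_D_def split: if_splits)
  have sgn: "conn_C z \<alpha> = conn_C \<xi> \<alpha>" if "z \<in> H" for z
    using that \<xi>(2) by (auto simp: H_def v_def conn_C_def split: if_splits)
  define S where "S = {z. cmod (sinh z / cosh z) < 1} \<inter> {z. cmod (sinh z ^ 2) < 1/2} \<inter> {z. Re (cosh z) > 0}"
  have S: "\<exists>r>0. \<forall>z. cmod z < r \<longrightarrow> z \<in> S"
  proof -
    have 1: "((\<lambda>z::complex. cmod (sinh z / cosh z)) \<longlongrightarrow> cmod (sinh 0 / cosh 0)) (at 0)"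
      unfolding sinh_field_def cosh_field_def by (intro tendsto_intros) auto
    have 2: "((\<lambda>z::complex. cmod (sinh z ^ 2)) \<longlongrightarrow> cmod (sinh 0 ^ 2)) (at 0)"
      unfolding sinh_field_def by (intro tendsto_intros) auto
    have 3: "((\<lambda>z::complex. Re (cosh z)) \<longlongrightarrow> Re (cosh 0)) (at 0)"
      unfolding cosh_field_def by (intro tendsto_intros) auto
    have "eventually (\<lambda>z. z \<in> S) (at 0)"
      using order_tendstoD(2)[OF 1, of 1] order_tendstoD(2)[OF 2, of "1/2"] order_tendstoD(1)[OF 3, of 0]
      unfolding S_def by (simp add: eventually_conj_iff)
    then obtain r where r: "r > 0" "\<forall>z. z \<noteq> 0 \<and> dist z 0 < r \<longrightarrow> z \<in> S" unfolding eventually_at by blast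
    have "z \<in> S" if "cmod z < r" for z
      using r(2)[rule_format, of z] that by (cases "z = 0") (simp_all add: S_def)
    thus ?thesis using r(1) by blast
  qed
  then obtain r where r: "r > 0" "\<And>z. cmod z < r \<Longrightarrow> z \<in> S" by blast
  let ?L = "\<lambda>z. of_real pi * 2 powr (- (2 * \<nu> + \<alpha> + \<beta>)) * rGamma (\<nu> + 1) * rGamma (\<nu> + \<beta> + 1) *
      reg_2F1 (- \<nu>) (\<nu> + \<alpha> + \<beta> + 1) (\<alpha> + 1) (- (sinh z ^ 2))"
  let ?R = "\<lambda>z. Xp z powr (\<alpha> + 1/2) * Yp z powr (\<beta> + 1/2) * exp (2 * \<nu> * z) * jacobi_E A B (2 * \<nu> + \<alpha> + \<beta>) (exp (- 2 * z)) -
     conn_C \<xi> \<alpha> * Xm z powr (\<alpha> + 1/2) * Ym z powr (\<beta> + 1/2) * exp (- 2 * \<nu> * z) * jacobi_E A B (2 * \<nu> + \<alpha> + \<beta>) (exp (2 * z))"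
  have "?L \<xi> = ?R \<xi>"
  proof (rule analytic_continuation_open[of "H \<inter> ball 0 r" H ?L ?R])
    show "open (H \<inter> ball 0 r)" using H by auto
    define q where "q = min (r / 4) (pi / 4)"
    have q: "q > 0" "q \<le> r / 4" "q \<le> pi / 4" using r(1) by (auto simp: q_def)
    have "cmod (Complex q (v * q)) \<le> q + q"
      using cmod_le[of "Complex q (v * q)"] q by (auto simp: v_def split: if_splits)
    hence "Complex q (v * q) \<in> H \<inter> ball 0 r"
      using q r(1) by (auto simp: H_def v_def)
    thus "H \<inter> ball 0 r \<noteq> {}" by blast
    \<comment> \<open>4 sinh^2 z = exp (2 z) + exp (- 2 z) - 2 is real only if sin (2 Im z) = 0 or
      Re z = 0, and H excludes both.\<close>
    have slit: "- (sinh z ^ 2) \<in> slit_plane" if z: "z \<in> H" for z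
    proof (rule ccontr)
      assume "- (sinh z ^ 2) \<notin> slit_plane"
      hence im: "Im (- (sinh z ^ 2)) = 0" and re: "Re (- (sinh z ^ 2)) \<ge> 1" by (auto simp: slit_plane_iff)
      have W: "4 * sinh z ^ 2 = exp (2 * z) + exp (- 2 * z) - 2"
        by (simp add: sinh_field_def power2_eq_square field_simps flip: exp_add)
      have "Im (exp (2 * z) + exp (- 2 * z) - 2) = 0" using im unfolding W[symmetric] by simp
      hence "sin (2 * Im z) * (exp (2 * Re z) - exp (- 2 * Re z)) = 0" by (simp add: Im_exp algebra_simps)
      moreover have "sin (2 * Im z) \<noteq> 0" using strip_D_Im_exp(3) HD[OF z] by blast
      ultimately have "exp (2 * Re z) = exp (- 2 * Re z)" by simp
      hence "Re z = 0" by simp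
      thus False using z by (simp add: H_def)
    qed
    have "(reg_2F1 (- \<nu>) (\<nu> + \<alpha> + \<beta> + 1) (\<alpha> + 1) \<circ> (\<lambda>z. - (sinh z ^ 2))) holomorphic_on H"
      by (rule holomorphic_on_compose_gen[OF _ reg_2F1_holomorphic])
         (use slit in \<open>auto intro!: holomorphic_intros simp: sinh_field_def\<close>)
    thus "?L holomorphic_on H" by (auto intro!: holomorphic_intros simp: o_def)
    have XY: "Xp holomorphic_on H" "Yp holomorphic_on H" "Xm holomorphic_on H" "Ym holomorphic_on H"
      unfolding Xp_def[abs_def] Yp_def[abs_def] Xm_def[abs_def] Ym_def[abs_def] sinh_field_def cosh_field_def
      using strip_D_nz HD(1) by (auto intro!: holomorphic_intros simp: sinh_field_def cosh_field_def)
    have E: "(\<lambda>z. jacobi_E A B (2 * \<nu> + \<alpha> + \<beta>) (exp (- 2 * z))) holomorphic_on H" "(\<lambda>z. jacobi_E A B (2 * \<nu> + \<alpha> + \<beta>) (exp (2 * z))) holomorphic_on H"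
      by (intro jacobi_E_holomorphic H(1) par; use strip_D_Im_exp HD in \<open>auto intro!: holomorphic_intros\<close>)+
    show "?R holomorphic_on H"
      by (intro holomorphic_on_diff holomorphic_on_mult holomorphic_on_powr holomorphic_on_const XY E)
         (use XY_notin_cut HD(1) in \<open>auto intro!: holomorphic_intros\<close>)
    fix z assume z: "z \<in> H \<inter> ball 0 r"
    hence zS: "z \<in> S" and zH: "z \<in> H" using r(2) by auto
    have "?L z = jacobi_rhs \<nu> \<alpha> \<beta> A B z"
      by (rule reg_2F1_eq_jacobi_rhs_near_0[OF HD[OF zH] _ _ _ A B par]) (use zS in \<open>auto simp: S_def\<close>)
    thus "?L z = ?R z" unfolding jacobi_rhs_def sgn[OF zH] .
  qed (use H \<xi>H in auto)
  thus ?thesis unfolding jacobi_rhs_def .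
qed

section \<open>The remainders\<close>

lemma primed_cases:
  assumes "primed \<mu> \<mu>'"
  shows "\<mu>' = \<mu> \<or> \<mu>' = - \<mu>" "Re \<mu>' > -1/2"
    "-1/2 < Re \<mu> \<Longrightarrow> Re \<mu> < real n + 1/2 \<Longrightarrow> Re \<mu>' < real n + 1/2"
    "-1/2 < Re \<mu> \<Longrightarrow> Re \<mu> < real n + 1/2 \<Longrightarrow> hat_a n \<mu>' = hat_a n \<mu>"
    "coeff_a n \<mu>' = coeff_a n \<mu>"
proof -
  show *: "\<mu>' = \<mu> \<or> \<mu>' = - \<mu>" using assms unfolding primed_def by linarith
  have cs: "Re \<mu> \<ge> 1/2 \<and> \<mu>' = \<mu> \<or> Re \<mu> \<le> -1/2 \<and> \<mu>' = - \<mu> \<or> -1/2 < Re \<mu> \<and> Re \<mu> < 1/2 \<and> (\<mu>' = \<mu> \<or> \<mu>' = - \<mu>)"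
    using assms unfolding primed_def by linarith
  show "Re \<mu>' > -1/2" using cs by auto
  show "coeff_a n \<mu>' = coeff_a n \<mu>" using * by (auto simp: coeff_a_minus)
  show "Re \<mu>' < real n + 1/2" if "-1/2 < Re \<mu>" "Re \<mu> < real n + 1/2" using cs that by auto
  show "hat_a n \<mu>' = hat_a n \<mu>" if "-1/2 < Re \<mu>" "Re \<mu> < real n + 1/2"
    using cs that by (auto simp: abs_less_iff intro!: hat_a_minus)
qed

text \<open>The modulus of 1 - W is written as that of (1 - 1 / W) W, because at W = exp
  (\<plusminus> 2 \<xi>) the quotient |W| / |Im W| is then the cosecant.\<close>

definition seg_factor :: "complex \<Rightarrow> real" where
  "seg_factor W = (if 1 \<le> Re W then 1 else if 0 \<le> Re W then cmod (1 - 1 / W) * (cmod W / \<bar>Im W\<bar>) else cmod (1 - 1 / W))"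

text \<open>With \<open>1 - s / (1 - W) = (1 - s - W) / (1 - W)\<close>, the three cases are the possible positions of the
  point of \<open>[0, 1]\<close> closest to \<open>W\<close>.\<close>

lemma seg_factor:
  assumes W: "Im W \<noteq> 0" and s: "s \<in> {0..1}"
  shows "1 / cmod (1 - of_real s * (1 / (1 - W))) \<le> seg_factor W"
proof -
  have nz: "W \<noteq> 0" "1 - W \<noteq> 0" "Im (1 - of_real s - W) \<noteq> 0" using W by auto
  hence nz': "1 - of_real s - W \<noteq> 0" by (metis zero_complex.sel(2))
  have "1 - of_real s * (1 / (1 - W)) = (1 - of_real s - W) / (1 - W)" using nz by (simp add: field_simps)
  hence eq: "1 / cmod (1 - of_real s * (1 / (1 - W))) = cmod (1 - W) / cmod (1 - of_real s - W)"
    by (simp add: norm_divide)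
  have mono: "cmod u \<le> cmod v" if "\<bar>Re u\<bar> \<le> \<bar>Re v\<bar>" "\<bar>Im u\<bar> \<le> \<bar>Im v\<bar>" for u v
    unfolding cmod_def using that by (intro real_sqrt_le_mono add_mono) (simp_all add: abs_le_square_iff)
  have q: "cmod (1 - W) = cmod (1 - 1 / W) * cmod W"
  proof -
    have "(1 - 1 / W) * W = W - 1" using nz(1) by (simp add: left_diff_distrib)
    thus ?thesis unfolding norm_mult[symmetric] by (simp only: norm_minus_commute)
  qed
  consider "1 \<le> Re W" | "0 \<le> Re W" "Re W < 1" | "Re W < 0" by linarith
  thus ?thesis
  proof cases
    case 1
    have "cmod (1 - W) \<le> cmod (1 - of_real s - W)" using 1 s by (intro mono) auto
    thus ?thesis unfolding eq seg_factor_def using 1 nz' by simp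
  next
    case 2
    have "\<bar>Im W\<bar> \<le> cmod (1 - of_real s - W)" using abs_Im_le_cmod[of "1 - of_real s - W"] by simp
    hence "cmod (1 - W) / cmod (1 - of_real s - W) \<le> cmod (1 - W) / \<bar>Im W\<bar>" using W nz' by (intro divide_left_mono) auto
    thus ?thesis unfolding eq seg_factor_def using 2 q by simp
  next
    case 3
    have "cmod W \<le> cmod (1 - of_real s - W)" using 3 s by (intro mono) auto
    hence "cmod (1 - W) / cmod (1 - of_real s - W) \<le> cmod (1 - W) / cmod W" using nz nz' by (intro divide_left_mono) auto
    thus ?thesis unfolding eq seg_factor_def using 3 q nz by simp
  qed
qed

lemma abs_csc_exp:
  "cmod (exp (2 * \<xi>)) / \<bar>Im (exp (2 * \<xi>))\<bar> = abs_csc \<xi>" "cmod (exp (- 2 * \<xi>)) / \<bar>Im (exp (- 2 * \<xi>))\<bar> = abs_csc \<xi>"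
  by (simp_all add: abs_csc_def Im_exp abs_mult)

text \<open>Here |W| < 1 excludes the first case of \<open>seg_factor\<close>. Of the factors for W
  and - W exactly one carries the cosecant, except on Re W = 0, where both do but the cosecant is
  1.\<close>

lemma seg_factor_plus:
  assumes \<xi>: "\<xi> \<in> strip_D" "Im \<xi> \<noteq> 0"
  shows "seg_factor (exp (- 2 * \<xi>)) = (if 0 \<le> Re (exp (- 2 * \<xi>)) then cmod (1 - exp (2 * \<xi>)) * abs_csc \<xi> else cmod (1 - exp (2 * \<xi>)))"
    "seg_factor (- exp (- 2 * \<xi>)) = (if Re (exp (- 2 * \<xi>)) \<le> 0 then cmod (1 + exp (2 * \<xi>)) * abs_csc \<xi> else cmod (1 + exp (2 * \<xi>)))"
    "seg_factor (exp (- 2 * \<xi>)) * seg_factor (- exp (- 2 * \<xi>)) = cmod (1 - exp (4 * \<xi>)) * abs_csc \<xi>"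
proof -
  have "cmod (exp (- 2 * \<xi>)) < 1" using \<xi> by (simp add: strip_D_def)
  hence r: "\<bar>Re (exp (- 2 * \<xi>))\<bar> < 1" using abs_Re_le_cmod order_le_less_trans by blast
  have i: "1 / exp (- 2 * \<xi>) = exp (2 * \<xi>)" by (simp add: exp_minus field_simps)
  show 1: "seg_factor (exp (- 2 * \<xi>)) = (if 0 \<le> Re (exp (- 2 * \<xi>)) then cmod (1 - exp (2 * \<xi>)) * abs_csc \<xi> else cmod (1 - exp (2 * \<xi>)))"
    unfolding seg_factor_def i abs_csc_exp using r by (auto simp del: Re_exp)
  have i': "1 - 1 / (- exp (- 2 * \<xi>)) = 1 + exp (2 * \<xi>)" unfolding divide_minus_right i by simp
  show 2: "seg_factor (- exp (- 2 * \<xi>)) = (if Re (exp (- 2 * \<xi>)) \<le> 0 then cmod (1 + exp (2 * \<xi>)) * abs_csc \<xi> else cmod (1 + exp (2 * \<xi>)))"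
    unfolding seg_factor_def i' norm_minus_cancel uminus_complex.sel abs_minus_cancel abs_csc_exp using r by (auto simp del: Re_exp)
  have p: "cmod (1 - exp (4 * \<xi>)) = cmod (1 - exp (2 * \<xi>)) * cmod (1 + exp (2 * \<xi>))"
    unfolding norm_mult[symmetric] by (simp add: algebra_simps flip: exp_add)
  have c1: "abs_csc \<xi> = 1" if "Re (exp (- 2 * \<xi>)) = 0"
  proof -
    have "cmod (exp (- 2 * \<xi>)) = \<bar>Im (exp (- 2 * \<xi>))\<bar>" using that unfolding cmod_def by simp
    thus ?thesis using strip_D_Im_exp(2)[OF \<xi>] abs_csc_exp(2)[of \<xi>] by simp
  qed
  show "seg_factor (exp (- 2 * \<xi>)) * seg_factor (- exp (- 2 * \<xi>)) = cmod (1 - exp (4 * \<xi>)) * abs_csc \<xi>"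
    unfolding 1 2 p using c1 by (cases "Re (exp (- 2 * \<xi>)) = 0") auto
qed

text \<open>When |Re W| \<ge> 1 one factor is 1 and the other carries no cosecant, which gives the
  alternatives of \<open>fac_T\<close> without a cosecant. On Re W = 0 the cosecant is again
  1.\<close>

lemma seg_factor_minus:
  assumes \<xi>: "\<xi> \<in> strip_D" "Im \<xi> \<noteq> 0"
  shows "seg_factor (exp (2 * \<xi>)) = (if 1 \<le> Re (exp (2 * \<xi>)) then 1 else if 0 \<le> Re (exp (2 * \<xi>)) then cmod (1 - exp (- 2 * \<xi>)) * abs_csc \<xi> else cmod (1 - exp (- 2 * \<xi>)))"
    "seg_factor (- exp (2 * \<xi>)) = (if Re (exp (2 * \<xi>)) \<le> -1 then 1 else if Re (exp (2 * \<xi>)) \<le> 0 then cmod (1 + exp (- 2 * \<xi>)) * abs_csc \<xi> else cmod (1 + exp (- 2 * \<xi>)))"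
    "seg_factor (exp (2 * \<xi>)) * seg_factor (- exp (2 * \<xi>)) = fac_T \<xi>"
proof -
  have i: "1 / exp (2 * \<xi>) = exp (- 2 * \<xi>)" by (simp add: exp_minus field_simps)
  show 1: "seg_factor (exp (2 * \<xi>)) = (if 1 \<le> Re (exp (2 * \<xi>)) then 1 else if 0 \<le> Re (exp (2 * \<xi>)) then cmod (1 - exp (- 2 * \<xi>)) * abs_csc \<xi> else cmod (1 - exp (- 2 * \<xi>)))"
    unfolding seg_factor_def i abs_csc_exp by (rule refl)
  have i': "1 - 1 / (- exp (2 * \<xi>)) = 1 + exp (- 2 * \<xi>)" unfolding divide_minus_right i by simp
  show 2: "seg_factor (- exp (2 * \<xi>)) = (if Re (exp (2 * \<xi>)) \<le> -1 then 1 else if Re (exp (2 * \<xi>)) \<le> 0 then cmod (1 + exp (- 2 * \<xi>)) * abs_csc \<xi> else cmod (1 + exp (- 2 * \<xi>)))"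
    unfolding seg_factor_def i' norm_minus_cancel uminus_complex.sel abs_minus_cancel abs_csc_exp by (auto simp del: Re_exp)
  have p: "cmod (1 - exp (- 4 * \<xi>)) = cmod (1 - exp (- 2 * \<xi>)) * cmod (1 + exp (- 2 * \<xi>))"
    unfolding norm_mult[symmetric] by (simp add: algebra_simps flip: exp_add)
  have c1: "abs_csc \<xi> = 1" if "Re (exp (2 * \<xi>)) = 0"
  proof -
    have "cmod (exp (2 * \<xi>)) = \<bar>Im (exp (2 * \<xi>))\<bar>" using that unfolding cmod_def by simp
    thus ?thesis using strip_D_Im_exp(1)[OF \<xi>] abs_csc_exp(1)[of \<xi>] by simp
  qed
  show "seg_factor (exp (2 * \<xi>)) * seg_factor (- exp (2 * \<xi>)) = fac_T \<xi>"
    unfolding 1 2 p fac_T_def using c1 by (cases "Re (exp (2 * \<xi>)) = 0") auto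
qed

section \<open>Truncated series and remainders in terms of \<xi>\<close>

lemma Gamma_appell_partial:
  "Gamma (\<sigma> + 2) * appell_partial N \<alpha> \<beta> \<sigma> x y =
     (\<Sum>n<N. (-1) ^ n * (\<Sum>l\<le>n. coeff_a l \<alpha> * coeff_a (n - l) \<beta> * (2 * x) ^ l * (2 * y) ^ (n - l)) * (Gamma (\<sigma> + 2) / Gamma (\<sigma> + of_nat n + 2)))"
  unfolding appell_partial_def sum_distrib_left sum_distrib_right
proof (intro sum.cong refl)
  fix n l :: nat assume "l \<in> {..n}"
  hence "(-2 :: complex) ^ n = (-1) ^ n * (2 ^ l * 2 ^ (n - l))"
    by (simp add: power_minus[of 2 n] flip: power_add)
  moreover have "rGamma (\<sigma> + 2 + of_nat n) = 1 / Gamma (\<sigma> + of_nat n + 2)"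
    by (simp add: rGamma_inverse_Gamma field_simps)
  ultimately show "Gamma (\<sigma> + 2) * ((-2) ^ n * coeff_a l \<alpha> * coeff_a (n - l) \<beta> * x ^ l * y ^ (n - l) * rGamma (\<sigma> + 2 + of_nat n)) =
     (-1) ^ n * (coeff_a l \<alpha> * coeff_a (n - l) \<beta> * (2 * x) ^ l * (2 * y) ^ (n - l)) * (Gamma (\<sigma> + 2) / Gamma (\<sigma> + of_nat n + 2))"
    by (simp add: power_mult_distrib)
qed

text \<open>All admissible pairs \<open>A\<close>, \<open>B\<close> give the same value of \<^const>\<open>jacobi_E\<close>, so the choice is immaterial; it
  makes the remainder a function of \<open>\<alpha>\<close> and \<open>\<beta>\<close> alone.\<close>

definition jacobi_remainder :: "nat \<Rightarrow> complex \<Rightarrow> complex \<Rightarrow> complex \<Rightarrow> complex \<Rightarrow> complex" where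
  "jacobi_remainder N \<sigma> \<alpha> \<beta> W = Gamma (\<sigma> + 2) *
     ((SOME e. \<exists>A B. primed \<alpha> A \<and> primed \<beta> B \<and> Re (\<sigma> + 1) > Re (A + B) \<and> e = jacobi_E A B \<sigma> W) -
      appell_partial N \<alpha> \<beta> \<sigma> (1 / (1 - W)) (1 / (1 + W)))"

lemma jacobi_remainder_eq:
  assumes W: "Im W \<noteq> 0" and p: "primed \<alpha> A" "primed \<beta> B" and re: "Re (\<sigma> + 1) > Re (A + B)"
  shows "jacobi_remainder N \<sigma> \<alpha> \<beta> W = Gamma (\<sigma> + 2) *
     (jacobi_E A B \<sigma> W - appell_partial N A B \<sigma> (1 / (1 - W)) (1 / (1 + W)))"
proof -
  have "(SOME e. \<exists>A B. primed \<alpha> A \<and> primed \<beta> B \<and> Re (\<sigma> + 1) > Re (A + B) \<and> e = jacobi_E A B \<sigma> W) = jacobi_E A B \<sigma> W"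
  proof (rule some_equality)
    fix e assume "\<exists>A B. primed \<alpha> A \<and> primed \<beta> B \<and> Re (\<sigma> + 1) > Re (A + B) \<and> e = jacobi_E A B \<sigma> W"
    then obtain A' B' where p': "primed \<alpha> A'" "primed \<beta> B'" and re': "Re (\<sigma> + 1) > Re (A' + B')" and e: "e = jacobi_E A' B' \<sigma> W" by blast
    show "e = jacobi_E A B \<sigma> W" unfolding e
      by (rule jacobi_E_symmetric[OF W primed_cases(2)[OF p(1)] primed_cases(2)[OF p(2)] re primed_cases(2)[OF p'(1)] primed_cases(2)[OF p'(2)] re'])
         (use primed_cases(1)[OF p(1)] primed_cases(1)[OF p(2)] primed_cases(1)[OF p'(1)] primed_cases(1)[OF p'(2)] in auto)
  qed (use p re in blast)
  moreover have "appell_partial N \<alpha> \<beta> \<sigma> x y = appell_partial N A B \<sigma> x y" for x y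
    unfolding appell_partial_def primed_cases(5)[OF p(1)] primed_cases(5)[OF p(2)] ..
  ultimately show ?thesis unfolding jacobi_remainder_def by simp
qed

lemma jacobi_remainder_bound:
  assumes W: "Im W \<noteq> 0" and p: "primed \<alpha> A" "primed \<beta> B" and re: "Re (\<sigma> + 1) > Re (A + B)"
  defines "X \<equiv> 2 * cmod (1 / (1 - W))" and "Y \<equiv> 2 * cmod (1 / (1 + W))"
  shows "-1/2 < Re \<alpha> \<Longrightarrow> Re \<alpha> < real N + 1/2 \<Longrightarrow> \<bar>Re \<beta>\<bar> < 1/2 \<Longrightarrow>
      cmod (jacobi_remainder N \<sigma> \<alpha> \<beta> W) \<le>
        kappa \<sigma> A B * fac_H N \<sigma> * rho 0 A * rho 0 B * hat_a N \<alpha> * hat_a 0 \<beta> * X ^ N * (seg_factor W * seg_factor (- W)) +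
        kappa \<sigma> A B * fac_H N \<sigma> * rho 0 B *
          (\<Sum>l<N. rho l A * cmod (coeff_a l \<alpha>) * hat_a (N - l) \<beta> * X ^ l * Y ^ (N - l)) * seg_factor (- W)" (is "_ \<Longrightarrow> _ \<Longrightarrow> _ \<Longrightarrow> ?R1")
    and "\<bar>Re \<alpha>\<bar> < 1/2 \<Longrightarrow> -1/2 < Re \<beta> \<Longrightarrow> Re \<beta> < real N + 1/2 \<Longrightarrow>
      cmod (jacobi_remainder N \<sigma> \<alpha> \<beta> W) \<le>
        kappa \<sigma> A B * fac_H N \<sigma> * rho 0 A * rho 0 B * hat_a 0 \<alpha> * hat_a N \<beta> * Y ^ N * (seg_factor W * seg_factor (- W)) +
        kappa \<sigma> A B * fac_H N \<sigma> * rho 0 A *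
          (\<Sum>l=1..N. rho (N - l) B * hat_a l \<alpha> * cmod (coeff_a (N - l) \<beta>) * X ^ l * Y ^ (N - l)) * seg_factor W" (is "_ \<Longrightarrow> _ \<Longrightarrow> _ \<Longrightarrow> ?R2")
    and "\<bar>Re \<alpha>\<bar> < 1/2 \<Longrightarrow> \<bar>Re \<beta>\<bar> < 1/2 \<Longrightarrow>
      cmod (jacobi_remainder N \<sigma> \<alpha> \<beta> W) \<le>
        kappa \<sigma> A B * fac_H N \<sigma> * rho 0 A * rho 0 B *
          (\<Sum>l\<le>N. hat_a l \<alpha> * hat_a (N - l) \<beta> * X ^ l * Y ^ (N - l)) * (seg_factor W * seg_factor (- W))" (is "_ \<Longrightarrow> _ \<Longrightarrow> ?R3")
proof -
  interpret appell_params A B "\<sigma> - A - B"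
    using primed_cases(2)[OF p(1)] primed_cases(2)[OF p(2)] re by unfold_locales auto
  have \<sigma>: "A + B + (\<sigma> - A - B) = \<sigma>" by simp
  have Sx: "1 / cmod (1 - of_real s * (1 / (1 - W))) \<le> seg_factor W" if "s \<in> {0..1}" for s by (rule seg_factor[OF W that])
  have Sy: "1 / cmod (1 - of_real s * (1 / (1 + W))) \<le> seg_factor (- W)" if "s \<in> {0..1}" for s using seg_factor[of "- W" s] W that by simp
  note xy = jacobi_E_xy_slit[OF W]
  note eq = jacobi_remainder_eq[OF W p re, unfolded jacobi_E_def]
  note h = primed_cases(4)[OF p(1)] primed_cases(4)[OF p(2)]
  have small: "Re \<mu>' < 1/2" "\<And>n. hat_a n \<mu>' = hat_a n \<mu>" if "primed \<mu> \<mu>'" "\<bar>Re \<mu>\<bar> < 1/2" for \<mu> \<mu>'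
    using primed_cases(3)[OF that(1), of 0] primed_cases(4)[OF that(1)] that(2) by (auto simp: abs_less_iff)
  note c = primed_cases(5)[OF p(1)] primed_cases(5)[OF p(2)]
  {
    assume a: "-1/2 < Re \<alpha>" "Re \<alpha> < real N + 1/2" "\<bar>Re \<beta>\<bar> < 1/2"
    show ?R1
      using appell_E_remainder_1[OF xy Sx Sy primed_cases(3)[OF p(1) a(1,2)] small(1)[OF p(2) a(3)]]
      unfolding \<sigma> small(2)[OF p(2) a(3)] h(1)[OF a(1,2)] c X_def Y_def eq .
  next
    assume a: "\<bar>Re \<alpha>\<bar> < 1/2" "-1/2 < Re \<beta>" "Re \<beta> < real N + 1/2"
    show ?R2
      using appell_E_remainder_2[OF xy Sx Sy primed_cases(3)[OF p(2) a(2,3)] small(1)[OF p(1) a(1)]]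
      unfolding \<sigma> small(2)[OF p(1) a(1)] h(2)[OF a(2,3)] c X_def Y_def eq .
  next
    assume a: "\<bar>Re \<alpha>\<bar> < 1/2" "\<bar>Re \<beta>\<bar> < 1/2"
    show ?R3
      using appell_E_remainder_3[OF xy Sx Sy small(1)[OF p(1) a(1)] small(1)[OF p(2) a(2)]]
      unfolding \<sigma> small(2)[OF p(1) a(1)] small(2)[OF p(2) a(2)] X_def Y_def eq .
  }
qed

text \<open>The minus sign at \<open>Xm\<close> produces the factor (-1)^l in g_n at -
  \<xi>.\<close>

lemma XY_cayley:
  "2 * (1 / (1 - exp (- 2 * \<xi>))) = Xp \<xi>" "2 * (1 / (1 + exp (- 2 * \<xi>))) = Yp \<xi>"
  "2 * (1 / (1 - exp (2 * \<xi>))) = - Xm \<xi>" "2 * (1 / (1 + exp (2 * \<xi>))) = Ym \<xi>"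
proof -
  have "2 * (1 / (- (exp (2 * \<xi>) + (-1)))) = - (2 / (exp (2 * \<xi>) + (-1)))" by (simp only: divide_minus_right times_divide_eq_right mult_minus_right mult_1_right)
  thus "2 * (1 / (1 - exp (2 * \<xi>))) = - Xm \<xi>" unfolding XY_alt by simp
qed (simp_all add: XY_alt add.commute)

lemma jacobi_P_exact:
  assumes \<xi>: "\<xi> \<in> strip_D" "Im \<xi> \<noteq> 0" and \<nu>: "\<nu> + \<alpha> \<notin> of_int ` {..<0}"
    and p: "primed \<alpha> A" "primed \<beta> B" and re: "Re (2 * \<nu> + \<alpha> + \<beta> + 1) > Re (A + B)"
  shows "of_real pi * jacobi_P \<nu> \<alpha> \<beta> (cosh (2 * \<xi>)) / (2 powr (2 * \<nu> + \<alpha> + \<beta>) * Beta (\<nu> + \<alpha> + 1) (\<nu> + \<beta> + 1)) =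
     Gamma (2 * \<nu> + \<alpha> + \<beta> + 2) * jacobi_rhs \<nu> \<alpha> \<beta> A B \<xi>"
proof -
  let ?F = "reg_2F1 (- \<nu>) (\<nu> + \<alpha> + \<beta> + 1) (\<alpha> + 1) (- (sinh \<xi> ^ 2))"
  \<comment> \<open>\<open>Gamma\<close> is 0 by convention at its poles, so cancelling it between
    the Jacobi function and the beta function requires that \<nu> + \<alpha> + 1 is not a
    pole.\<close>
  have "\<nu> + \<alpha> + 1 \<notin> \<int>\<^sub>\<le>\<^sub>0"
  proof
    assume "\<nu> + \<alpha> + 1 \<in> \<int>\<^sub>\<le>\<^sub>0"
    then obtain k :: int where k: "k \<le> 0" "\<nu> + \<alpha> + 1 = of_int k" by (elim nonpos_Ints_cases)
    hence "\<nu> + \<alpha> = of_int (k - 1)" by (simp add: algebra_simps)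
    hence "\<nu> + \<alpha> \<in> of_int ` {..<0}" using k(1) by (intro image_eqI[of _ _ "k - 1"]) auto
    thus False using \<nu> by blast
  qed
  hence G: "Gamma (\<nu> + \<alpha> + 1) \<noteq> 0" by (simp add: Gamma_eq_zero_iff)
  have z: "(1 - cosh (2 * \<xi>)) / 2 = - (sinh \<xi> ^ 2)" by (simp add: cosh_double cosh_square_eq)
  have s: "\<nu> + \<alpha> + 1 + (\<nu> + \<beta> + 1) = 2 * \<nu> + \<alpha> + \<beta> + 2" by simp
  have B: "Beta (\<nu> + \<alpha> + 1) (\<nu> + \<beta> + 1) = Gamma (\<nu> + \<alpha> + 1) * Gamma (\<nu> + \<beta> + 1) / Gamma (2 * \<nu> + \<alpha> + \<beta> + 2)"
    unfolding Beta_def s by (simp add: rGamma_inverse_Gamma divide_inverse)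
  have "of_real pi * jacobi_P \<nu> \<alpha> \<beta> (cosh (2 * \<xi>)) / (2 powr (2 * \<nu> + \<alpha> + \<beta>) * Beta (\<nu> + \<alpha> + 1) (\<nu> + \<beta> + 1)) =
     Gamma (2 * \<nu> + \<alpha> + \<beta> + 2) * (of_real pi * 2 powr (- (2 * \<nu> + \<alpha> + \<beta>)) * rGamma (\<nu> + 1) * rGamma (\<nu> + \<beta> + 1) * ?F)"
    unfolding jacobi_P_def z B powr_minus rGamma_inverse_Gamma[of "\<nu> + \<beta> + 1"] using G by (simp add: divide_simps)
  also have "of_real pi * 2 powr (- (2 * \<nu> + \<alpha> + \<beta>)) * rGamma (\<nu> + 1) * rGamma (\<nu> + \<beta> + 1) * ?F = jacobi_rhs \<nu> \<alpha> \<beta> A B \<xi>"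
    by (rule reg_2F1_eq_jacobi_rhs[OF \<xi> primed_cases(1)[OF p(1)] primed_cases(1)[OF p(2)] primed_cases(2)[OF p(1)] primed_cases(2)[OF p(2)] re])
  finally show ?thesis .
qed

lemma jacobi_expansion:
  assumes \<xi>: "\<xi> \<in> strip_D" "Im \<xi> \<noteq> 0" and p: "primed \<alpha> A" "primed \<beta> B" and re: "Re (\<sigma> + 1) > Re (A + B)"
  shows "Gamma (\<sigma> + 2) * jacobi_E A B \<sigma> (exp (- 2 * \<xi>)) =
      (\<Sum>n<N. (-1) ^ n * coeff_g n \<xi> \<alpha> \<beta> * (Gamma (\<sigma> + 2) / Gamma (\<sigma> + of_nat n + 2))) + jacobi_remainder N \<sigma> \<alpha> \<beta> (exp (- 2 * \<xi>))"
    and "Gamma (\<sigma> + 2) * jacobi_E A B \<sigma> (exp (2 * \<xi>)) =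
      (\<Sum>n<N. (-1) ^ n * coeff_g n (- \<xi>) \<alpha> \<beta> * (Gamma (\<sigma> + 2) / Gamma (\<sigma> + of_nat n + 2))) + jacobi_remainder N \<sigma> \<alpha> \<beta> (exp (2 * \<xi>))"
proof -
  have g1: "(\<Sum>l\<le>n. coeff_a l A * coeff_a (n - l) B * Xp \<xi> ^ l * Yp \<xi> ^ (n - l)) = coeff_g n \<xi> \<alpha> \<beta>" for n
    unfolding coeff_g_XY(1) primed_cases(5)[OF p(1)] primed_cases(5)[OF p(2)] ..
  have g2: "(\<Sum>l\<le>n. coeff_a l A * coeff_a (n - l) B * (- Xm \<xi>) ^ l * Ym \<xi> ^ (n - l)) = coeff_g n (- \<xi>) \<alpha> \<beta>" for n
    unfolding coeff_g_XY(2) power_minus[of "Xm \<xi>"] primed_cases(5)[OF p(1)] primed_cases(5)[OF p(2)] by (simp add: mult_ac)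
  show "Gamma (\<sigma> + 2) * jacobi_E A B \<sigma> (exp (- 2 * \<xi>)) =
      (\<Sum>n<N. (-1) ^ n * coeff_g n \<xi> \<alpha> \<beta> * (Gamma (\<sigma> + 2) / Gamma (\<sigma> + of_nat n + 2))) + jacobi_remainder N \<sigma> \<alpha> \<beta> (exp (- 2 * \<xi>))"
    unfolding jacobi_remainder_eq[OF strip_D_Im_exp(2)[OF \<xi>] p re] right_diff_distrib Gamma_appell_partial XY_cayley g1 g2 by simp
  show "Gamma (\<sigma> + 2) * jacobi_E A B \<sigma> (exp (2 * \<xi>)) =
      (\<Sum>n<N. (-1) ^ n * coeff_g n (- \<xi>) \<alpha> \<beta> * (Gamma (\<sigma> + 2) / Gamma (\<sigma> + of_nat n + 2))) + jacobi_remainder N \<sigma> \<alpha> \<beta> (exp (2 * \<xi>))"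
    unfolding jacobi_remainder_eq[OF strip_D_Im_exp(1)[OF \<xi>] p re] right_diff_distrib Gamma_appell_partial XY_cayley g1 g2 by simp
qed


text \<open>The two remainders are quantified first and take only their own truncation index and
  \<nu>, \<xi>, \<alpha>, \<beta>. Thus their independence of the other index, and of the choice of
  \<alpha>' and \<beta>', is part of the claim.\<close>

theorem theorem2p4:
  shows "\<exists>RP1 RP2 :: nat \<Rightarrow> complex \<Rightarrow> complex \<Rightarrow> complex \<Rightarrow> complex \<Rightarrow> complex.
    \<forall>(N::nat) (M::nat) (\<nu>::complex) (\<xi>::complex) (\<alpha>::complex) (\<beta>::complex) (\<alpha>'::complex) (\<beta>'::complex).
      \<xi> \<in> strip_D - complex_of_real ` {0<..} \<and>
      \<nu> + \<alpha> \<notin> of_int ` {..<0} \<and> \<nu> + \<beta> \<notin> of_int ` {..<0} \<and>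
      primed \<alpha> \<alpha>' \<and> primed \<beta> \<beta>' \<and>
      Re (2 * \<nu> + \<alpha> + \<beta> + 1) > Re (\<alpha>' + \<beta>') \<longrightarrow>
      (let \<sigma> = 2 * \<nu> + \<alpha> + \<beta>; \<kappa> = kappa \<sigma> \<alpha>' \<beta>' in
        of_real pi * jacobi_P \<nu> \<alpha> \<beta> (cosh (2 * \<xi>)) / (2 powr \<sigma> * Beta (\<nu> + \<alpha> + 1) (\<nu> + \<beta> + 1)) =
          Xp \<xi> powr (\<alpha> + 1/2) * Yp \<xi> powr (\<beta> + 1/2) * exp (2 * \<nu> * \<xi>) *
            ((\<Sum>n<N. (-1) ^ n * coeff_g n \<xi> \<alpha> \<beta> * (Gamma (\<sigma> + 2) / Gamma (\<sigma> + of_nat n + 2)))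
              + RP1 N \<nu> \<xi> \<alpha> \<beta>)
          - conn_C \<xi> \<alpha> * Xm \<xi> powr (\<alpha> + 1/2) * Ym \<xi> powr (\<beta> + 1/2) * exp (- 2 * \<nu> * \<xi>) *
            ((\<Sum>m<M. (-1) ^ m * coeff_g m (- \<xi>) \<alpha> \<beta> * (Gamma (\<sigma> + 2) / Gamma (\<sigma> + of_nat m + 2)))
              + RP2 M \<nu> \<xi> \<alpha> \<beta>)
        \<and>
        \<comment> \<open>(i)\<close>
        (-1/2 < Re \<alpha> \<and> Re \<alpha> < real N + 1/2 \<and> \<bar>Re \<beta>\<bar> < 1/2 \<longrightarrow>
          cmod (RP1 N \<nu> \<xi> \<alpha> \<beta>) \<le>
            \<kappa> * fac_H N \<sigma> * rho 0 \<alpha>' * rho 0 \<beta>' * hat_a N \<alpha> * hat_a 0 \<beta> * cmod (Xp \<xi>) ^ N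
              * cmod (1 - exp (4 * \<xi>)) * abs_csc \<xi>
            + \<kappa> * fac_H N \<sigma> * rho 0 \<beta>'
              * (\<Sum>l<N. rho l \<alpha>' * cmod (coeff_a l \<alpha>) * hat_a (N - l) \<beta>
                          * cmod (Xp \<xi>) ^ l * cmod (Yp \<xi>) ^ (N - l))
              * (if Re (exp (- 2 * \<xi>)) \<le> 0 then cmod (1 + exp (2 * \<xi>)) * abs_csc \<xi>
                 else cmod (1 + exp (2 * \<xi>))))
        \<and>
        \<comment> \<open>(ii)\<close>
        (\<bar>Re \<alpha>\<bar> < 1/2 \<and> -1/2 < Re \<beta> \<and> Re \<beta> < real N + 1/2 \<longrightarrow>
          cmod (RP1 N \<nu> \<xi> \<alpha> \<beta>) \<le>
            \<kappa> * fac_H N \<sigma> * rho 0 \<alpha>' * rho 0 \<beta>' * hat_a 0 \<alpha> * hat_a N \<beta> * cmod (Yp \<xi>) ^ N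
              * cmod (1 - exp (4 * \<xi>)) * abs_csc \<xi>
            + \<kappa> * fac_H N \<sigma> * rho 0 \<alpha>'
              * (\<Sum>l=1..N. rho (N - l) \<beta>' * hat_a l \<alpha> * cmod (coeff_a (N - l) \<beta>)
                          * cmod (Xp \<xi>) ^ l * cmod (Yp \<xi>) ^ (N - l))
              * (if 0 \<le> Re (exp (- 2 * \<xi>)) then cmod (1 - exp (2 * \<xi>)) * abs_csc \<xi>
                 else cmod (1 - exp (2 * \<xi>))))
        \<and>
        \<comment> \<open>(iii)\<close>
        (\<bar>Re \<alpha>\<bar> < 1/2 \<and> \<bar>Re \<beta>\<bar> < 1/2 \<longrightarrow>
          cmod (RP1 N \<nu> \<xi> \<alpha> \<beta>) \<le>
            \<kappa> * fac_H N \<sigma> * rho 0 \<alpha>' * rho 0 \<beta>'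
              * (\<Sum>l\<le>N. hat_a l \<alpha> * hat_a (N - l) \<beta> * cmod (Xp \<xi>) ^ l * cmod (Yp \<xi>) ^ (N - l))
              * (cmod (1 - exp (4 * \<xi>)) * abs_csc \<xi>))
        \<and>
        \<comment> \<open>(iv)\<close>
        (-1/2 < Re \<alpha> \<and> Re \<alpha> < real M + 1/2 \<and> \<bar>Re \<beta>\<bar> < 1/2 \<longrightarrow>
          cmod (RP2 M \<nu> \<xi> \<alpha> \<beta>) \<le>
            \<kappa> * fac_H M \<sigma> * rho 0 \<alpha>' * rho 0 \<beta>' * hat_a M \<alpha> * hat_a 0 \<beta> * cmod (Xm \<xi>) ^ M
              * fac_T \<xi>
            + \<kappa> * fac_H M \<sigma> * rho 0 \<beta>'
              * (\<Sum>l<M. rho l \<alpha>' * cmod (coeff_a l \<alpha>) * hat_a (M - l) \<beta>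
                          * cmod (Xm \<xi>) ^ l * cmod (Ym \<xi>) ^ (M - l))
              * (if Re (exp (2 * \<xi>)) \<le> -1 then 1
                 else if Re (exp (2 * \<xi>)) \<le> 0 then cmod (1 + exp (- 2 * \<xi>)) * abs_csc \<xi>
                 else cmod (1 + exp (- 2 * \<xi>))))
        \<and>
        \<comment> \<open>(v)\<close>
        (\<bar>Re \<alpha>\<bar> < 1/2 \<and> -1/2 < Re \<beta> \<and> Re \<beta> < real M + 1/2 \<longrightarrow>
          cmod (RP2 M \<nu> \<xi> \<alpha> \<beta>) \<le>
            \<kappa> * fac_H M \<sigma> * rho 0 \<alpha>' * rho 0 \<beta>' * hat_a 0 \<alpha> * hat_a M \<beta> * cmod (Ym \<xi>) ^ M
              * fac_T \<xi>
            + \<kappa> * fac_H M \<sigma> * rho 0 \<alpha>'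
              * (\<Sum>l=1..M. rho (M - l) \<beta>' * hat_a l \<alpha> * cmod (coeff_a (M - l) \<beta>)
                          * cmod (Xm \<xi>) ^ l * cmod (Ym \<xi>) ^ (M - l))
              * (if 1 \<le> Re (exp (2 * \<xi>)) then 1
                 else if 0 \<le> Re (exp (2 * \<xi>)) then cmod (1 - exp (- 2 * \<xi>)) * abs_csc \<xi>
                 else cmod (1 - exp (- 2 * \<xi>))))
        \<and>
        \<comment> \<open>(vi)\<close>
        (\<bar>Re \<alpha>\<bar> < 1/2 \<and> \<bar>Re \<beta>\<bar> < 1/2 \<longrightarrow>
          cmod (RP2 M \<nu> \<xi> \<alpha> \<beta>) \<le>
            \<kappa> * fac_H M \<sigma> * rho 0 \<alpha>' * rho 0 \<beta>'
              * (\<Sum>l\<le>M. hat_a l \<alpha> * hat_a (M - l) \<beta> * cmod (Xm \<xi>) ^ l * cmod (Ym \<xi>) ^ (M - l))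
              * fac_T \<xi>))"
proof (rule exI[of _ "\<lambda>N \<nu> \<xi> \<alpha> \<beta>. jacobi_remainder N (2 * \<nu> + \<alpha> + \<beta>) \<alpha> \<beta> (exp (- 2 * \<xi>))"],
    rule exI[of _ "\<lambda>N \<nu> \<xi> \<alpha> \<beta>. jacobi_remainder N (2 * \<nu> + \<alpha> + \<beta>) \<alpha> \<beta> (exp (2 * \<xi>))"], intro allI impI, elim conjE, goal_cases)
  case (1 N M \<nu> \<xi> \<alpha> \<beta> \<alpha>' \<beta>')
  note \<xi>' = 1(1) and \<nu> = 1(2) and p = 1(4,5) and re = 1(6)
  have \<xi>: "\<xi> \<in> strip_D" "Im \<xi> \<noteq> 0"
  proof -
    show D: "\<xi> \<in> strip_D" using \<xi>' by blast
    show "Im \<xi> \<noteq> 0"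
    proof
      assume "Im \<xi> = 0"
      hence "\<xi> = of_real (Re \<xi>)" by (simp add: complex_eq_iff)
      moreover have "Re \<xi> \<in> {0<..}" using D by (simp add: strip_D_def)
      ultimately show False using \<xi>' by blast
    qed
  qed
  define \<sigma> where "\<sigma> = 2 * \<nu> + \<alpha> + \<beta>"
  note re\<sigma> = re[folded \<sigma>_def]
  note ex = jacobi_expansion[OF \<xi> p re\<sigma>]
  have nX: "2 * cmod (1 / (1 - exp (- 2 * \<xi>))) = cmod (Xp \<xi>)" "2 * cmod (1 / (1 + exp (- 2 * \<xi>))) = cmod (Yp \<xi>)"
    "2 * cmod (1 / (1 - exp (2 * \<xi>))) = cmod (Xm \<xi>)" "2 * cmod (1 / (1 + exp (2 * \<xi>))) = cmod (Ym \<xi>)"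
    unfolding norm_minus_cancel[of "Xm \<xi>", symmetric] XY_cayley[symmetric] by (simp_all only: norm_mult norm_numeral)
  \<comment> \<open>The product of the two factors is rewritten first, since the equations for the
    single factors would break it up.\<close>
  note bp = jacobi_remainder_bound[OF strip_D_Im_exp(2)[OF \<xi>] p re\<sigma>, unfolded seg_factor_plus(3)[OF \<xi>],
      unfolded seg_factor_plus(1,2)[OF \<xi>] nX mult.assoc]
  note bm = jacobi_remainder_bound[OF strip_D_Im_exp(1)[OF \<xi>] p re\<sigma>, unfolded seg_factor_minus(3)[OF \<xi>],
      unfolded seg_factor_minus(1,2)[OF \<xi>] nX mult.assoc]
  show ?case
    unfolding Let_def \<sigma>_def[symmetric]
  proof (intro conjI impI, goal_cases)
    case 1
    show ?case
      unfolding ex[symmetric] jacobi_P_exact[OF \<xi> \<nu> p re, folded \<sigma>_def] jacobi_rhs_def \<sigma>_def[symmetric]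
      by (simp only: right_diff_distrib mult_ac)
  next
    case 2
    thus ?case unfolding mult.assoc by (elim conjE) (rule bp(1))
  next
    case 3
    thus ?case unfolding mult.assoc by (elim conjE) (rule bp(2))
  next
    case 4
    thus ?case unfolding mult.assoc by (elim conjE) (rule bp(3))
  next
    case 5
    thus ?case unfolding mult.assoc by (elim conjE) (rule bm(1))
  next
    case 6
    thus ?case unfolding mult.assoc by (elim conjE) (rule bm(2))
  next
    case 7
    thus ?case unfolding mult.assoc by (elim conjE) (rule bm(3))
  qed
qed

end
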